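(* Let $I\subset\mathscr L_1$ be an ideal of $B(H)$ contained in the trace class and let $\xi\in(\ell^1)^*$. Then the following conditions are equivalent. (i) $\xi\in\Sigma(I^{-\infty})$. (ii) $\xi\prec_\infty\eta$ for some $\eta\in\Sigma(I)$. (ii$'$) $\xi\preccurlyeq_\infty\eta$ for some $\eta\in\Sigma(I)$. (ii$''$) $\eta\preccurlyeq\xi$ for some $\eta\in\Sigma(I)$. (iii) $P\xi\in\Sigma(I)$ for some column-stochastic matrix $P$. (iii$'$) $Q\xi\in\Sigma(I)$ for some block orthostochastic matrix $Q$. (iv) $E(V\operatorname{diag}\xi\,V^* )\in I$ for some isometry $V\in B(H)$. (iv$'$) $E(U\operatorname{diag}\xi\,U^* )\in I$ for some matrix $U$ that is a direct sum of finite orthogonal matrices.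
   Context: $\mathbb N=\{1,2,\dots\}$. $c_0^*$ is the cone of nonincreasing sequences of nonnegative reals converging to $0$, and $(\ell^1)^*\subset c_0^*$ the subcone of summable ones (not dual spaces). For $\xi,\eta\in c_0^*$: $\xi\prec\eta$ means $\sum_{j=1}^n\xi_j\le\sum_{j=1}^n\eta_j$ for all $n\in\mathbb N$; $\xi\preccurlyeq\eta$ means $\xi\prec\eta$ and $\liminf_n\sum_{j=1}^n(\eta_j-\xi_j)=0$. For $\xi,\eta\in(\ell^1)^*$: $\xi\prec_\infty\eta$ means $\sum_{j=n}^\infty\xi_j\le\sum_{j=n}^\infty\eta_j$ for all $n\in\mathbb N$; $\xi\preccurlyeq_\infty\eta$ means $\xi\prec_\infty\eta$ and $\sum_{j=1}^\infty\xi_j=\sum_{j=1}^\infty\eta_j$. $H$ is a separable infinite-dimensional Hilbert space with a fixed orthonormal basis $\{e_n\}_{n\in\mathbb N}$; operators are identified with their matrices in this basis. $\operatorname{diag}\xi$ is the diagonal operator with diagonal $\xi$, and $E$ is the conditional expectation of $B(H)$ onto the diagonal operators, i.e. $E(A)$ is the main diagonal of $A$. An ideal is a two-sided ideal of $B(H)$; for an ideal $I$ of compact operators its characteristic set is $\Sigma(I)=\{s(X): X\in I\}\subset c_0^*$, where $s(X)$ is the singular number sequence of $X$ (eigenvalues of $|X|$ in decreasing order, repeated with multiplicity). $I\mapsto\Sigma(I)$ is a bijection from ideals of compact operators onto the hereditary (solid) subcones of $c_0^*$ invariant under all ampliations $\xi\mapsto\langle\xi_1,\dots,\xi_1,\xi_2,\dots,\xi_2,\dots\rangle$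 (each entry repeated $m$ times). $\mathscr L_1$ is the trace class. For $\xi\in(\ell^1)^*$, $\xi_{a_\infty}:=\langle\frac1n\sum_{j=n+1}^\infty\xi_j\rangle_n$. The ideals ${}_{a_\infty}I$ and $I_{a_\infty}$ are defined by $\Sigma({}_{a_\infty}I)=\{\xi\in(\ell^1)^*:\xi_{a_\infty}\in\Sigma(I)\}$ and $\Sigma(I_{a_\infty})=\{\xi\in c_0^*:\xi=O(\eta_{a_\infty})\text{ for some }\eta\in\Sigma(I\cap\mathscr L_1)\}$, and the am-$\infty$ closure of $I$ is $I^{-\infty}:={}_{a_\infty}(I_{a_\infty})$. Infinite matrices are indexed by $\mathbb N\times\mathbb N$ and $(P\rho)_i=\sum_jP_{ij}\rho_j$. A matrix with nonnegative entries is substochastic if all its row and column sums are at most $1$, and column-stochastic if it is substochastic with all column sums equal to $1$. An orthogonal matrix is a unitary matrix with real entries. A matrix $Q$ is block orthostochastic if $Q_{ij}=(U_{ij})^2$ for a matrix $U$ which is a direct sum of finite orthogonal matrices.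
   Formalization: The equivalence of (i) with the other conditions is stated only for I ≠ {0}: for I = {0} and ξ = (1,0,0,…), ξ_{a_∞} = 0 gives (i) while (ii) fails. The other seven conditions are proved equivalent for every I, including {0}. *)

theory Defs
  imports "HOL-Analysis.Analysis" "HOL-Library.Landau_Symbols"
begin

section \<open>Complex Hilbert spaces and their bounded operators\<close>

text \<open>
  A complex Hilbert space; the inner product is linear in its first argument.
  Completeness and the underlying real normed space come from \<^class>\<open>banach\<close>.
\<close>

class chilbert = banach +
  fixes scaleC :: "complex \<Rightarrow> 'a \<Rightarrow> 'a" (infixr \<open>*\<^sub>C\<close> 75)
    and cinner :: "'a \<Rightarrow> 'a \<Rightarrow> complex"
  assumes scaleC_add_right: "a *\<^sub>C (x + y) = a *\<^sub>C x + a *\<^sub>C y"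
    and scaleC_add_left: "(a + b) *\<^sub>C x = a *\<^sub>C x + b *\<^sub>C x"
    and scaleC_scaleC: "a *\<^sub>C (b *\<^sub>C x) = (a * b) *\<^sub>C x"
    and scaleC_one: "1 *\<^sub>C x = x"
    and scaleR_scaleC: "r *\<^sub>R x = complex_of_real r *\<^sub>C x"
    and cinner_commute: "cinner x y = cnj (cinner y x)"
    and cinner_add_left: "cinner (x + y) z = cinner x z + cinner y z"
    and cinner_scaleC_left: "cinner (a *\<^sub>C x) y = a * cinner x y"
    and norm_eq_sqrt_cinner: "norm x = sqrt (Re (cinner x x))"

global_interpretation complex_vector:
  vector_space "scaleC :: complex \<Rightarrow> 'a \<Rightarrow> 'a::chilbert"
  by unfold_locales
    (simp_all add: scaleC_add_right scaleC_add_left scaleC_scaleC scaleC_one)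

definition orthonormal_basis :: "(nat \<Rightarrow> 'h::chilbert) \<Rightarrow> bool" where
  "orthonormal_basis e \<longleftrightarrow>
     (\<forall>i j. cinner (e i) (e j) = (if i = j then 1 else 0)) \<and>
     (\<forall>x. (\<lambda>n. cinner x (e n) *\<^sub>C e n) sums x)"

text \<open>
  The type of bounded linear functions in the library is real linear; \<open>B(H)\<close> is its
  subset of complex linear elements.
\<close>

definition bops :: "('h::chilbert \<Rightarrow>\<^sub>L 'h) set" where
  "bops = {A. \<forall>c x. blinfun_apply A (c *\<^sub>C x) = c *\<^sub>C blinfun_apply A x}"

definition adj :: "('h::chilbert \<Rightarrow>\<^sub>L 'h) \<Rightarrow> ('h \<Rightarrow>\<^sub>L 'h)" where
  "adj A = (THE B. B \<in> bops \<and>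
     (\<forall>x y. cinner (blinfun_apply A x) y = cinner x (blinfun_apply B y)))"

definition positive_op :: "('h::chilbert \<Rightarrow>\<^sub>L 'h) \<Rightarrow> bool" where
  "positive_op A \<longleftrightarrow> A \<in> bops \<and>
     (\<forall>x. cinner (blinfun_apply A x) x \<in> \<real> \<and> 0 \<le> Re (cinner (blinfun_apply A x) x))"

definition op_abs :: "('h::chilbert \<Rightarrow>\<^sub>L 'h) \<Rightarrow> ('h \<Rightarrow>\<^sub>L 'h)" where
  "op_abs X = (THE A. positive_op A \<and> A o\<^sub>L A = adj X o\<^sub>L X)"

definition compact_op :: "('h::chilbert \<Rightarrow>\<^sub>L 'h) \<Rightarrow> bool" where
  "compact_op X \<longleftrightarrow> X \<in> bops \<and> compact (closure (blinfun_apply X ` ball 0 1))"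

definition isometry_op :: "('h::chilbert \<Rightarrow>\<^sub>L 'h) \<Rightarrow> bool" where
  "isometry_op V \<longleftrightarrow> V \<in> bops \<and> (\<forall>x. norm (blinfun_apply V x) = norm x)"

definition op_matrix :: "(nat \<Rightarrow> 'h::chilbert) \<Rightarrow> ('h \<Rightarrow>\<^sub>L 'h) \<Rightarrow> nat \<Rightarrow> nat \<Rightarrow> complex" where
  "op_matrix e A i j = cinner (blinfun_apply A (e j)) (e i)"

text \<open>Meaningful for bounded \<open>a\<close> only.\<close>

definition diag_op :: "(nat \<Rightarrow> 'h::chilbert) \<Rightarrow> (nat \<Rightarrow> complex) \<Rightarrow> ('h \<Rightarrow>\<^sub>L 'h)" where
  "diag_op e a = Blinfun (\<lambda>x. \<Sum>n. (a n * cinner x (e n)) *\<^sub>C e n)"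

definition cond_exp :: "(nat \<Rightarrow> 'h::chilbert) \<Rightarrow> ('h \<Rightarrow>\<^sub>L 'h) \<Rightarrow> ('h \<Rightarrow>\<^sub>L 'h)" where
  "cond_exp e A = diag_op e (\<lambda>n. op_matrix e A n n)"


section \<open>Sequences and majorization\<close>

text \<open>
  Sequences are indexed from \<open>0\<close>: the entry \<open>\<xi> n\<close> is the mathematical \<open>\<xi>\<^sub>n\<^sub>+\<^sub>1\<close>.
\<close>

definition c0star :: "(nat \<Rightarrow> real) set" where
  "c0star = {\<xi>. decseq \<xi> \<and> (\<forall>n. 0 \<le> \<xi> n) \<and> \<xi> \<longlonglongrightarrow> 0}"

definition l1star :: "(nat \<Rightarrow> real) set" where
  "l1star = {\<xi> \<in> c0star. summable \<xi>}"

definition majorized :: "(nat \<Rightarrow> real) \<Rightarrow> (nat \<Rightarrow> real) \<Rightarrow> bool" where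
  "majorized \<xi> \<eta> \<longleftrightarrow> (\<forall>n. (\<Sum>j<n. \<xi> j) \<le> (\<Sum>j<n. \<eta> j))"

definition strongly_majorized :: "(nat \<Rightarrow> real) \<Rightarrow> (nat \<Rightarrow> real) \<Rightarrow> bool" where
  "strongly_majorized \<xi> \<eta> \<longleftrightarrow>
     majorized \<xi> \<eta> \<and> liminf (\<lambda>n. ereal (\<Sum>j<n. \<eta> j - \<xi> j)) = 0"

definition majorized_inf :: "(nat \<Rightarrow> real) \<Rightarrow> (nat \<Rightarrow> real) \<Rightarrow> bool" where
  "majorized_inf \<xi> \<eta> \<longleftrightarrow> (\<forall>n. (\<Sum>j. \<xi> (j + n)) \<le> (\<Sum>j. \<eta> (j + n)))"

definition strongly_majorized_inf :: "(nat \<Rightarrow> real) \<Rightarrow> (nat \<Rightarrow> real) \<Rightarrow> bool" where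
  "strongly_majorized_inf \<xi> \<eta> \<longleftrightarrow> majorized_inf \<xi> \<eta> \<and> (\<Sum>j. \<xi> j) = (\<Sum>j. \<eta> j)"

text \<open>
  With indices from \<open>1\<close> this is \<open>(1/n) (\<Sum>j>n. \<xi>\<^sub>j)\<close>.
\<close>

definition amean_inf :: "(nat \<Rightarrow> real) \<Rightarrow> nat \<Rightarrow> real" where
  "amean_inf \<xi> n = (\<Sum>j. \<xi> (j + Suc n)) / real (Suc n)"


section \<open>Singular numbers and ideals\<close>

text \<open>
  For compact \<open>X\<close>: the eigenvalues of \<open>|X|\<close> in decreasing order, each \<open>t > 0\<close> occurring as
  often as the complex dimension of its eigenspace, followed by zeros if there are only
  finitely many positive eigenvalues.
\<close>

definition singular_numbers :: "('h::chilbert \<Rightarrow>\<^sub>L 'h) \<Rightarrow> nat \<Rightarrow> real" where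
  "singular_numbers X = (THE s. s \<in> c0star \<and>
     (\<forall>t>0. card {n. s n = t} =
        complex_vector.dim {x. blinfun_apply (op_abs X) x = complex_of_real t *\<^sub>C x}))"

definition op_ideal :: "('h::chilbert \<Rightarrow>\<^sub>L 'h) set \<Rightarrow> bool" where
  "op_ideal I \<longleftrightarrow> I \<subseteq> bops \<and> 0 \<in> I \<and> (\<forall>X\<in>I. \<forall>Y\<in>I. X + Y \<in> I) \<and>
     (\<forall>X\<in>I. \<forall>A\<in>bops. A o\<^sub>L X \<in> I \<and> X o\<^sub>L A \<in> I)"

definition trace_class :: "('h::chilbert \<Rightarrow>\<^sub>L 'h) set" where
  "trace_class = {X. compact_op X \<and> summable (singular_numbers X)}"

text \<open>
  The characteristic set of an ideal of compact operators, and the inverse map, sending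
  a characteristic set to its ideal.
\<close>

definition charset :: "('h::chilbert \<Rightarrow>\<^sub>L 'h) set \<Rightarrow> (nat \<Rightarrow> real) set" where
  "charset I = singular_numbers ` I"

definition ideal_of_charset :: "(nat \<Rightarrow> real) set \<Rightarrow> ('h::chilbert \<Rightarrow>\<^sub>L 'h) set" where
  "ideal_of_charset S = {X. compact_op X \<and> singular_numbers X \<in> S}"

text \<open>The ideals \<open>\<^sub>aI\<close> and \<open>I\<^sub>a\<close> for \<open>a = a\<^sub>\<infinity>\<close>, and the am-\<open>\<infinity>\<close> closure.\<close>

definition pre_ainf :: "('h::chilbert \<Rightarrow>\<^sub>L 'h) set \<Rightarrow> ('h \<Rightarrow>\<^sub>L 'h) set" where
  "pre_ainf I = ideal_of_charset {\<xi> \<in> l1star. amean_inf \<xi> \<in> charset I}"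

definition post_ainf :: "('h::chilbert \<Rightarrow>\<^sub>L 'h) set \<Rightarrow> ('h \<Rightarrow>\<^sub>L 'h) set" where
  "post_ainf I = ideal_of_charset
     {\<xi> \<in> c0star. \<exists>\<eta> \<in> charset (I \<inter> trace_class). \<xi> \<in> O(amean_inf \<eta>)}"

definition am_inf_closure :: "('h::chilbert \<Rightarrow>\<^sub>L 'h) set \<Rightarrow> ('h \<Rightarrow>\<^sub>L 'h) set" where
  "am_inf_closure I = pre_ainf (post_ainf I)"


section \<open>Infinite matrices\<close>

definition mat_apply :: "(nat \<Rightarrow> nat \<Rightarrow> real) \<Rightarrow> (nat \<Rightarrow> real) \<Rightarrow> nat \<Rightarrow> real" where
  "mat_apply P \<rho> i = (\<Sum>j. P i j * \<rho> j)"

definition substochastic :: "(nat \<Rightarrow> nat \<Rightarrow> real) \<Rightarrow> bool" where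
  "substochastic P \<longleftrightarrow> (\<forall>i j. 0 \<le> P i j) \<and>
     (\<forall>i. summable (\<lambda>j. P i j) \<and> (\<Sum>j. P i j) \<le> 1) \<and>
     (\<forall>j. summable (\<lambda>i. P i j) \<and> (\<Sum>i. P i j) \<le> 1)"

definition column_stochastic :: "(nat \<Rightarrow> nat \<Rightarrow> real) \<Rightarrow> bool" where
  "column_stochastic P \<longleftrightarrow> substochastic P \<and> (\<forall>j. (\<Sum>i. P i j) = 1)"

text \<open>
  Direct sums of finite orthogonal matrices: the \<open>k\<close>-th summand occupies the rows and
  columns \<open>p k, \<dots>, p (k + 1) - 1\<close>.
\<close>

definition block_orthogonal :: "(nat \<Rightarrow> nat \<Rightarrow> real) \<Rightarrow> bool" where
  "block_orthogonal U \<longleftrightarrow> (\<exists>p. strict_mono p \<and> p 0 = 0 \<and>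
     (\<forall>k. let B = {p k..<p (Suc k)} in
        (\<forall>i\<in>B. \<forall>j\<in>-B. U i j = 0) \<and>
        (\<forall>i\<in>B. \<forall>j\<in>B. (\<Sum>l\<in>B. U i l * U j l) = (if i = j then 1 else 0)) \<and>
        (\<forall>i\<in>B. \<forall>j\<in>B. (\<Sum>l\<in>B. U l i * U l j) = (if i = j then 1 else 0))))"

definition block_orthostochastic :: "(nat \<Rightarrow> nat \<Rightarrow> real) \<Rightarrow> bool" where
  "block_orthostochastic Q \<longleftrightarrow> (\<exists>U. block_orthogonal U \<and> (\<forall>i j. Q i j = (U i j)\<^sup>2))"

end

theory Submission
  imports Defs
begin

text \<open>
  The operator side rests on the Schmidt decomposition of a compact operator. It shows that the
  characteristic set of an ideal consists of those \<open>a\<close> for which the diagonal operator of \<open>a\<close> lies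
  in the ideal, so that only sequences remain.

  If \<open>V\<close> is an isometry, the diagonal of \<open>V diag \<xi> V\<^sup>*\<close> is \<open>P \<xi>\<close> for the column-stochastic matrix
  \<open>P\<^sub>i\<^sub>j = \<bar>V\<^sub>i\<^sub>j\<bar>\<^sup>2\<close>. The decreasing rearrangement of \<open>P \<xi>\<close> is majorized by \<open>\<xi>\<close> and has the same sum,
  and for summable sequences majorization with equal sums is tail majorization in the opposite direction.

  To get from \<open>\<xi> \<prec>\<^sub>\<infinity> \<eta>\<close> back to a block orthostochastic matrix, pass to \<open>2\<eta>\<close>, so that the tails of
  \<open>2\<eta>\<close> exceed those of \<open>\<xi>\<close> strictly as long as those of \<open>\<eta>\<close> do not vanish. The difference of the
  tails tends to \<open>0\<close>, hence has a sequence of record minima; between two consecutive ones, truncate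
  \<open>2\<eta>\<close> at the height that makes its block sum agree with that of \<open>\<xi>\<close>. The truncated sequence
  is decreasing, lies below \<open>2\<eta>\<close>, and is majorized by \<open>\<xi>\<close> on every block with equal block sums, so
  Horn's theorem supplies an orthogonal matrix on each block.
\<close>

section \<open>Inner products and adjoints\<close>

text \<open>The equivalence of (i) and (ii) is restricted to \<open>I \<noteq> {0}\<close> because
  \<open>O\<close> is asymptotic: for the zero ideal every finitely supported \<xi> satisfies (i),
  since \<open>amean_inf \<xi>\<close> vanishes eventually, while (ii) leaves only \<xi> = 0. A
  nonzero ideal has every finitely supported member of \<open>c0star\<close> in its characteristic
  set, and these absorb the finitely many indices at which the bound behind \<open>O\<close> fails.

  The factor 2 removes the following obstacle. If the tails of \<xi> and \<eta> agreed at some p and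
  those of \<eta> were strictly larger ever after, a block starting at p could never be closed,
  because the difference of the tails would be 0 at p and positive later. With 2\<eta> the
  difference is at least the tail of \<eta>, so it vanishes only where both sequences have ended.

  \<open>adj\<close>, \<open>op_abs\<close> and \<open>singular_numbers\<close> are definite
  descriptions, so evaluating them takes a uniqueness proof; the Schmidt expansion puts a compact
  operator into a form in which all three can be computed.\<close>

lemma cinner_add_right: "cinner x (y + z) = cinner x y + cinner x (z::'h::chilbert)"
  by (metis cinner_add_left cinner_commute complex_cnj_add)

lemma cinner_scaleC_right: "cinner x (a *\<^sub>C y) = cnj a * cinner x (y::'h::chilbert)"
  by (metis cinner_scaleC_left cinner_commute complex_cnj_mult)

lemma cinner_scaleR_left: "cinner (r *\<^sub>R x) (y::'h::chilbert) = r *\<^sub>R cinner x y"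
  by (simp add: scaleR_scaleC cinner_scaleC_left scaleR_conv_of_real)

lemma cinner_scaleR_right: "cinner x (r *\<^sub>R (y::'h::chilbert)) = r *\<^sub>R cinner x y"
  by (simp add: scaleR_scaleC cinner_scaleC_right scaleR_conv_of_real)

lemma cinner_zero_left [simp]: "cinner 0 (y::'h::chilbert) = 0"
  using cinner_scaleR_left[of 0 0 y] by simp

lemma cinner_zero_right [simp]: "cinner (y::'h::chilbert) 0 = 0"
  using cinner_scaleR_right[of y 0 0] by simp

lemma cinner_minus_left: "cinner (- x) (y::'h::chilbert) = - cinner x y"
  using cinner_scaleR_left[of "-1" x y] by simp

lemma cinner_minus_right: "cinner x (- y::'h::chilbert) = - cinner x y"
  using cinner_scaleR_right[of x "-1" y] by simp

lemma cinner_diff_left: "cinner (x - y) (z::'h::chilbert) = cinner x z - cinner y z"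
  using cinner_add_left[of x "- y" z] by (simp add: cinner_minus_left)

lemma cinner_diff_right: "cinner x (y - z::'h::chilbert) = cinner x y - cinner x z"
  using cinner_add_right[of x y "- z"] by (simp add: cinner_minus_right)

lemma cinner_sum_left: "cinner (\<Sum>i\<in>F. f i) (z::'h::chilbert) = (\<Sum>i\<in>F. cinner (f i) z)"
  by (induction F rule: infinite_finite_induct) (simp_all add: cinner_add_left)

lemma cinner_sum_right: "cinner (z::'h::chilbert) (\<Sum>i\<in>F. f i) = (\<Sum>i\<in>F. cinner z (f i))"
  by (induction F rule: infinite_finite_induct) (simp_all add: cinner_add_right)

lemma cinner_self: "cinner x (x::'h::chilbert) = of_real ((norm x)\<^sup>2)"
proof -
  have "Im (cinner x x) = 0"
    using cinner_commute[of x x] by (simp add: complex_eq_iff)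
  moreover have "Re (cinner x x) = (norm x)\<^sup>2"
  proof -
    have "0 \<le> sqrt (Re (cinner x x))"
      using norm_ge_zero[of x] by (simp only: norm_eq_sqrt_cinner)
    then show ?thesis by (simp add: norm_eq_sqrt_cinner)
  qed
  ultimately show ?thesis by (simp add: complex_eq_iff)
qed

lemma cinner_self_eq_0 [simp]: "cinner x x = 0 \<longleftrightarrow> x = (0::'h::chilbert)"
  by (simp add: cinner_self)

lemma norm_scaleC [simp]: "norm (a *\<^sub>C x) = cmod a * norm (x::'h::chilbert)"
proof -
  have "of_real ((norm (a *\<^sub>C x))\<^sup>2) = a * cnj a * of_real ((norm x)\<^sup>2)"
    by (simp only: cinner_self[symmetric] cinner_scaleC_left cinner_scaleC_right mult_ac)
  also have "\<dots> = of_real ((cmod a * norm x)\<^sup>2)"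
    by (simp add: complex_norm_square[symmetric] power_mult_distrib)
  finally have "(norm (a *\<^sub>C x))\<^sup>2 = (cmod a * norm x)\<^sup>2" by (simp only: of_real_eq_iff)
  then show ?thesis by (simp add: power2_eq_iff_nonneg)
qed

lemma norm_add_sq:
  "(norm (x + y))\<^sup>2 = (norm x)\<^sup>2 + 2 * Re (cinner x y) + (norm (y::'h::chilbert))\<^sup>2"
proof -
  have "of_real ((norm (x + y))\<^sup>2)
      = of_real ((norm x)\<^sup>2) + (cinner x y + cnj (cinner x y)) + complex_of_real ((norm y)\<^sup>2)"
    unfolding cinner_self[symmetric] cinner_commute[symmetric]
    by (simp add: cinner_add_left cinner_add_right)
  then have "of_real ((norm (x + y))\<^sup>2)
      = complex_of_real ((norm x)\<^sup>2 + 2 * Re (cinner x y) + (norm y)\<^sup>2)"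
    by (simp add: complex_add_cnj)
  then show ?thesis by (simp only: of_real_eq_iff)
qed

lemma norm_diff_sq:
  "(norm (x - y))\<^sup>2 = (norm x)\<^sup>2 - 2 * Re (cinner x y) + (norm (y::'h::chilbert))\<^sup>2"
  using norm_add_sq[of x "- y"] by (simp add: cinner_minus_right)

lemma parallelogram:
  "(norm (x + y))\<^sup>2 + (norm (x - y))\<^sup>2 = 2 * (norm x)\<^sup>2 + 2 * (norm (y::'h::chilbert))\<^sup>2"
  by (simp add: norm_add_sq norm_diff_sq)

lemma norm_add_orth:
  "cinner x y = 0 \<Longrightarrow> (norm (x + y))\<^sup>2 = (norm x)\<^sup>2 + (norm (y::'h::chilbert))\<^sup>2"
  by (simp add: norm_add_sq)

lemma cinner_orth_commute: "cinner x y = 0 \<longleftrightarrow> cinner y (x::'h::chilbert) = 0"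
  by (metis cinner_commute complex_cnj_zero)

lemma norm_cinner_le: "cmod (cinner x y) \<le> norm x * norm (y::'h::chilbert)"
proof (cases "y = 0")
  case False
  \<comment> \<open>\<open>c *\<^sub>C y\<close> is the orthogonal projection of \<open>x\<close>
    onto the line of \<open>y\<close>, so its norm is at most that of \<open>x\<close>.\<close>
  define c where "c = cinner x y / of_real ((norm y)\<^sup>2)"
  have n: "(norm y)\<^sup>2 > 0" using False by simp
  have "cinner (x - c *\<^sub>C y) (c *\<^sub>C y) = 0"
    using False by (simp add: cinner_diff_left cinner_scaleC_left cinner_scaleC_right cinner_self c_def)
  from norm_add_orth[OF this] have "(norm (c *\<^sub>C y))\<^sup>2 \<le> (norm x)\<^sup>2" by simp
  then have "norm (c *\<^sub>C y) \<le> norm x" by (simp add: power2_le_iff_abs_le)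
  then have "cmod (cinner x y) / (norm y)\<^sup>2 * norm y \<le> norm x"
    by (simp add: c_def norm_divide norm_power)
  then show ?thesis using n False by (simp add: field_simps power2_eq_square)
qed simp

lemma bounded_linear_cinner_left: "bounded_linear (\<lambda>x. cinner x (y::'h::chilbert))"
  by (rule bounded_linear_intro[where K = "norm y"])
    (simp_all add: cinner_add_left cinner_scaleR_left norm_cinner_le)

lemma bounded_linear_cinner_right: "bounded_linear (cinner (x::'h::chilbert))"
  by (rule bounded_linear_intro[where K = "norm x"])
    (simp_all add: cinner_add_right cinner_scaleR_right norm_cinner_le mult.commute[of _ "norm x"])

lemma bounded_bilinear_scaleC: "bounded_bilinear (\<lambda>c (x::'h::chilbert). c *\<^sub>C x)"
proof
  show "\<exists>K. \<forall>a b. norm (a *\<^sub>C (b::'h)) \<le> norm a * norm b * K"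
    by (rule exI[of _ 1]) simp
qed (simp_all add: scaleC_add_left scaleC_add_right scaleR_scaleC scaleC_scaleC
      scaleR_conv_of_real mult.commute)

lemmas bounded_linear_scaleC_right = bounded_bilinear.bounded_linear_right[OF bounded_bilinear_scaleC]

definition suborthonormal :: "(nat \<Rightarrow> 'h::chilbert) \<Rightarrow> bool" where
  "suborthonormal u \<longleftrightarrow> (\<forall>i j. i \<noteq> j \<longrightarrow> cinner (u i) (u j) = 0) \<and> (\<forall>i. norm (u i) \<le> 1)"

definition orthonormal_seq :: "(nat \<Rightarrow> 'h::chilbert) \<Rightarrow> bool" where
  "orthonormal_seq u \<longleftrightarrow> (\<forall>i j. cinner (u i) (u j) = (if i = j then 1 else 0))"

lemma orthonormal_seq_norm [simp]: "orthonormal_seq u \<Longrightarrow> norm (u i) = 1"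
proof -
  assume "orthonormal_seq u"
  then have "cinner (u i) (u i) = 1" by (simp add: orthonormal_seq_def)
  then have "(norm (u i))\<^sup>2 = 1" using cinner_self[of "u i"] by (metis of_real_eq_1_iff)
  then show ?thesis by (simp add: power2_eq_1_iff) (smt (verit) norm_ge_zero)
qed

lemma orthonormal_imp_suborthonormal [simp]: "orthonormal_seq u \<Longrightarrow> suborthonormal u"
  by (simp add: suborthonormal_def) (simp add: orthonormal_seq_def)

lemma orthonormal_seqD: "orthonormal_seq u \<Longrightarrow> cinner (u i) (u j) = (if i = j then 1 else 0)"
  by (simp add: orthonormal_seq_def)

lemma orthonormal_seqI:
  assumes "\<And>i. norm (u i) = 1" "\<And>i j. j < i \<Longrightarrow> cinner (u i) (u j) = 0"
  shows "orthonormal_seq u"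
  unfolding orthonormal_seq_def
proof (intro allI)
  fix i j :: nat
  consider "i = j" | "i < j" | "j < i" by linarith
  then show "cinner (u i) (u j) = (if i = j then 1 else 0)"
    using assms(2)[of i j] assms(2)[of j i] cinner_orth_commute[of "u i" "u j"]
    by cases (auto simp: cinner_self assms(1))
qed

lemma orthonormal_basis_seq: "orthonormal_basis e \<Longrightarrow> orthonormal_seq e"
  by (simp add: orthonormal_basis_def orthonormal_seq_def)

lemma suborthonormal_reindex: "suborthonormal u \<Longrightarrow> inj h \<Longrightarrow> suborthonormal (u \<circ> h)"
  by (auto simp: suborthonormal_def inj_def)

section \<open>Pythagoras, Bessel and Parseval\<close>

lemma norm_sum_orth:
  assumes "\<And>i j. i \<in> F \<Longrightarrow> j \<in> F \<Longrightarrow> i \<noteq> j \<Longrightarrow> cinner (f i) (f j :: 'h::chilbert) = 0"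
    and "finite F"
  shows "(norm (\<Sum>i\<in>F. f i))\<^sup>2 = (\<Sum>i\<in>F. (norm (f i))\<^sup>2)"
  using assms(2,1)
proof (induction F)
  case (insert a F)
  have "cinner (f a) (\<Sum>i\<in>F. f i) = 0"
    using insert by (auto simp: cinner_sum_right intro!: sum.neutral)
  then show ?case using insert by (simp add: norm_add_orth)
qed simp

lemma norm_sum_suborthonormal:
  assumes "suborthonormal v" "finite F"
  shows "(norm (\<Sum>i\<in>F. c i *\<^sub>C v i))\<^sup>2 \<le> (\<Sum>i\<in>F. (cmod (c i))\<^sup>2)"
proof -
  have "(norm (\<Sum>i\<in>F. c i *\<^sub>C v i))\<^sup>2 = (\<Sum>i\<in>F. (norm (c i *\<^sub>C v i))\<^sup>2)"
    using assms by (intro norm_sum_orth)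
      (auto simp: suborthonormal_def cinner_scaleC_left cinner_scaleC_right)
  also have "\<dots> \<le> (\<Sum>i\<in>F. (cmod (c i))\<^sup>2)"
    using assms by (intro sum_mono)
      (auto simp: suborthonormal_def power_mult_distrib intro!: mult_left_le power_le_one)
  finally show ?thesis .
qed

text \<open>For vectors of norm below 1 the sum \<open>y\<close> is no longer the projection of
  \<open>x\<close>, but its squared norm is still at most \<open>Re (cinner x y)\<close>, and
  expanding the norm of \<open>x - y\<close> then suffices.\<close>

lemma bessel_finite:
  assumes "suborthonormal u" "finite F"
  shows "(\<Sum>i\<in>F. (cmod (cinner x (u i)))\<^sup>2) \<le> (norm x)\<^sup>2"
proof -
  define y where "y = (\<Sum>i\<in>F. cinner x (u i) *\<^sub>C u i)"
  let ?S = "\<Sum>i\<in>F. (cmod (cinner x (u i)))\<^sup>2"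
  have "cinner x y = of_real ?S"
    by (simp add: y_def cinner_sum_right cinner_scaleC_right complex_norm_square mult.commute
        del: of_real_power)
  then have "Re (cinner x y) = ?S" by simp
  moreover have "(norm y)\<^sup>2 \<le> ?S"
    unfolding y_def by (rule norm_sum_suborthonormal[OF assms])
  ultimately show ?thesis using norm_diff_sq[of x y] zero_le_power2[of "norm (x - y)"] by linarith
qed

lemma bessel_summable:
  assumes "suborthonormal u"
  shows "summable (\<lambda>i. (cmod (cinner x (u i)))\<^sup>2)"
    and "(\<Sum>i. (cmod (cinner x (u i)))\<^sup>2) \<le> (norm x)\<^sup>2"
proof -
  show s: "summable (\<lambda>i. (cmod (cinner x (u i)))\<^sup>2)"
    by (rule summableI_nonneg_bounded[where x = "(norm x)\<^sup>2"]) (auto intro: bessel_finite[OF assms])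
  show "(\<Sum>i. (cmod (cinner x (u i)))\<^sup>2) \<le> (norm x)\<^sup>2"
    by (rule suminf_le_const[OF s]) (auto intro: bessel_finite[OF assms])
qed

lemma summable_suborthonormal:
  assumes v: "suborthonormal v" and c: "summable (\<lambda>i. (cmod (c i))\<^sup>2)"
  shows "summable (\<lambda>i. c i *\<^sub>C v i)"
  unfolding summable_Cauchy
proof (intro allI impI)
  fix r :: real assume r: "r > 0"
  then have "r\<^sup>2 > 0" by simp
  with c obtain N where N: "\<And>m n. m \<ge> N \<Longrightarrow> norm (\<Sum>i = m..<n. (cmod (c i))\<^sup>2) < r\<^sup>2"
    unfolding summable_Cauchy by meson
  have "norm (\<Sum>i = m..<n. c i *\<^sub>C v i) < r" if "m \<ge> N" for m n
  proof -
    have "(norm (\<Sum>i = m..<n. c i *\<^sub>C v i))\<^sup>2 \<le> (\<Sum>i = m..<n. (cmod (c i))\<^sup>2)"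
      by (rule norm_sum_suborthonormal[OF v]) simp
    also have "\<dots> < r\<^sup>2" using N[OF that, of n] by simp
    finally show ?thesis using r by (simp add: power2_less_imp_less)
  qed
  then show "\<exists>N. \<forall>m\<ge>N. \<forall>n. norm (\<Sum>i = m..<n. c i *\<^sub>C v i) < r" by blast
qed

lemma norm_suminf_suborthonormal:
  assumes v: "suborthonormal v" and c: "summable (\<lambda>i. (cmod (c i))\<^sup>2)"
  shows "(norm (\<Sum>i. c i *\<^sub>C v i))\<^sup>2 \<le> (\<Sum>i. (cmod (c i))\<^sup>2)"
proof (rule LIMSEQ_le)
  show "(\<lambda>n. (norm (\<Sum>i<n. c i *\<^sub>C v i))\<^sup>2) \<longlonglongrightarrow> (norm (\<Sum>i. c i *\<^sub>C v i))\<^sup>2"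
    by (intro tendsto_intros summable_LIMSEQ summable_suborthonormal assms)
  show "(\<lambda>n. \<Sum>i<n. (cmod (c i))\<^sup>2) \<longlonglongrightarrow> (\<Sum>i. (cmod (c i))\<^sup>2)"
    by (rule summable_LIMSEQ[OF c])
  show "\<exists>N. \<forall>n\<ge>N. (norm (\<Sum>i<n. c i *\<^sub>C v i))\<^sup>2 \<le> (\<Sum>i<n. (cmod (c i))\<^sup>2)"
    using norm_sum_suborthonormal[OF v] by blast
qed

lemma orthonormal_basis_sums:
  "orthonormal_basis e \<Longrightarrow> (\<lambda>n. cinner x (e n) *\<^sub>C e n) sums x"
  by (simp add: orthonormal_basis_def)

lemma parseval:
  assumes "orthonormal_basis e"
  shows "(\<lambda>n. (cmod (cinner x (e n)))\<^sup>2) sums (norm x)\<^sup>2"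
proof -
  have "(\<lambda>n. cinner (cinner x (e n) *\<^sub>C e n) x) sums cinner x x"
    by (rule bounded_linear.sums[OF bounded_linear_cinner_left orthonormal_basis_sums[OF assms]])
  moreover have "cinner (cinner x (e n) *\<^sub>C e n) x = of_real ((cmod (cinner x (e n)))\<^sup>2)" for n
    by (metis cinner_scaleC_left cinner_commute complex_norm_square)
  ultimately have "(\<lambda>n. complex_of_real ((cmod (cinner x (e n)))\<^sup>2)) sums of_real ((norm x)\<^sup>2)"
    by (simp only: cinner_self)
  then show ?thesis by (simp only: sums_of_real_iff)
qed

lemma orthonormal_basis_eqI:
  assumes "orthonormal_basis e" "\<And>n. cinner x (e n) = cinner y (e n)"
  shows "x = y"
  using orthonormal_basis_sums[OF assms(1), of x] orthonormal_basis_sums[OF assms(1), of y]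
  by (simp add: assms(2) sums_unique2)

lemma cinner_eqI: "(\<And>y. cinner y x = cinner y x') \<Longrightarrow> x = (x'::'h::chilbert)"
  by (metis cinner_diff_right cinner_self_eq_0 eq_iff_diff_eq_0)

section \<open>Complex linear operators and existence of the adjoint\<close>

lemma bops_scaleC: "A \<in> bops \<Longrightarrow> blinfun_apply A (c *\<^sub>C x) = c *\<^sub>C blinfun_apply A x"
  by (simp add: bops_def)

lemma bops_eqI:
  fixes e :: "nat \<Rightarrow> 'h::chilbert" and A :: "'h \<Rightarrow>\<^sub>L 'h"
  assumes e: "orthonormal_basis e" and "A \<in> bops" "B \<in> bops"
    and eq: "\<And>n. blinfun_apply A (e n) = blinfun_apply B (e n)"
  shows "A = B"
proof (rule blinfun_eqI)
  fix x
  have "(\<lambda>n. blinfun_apply C (cinner x (e n) *\<^sub>C e n)) sums blinfun_apply C x" for C :: "'h \<Rightarrow>\<^sub>L 'h"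
    by (rule bounded_linear.sums[OF blinfun.bounded_linear_right orthonormal_basis_sums[OF e]])
  from this[of A] this[of B] show "blinfun_apply A x = blinfun_apply B x"
    using assms by (simp add: bops_scaleC sums_unique2)
qed

text \<open>The coefficients of \<open>B y\<close> in the basis are forced to be
  \<open>cinner y (A e\<^sub>n)\<close>. They are square summable: testing \<open>A\<close> on a
  partial sum \<open>z\<close> bounds the partial sum \<open>?S\<close> of their squares by
  \<open>norm y * norm A * sqrt ?S\<close>, from which one factor \<open>sqrt ?S\<close>
  cancels.\<close>

lemma ex_adjoint:
  fixes e :: "nat \<Rightarrow> 'h::chilbert" and A :: "'h \<Rightarrow>\<^sub>L 'h"
  assumes e: "orthonormal_basis e" and A: "A \<in> bops"
  obtains B where "B \<in> bops" "\<And>x y. cinner (blinfun_apply A x) y = cinner x (blinfun_apply B y)"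
proof -
  have on: "suborthonormal e" using orthonormal_basis_seq[OF e] by simp
  define c where "c y n = cinner y (blinfun_apply A (e n))" for y n
  have bd: "(\<Sum>n\<in>F. (cmod (c y n))\<^sup>2) \<le> (norm A * norm y)\<^sup>2" if "finite F" for F y
  proof -
    define z where "z = (\<Sum>n\<in>F. c y n *\<^sub>C e n)"
    let ?S = "\<Sum>n\<in>F. (cmod (c y n))\<^sup>2"
    have "cinner y (blinfun_apply A z) = of_real ?S"
      by (simp add: z_def blinfun.sum_right cinner_sum_right bops_scaleC[OF A] cinner_scaleC_right
          c_def complex_norm_square mult.commute del: of_real_power)
    then have "?S = cmod (cinner y (blinfun_apply A z))"
      by (simp add: sum_nonneg del: of_real_sum of_real_power)
    also have "\<dots> \<le> norm y * (norm A * norm z)"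
      by (intro order_trans[OF norm_cinner_le] mult_left_mono norm_blinfun) simp
    also have "\<dots> \<le> norm y * (norm A * sqrt ?S)"
      using norm_sum_suborthonormal[OF on that, of "c y"]
      by (intro mult_left_mono real_le_rsqrt) (auto simp: z_def)
    finally have *: "sqrt ?S * sqrt ?S \<le> (norm A * norm y) * sqrt ?S"
      by (simp add: sum_nonneg mult_ac)
    have "sqrt ?S \<le> norm A * norm y"
    proof (cases "sqrt ?S > 0")
      case True
      then show ?thesis using * by (rule mult_right_le_imp_le[rotated])
    next
      case False
      moreover have "0 \<le> norm A * norm y" by simp
      ultimately show ?thesis by linarith
    qed
    then show ?thesis by (simp add: sqrt_le_D)
  qed
  have sm: "summable (\<lambda>n. (cmod (c y n))\<^sup>2)" for y
    by (rule summableI_nonneg_bounded[where x = "(norm A * norm y)\<^sup>2"]) (auto intro: bd)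
  define b where "b y = (\<Sum>n. c y n *\<^sub>C e n)" for y
  have sb: "(\<lambda>n. c y n *\<^sub>C e n) sums b y" for y
    unfolding b_def by (intro summable_sums summable_suborthonormal on sm)
  have adj: "cinner (blinfun_apply A x) y = cinner x (b y)" for x y
  proof -
    have "(\<lambda>n. cinner x (c y n *\<^sub>C e n)) sums cinner x (b y)"
      by (rule bounded_linear.sums[OF bounded_linear_cinner_right sb])
    moreover have "(\<lambda>n. cinner (blinfun_apply A (cinner x (e n) *\<^sub>C e n)) y) sums cinner (blinfun_apply A x) y"
      by (intro bounded_linear.sums[OF bounded_linear_cinner_left]
          bounded_linear.sums[OF blinfun.bounded_linear_right] orthonormal_basis_sums e)
    moreover have "cinner (blinfun_apply A (cinner x (e n) *\<^sub>C e n)) y = cinner x (c y n *\<^sub>C e n)" for n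
      using cinner_commute[of "blinfun_apply A (e n)" y]
      by (simp add: bops_scaleC[OF A] cinner_scaleC_left cinner_scaleC_right c_def mult.commute)
    ultimately show ?thesis by (simp add: sums_unique2)
  qed
  have lin: "b (x + y) = b x + b y" "b (a *\<^sub>C x) = a *\<^sub>C b x" for x y a
  proof -
    show "b (x + y) = b x + b y"
      by (rule cinner_eqI) (simp add: adj[symmetric] cinner_add_right)
    show "b (a *\<^sub>C x) = a *\<^sub>C b x"
      by (rule cinner_eqI) (simp add: adj[symmetric] cinner_scaleC_right)
  qed
  have nb: "norm (b y) \<le> norm y * norm A" for y
  proof -
    have "(norm (b y))\<^sup>2 \<le> (\<Sum>n. (cmod (c y n))\<^sup>2)"
      unfolding b_def by (rule norm_suminf_suborthonormal[OF on sm])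
    also have "\<dots> \<le> (norm A * norm y)\<^sup>2"
      by (rule suminf_le_const[OF sm]) (auto intro: bd)
    finally show ?thesis by (simp add: power2_le_iff_abs_le mult.commute)
  qed
  have bl: "bounded_linear b"
    by (rule bounded_linear_intro[OF _ _ nb]) (simp_all add: lin scaleR_scaleC)
  show ?thesis
    by (rule that[of "Blinfun b"]) (simp_all add: bops_def bounded_linear_Blinfun_apply[OF bl] lin adj)
qed

lemma adj_eqI:
  assumes "B \<in> bops" "\<And>x y. cinner (blinfun_apply A x) y = cinner x (blinfun_apply B y)"
  shows "adj A = B"
  unfolding adj_def
proof (rule the_equality)
  fix C assume C: "C \<in> bops \<and> (\<forall>x y. cinner (blinfun_apply A x) y = cinner x (blinfun_apply C y))"
  show "C = B"
  proof (rule blinfun_eqI, rule cinner_eqI)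
    fix x y
    have "cinner y (blinfun_apply C x) = cinner (blinfun_apply A y) x" using C by simp
    also have "\<dots> = cinner y (blinfun_apply B x)" by (rule assms(2))
    finally show "cinner y (blinfun_apply C x) = cinner y (blinfun_apply B x)" .
  qed
next
  show "B \<in> bops \<and> (\<forall>x y. cinner (blinfun_apply A x) y = cinner x (blinfun_apply B y))"
    by (intro conjI allI assms)
qed

lemma cinner_adj:
  fixes e :: "nat \<Rightarrow> 'h::chilbert" and A :: "'h \<Rightarrow>\<^sub>L 'h"
  assumes "orthonormal_basis e" "A \<in> bops"
  shows "cinner (blinfun_apply A x) y = cinner x (blinfun_apply (adj A) y)"
proof -
  from ex_adjoint[OF assms] obtain B
    where B: "B \<in> bops" "\<And>x y. cinner (blinfun_apply A x) y = cinner x (blinfun_apply B y)" by blast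
  then have "adj A = B" by (rule adj_eqI)
  then show ?thesis by (simp add: B(2))
qed

section \<open>Operators given by orthogonal series\<close>

text \<open>One form covers diagonal operators (\<open>u = v\<close>), the partial isometries that
  carry one orthonormal family to another (\<open>a = 1\<close>), and Schmidt expansions. Products
  along a common middle family keep this form.\<close>

definition series_op ::
    "(nat \<Rightarrow> complex) \<Rightarrow> (nat \<Rightarrow> 'h::chilbert) \<Rightarrow> (nat \<Rightarrow> 'h) \<Rightarrow> ('h \<Rightarrow>\<^sub>L 'h)" where
  "series_op a u v = Blinfun (\<lambda>x. \<Sum>n. (a n * cinner x (u n)) *\<^sub>C v n)"

lemma diag_op_eq: "diag_op e a = series_op a e e"
  by (simp add: diag_op_def series_op_def)

lemma series_op_coeff_summable:
  assumes u: "suborthonormal u" and a: "bounded (range a)"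
  shows "summable (\<lambda>n. (cmod (a n * cinner x (u n)))\<^sup>2)"
proof -
  obtain K where K: "\<And>n. cmod (a n) \<le> K" using a by (auto simp: bounded_iff)
  show ?thesis
  proof (rule summable_comparison_test')
    show "summable (\<lambda>n. K\<^sup>2 * (cmod (cinner x (u n)))\<^sup>2)"
      by (intro summable_mult bessel_summable u)
    show "norm ((cmod (a n * cinner x (u n)))\<^sup>2) \<le> K\<^sup>2 * (cmod (cinner x (u n)))\<^sup>2" for n
      by (simp add: norm_mult power_mult_distrib K mult_right_mono power_mono)
  qed
qed

locale series_op_data =
  fixes a :: "nat \<Rightarrow> complex" and u v :: "nat \<Rightarrow> 'h::chilbert"
  assumes u: "suborthonormal u" and v: "suborthonormal v" and a: "bounded (range a)"
begin

lemma series_sums: "(\<lambda>n. (a n * cinner x (u n)) *\<^sub>C v n) sums (\<Sum>n. (a n * cinner x (u n)) *\<^sub>C v n)"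
  by (intro summable_sums summable_suborthonormal v series_op_coeff_summable u a)

lemma norm_series_le:
  assumes K: "\<And>n. cmod (a n) \<le> K"
  shows "norm (\<Sum>n. (a n * cinner x (u n)) *\<^sub>C v n) \<le> K * norm x"
proof -
  have K0: "K \<ge> 0" using K[of 0] norm_ge_zero order_trans by blast
  have "(norm (\<Sum>n. (a n * cinner x (u n)) *\<^sub>C v n))\<^sup>2 \<le> (\<Sum>n. (cmod (a n * cinner x (u n)))\<^sup>2)"
    by (intro norm_suminf_suborthonormal v series_op_coeff_summable u a)
  also have "\<dots> \<le> (\<Sum>n. K\<^sup>2 * (cmod (cinner x (u n)))\<^sup>2)"
    by (intro suminf_le series_op_coeff_summable u a summable_mult bessel_summable)
      (simp add: norm_mult power_mult_distrib K mult_right_mono power_mono)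
  also have "\<dots> = K\<^sup>2 * (\<Sum>n. (cmod (cinner x (u n)))\<^sup>2)"
    by (intro suminf_mult bessel_summable u)
  also have "\<dots> \<le> K\<^sup>2 * (norm x)\<^sup>2"
    by (intro mult_left_mono bessel_summable u) simp
  finally show ?thesis
    using K0 by (simp add: power_mult_distrib[symmetric] power2_le_iff_abs_le)
qed

lemma bounded_linear_series: "bounded_linear (\<lambda>x. \<Sum>n. (a n * cinner x (u n)) *\<^sub>C v n)"
proof -
  obtain K where K: "\<And>n. cmod (a n) \<le> K" using a by (auto simp: bounded_iff)
  show ?thesis
  proof (rule bounded_linear_intro)
    fix x y :: 'h and r :: real
    show "(\<Sum>n. (a n * cinner (x + y) (u n)) *\<^sub>C v n) =
        (\<Sum>n. (a n * cinner x (u n)) *\<^sub>C v n) + (\<Sum>n. (a n * cinner y (u n)) *\<^sub>C v n)"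
      using sums_unique[OF sums_add[OF series_sums[of x] series_sums[of y]]]
      by (simp add: cinner_add_left distrib_left scaleC_add_left)
    show "(\<Sum>n. (a n * cinner (r *\<^sub>R x) (u n)) *\<^sub>C v n) = r *\<^sub>R (\<Sum>n. (a n * cinner x (u n)) *\<^sub>C v n)"
      using sums_unique[OF sums_scaleR_right[OF series_sums[of x], of r]]
      by (simp add: cinner_scaleC_left scaleR_scaleC scaleC_scaleC mult_ac)
    show "norm (\<Sum>n. (a n * cinner x (u n)) *\<^sub>C v n) \<le> norm x * K"
      using norm_series_le[OF K] by (simp add: mult.commute)
  qed
qed

lemma series_op_apply: "blinfun_apply (series_op a u v) x = (\<Sum>n. (a n * cinner x (u n)) *\<^sub>C v n)"
  by (simp add: series_op_def bounded_linear_Blinfun_apply bounded_linear_series)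

lemma series_op_sums: "(\<lambda>n. (a n * cinner x (u n)) *\<^sub>C v n) sums blinfun_apply (series_op a u v) x"
  unfolding series_op_apply by (rule series_sums)

lemma series_op_bops: "series_op a u v \<in> bops"
  unfolding bops_def
proof (intro CollectI allI)
  fix c x
  have "(\<lambda>n. c *\<^sub>C ((a n * cinner x (u n)) *\<^sub>C v n)) sums (c *\<^sub>C blinfun_apply (series_op a u v) x)"
    by (rule bounded_linear.sums[OF bounded_linear_scaleC_right series_op_sums])
  then show "blinfun_apply (series_op a u v) (c *\<^sub>C x) = c *\<^sub>C blinfun_apply (series_op a u v) x"
    using series_op_sums[of "c *\<^sub>C x"]
    by (simp add: cinner_scaleC_left scaleC_scaleC mult_ac sums_unique2)
qed

lemma series_op_apply_left: "blinfun_apply (series_op a u v) (u m) = (a m * (norm (u m))\<^sup>2) *\<^sub>C v m"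
proof -
  have "(\<lambda>n. (a n * cinner (u m) (u n)) *\<^sub>C v n) sums ((a m * cinner (u m) (u m)) *\<^sub>C v m)"
    by (rule sums_cong[THEN iffD1, OF _ sums_single[of m "\<lambda>n. (a n * cinner (u m) (u n)) *\<^sub>C v n"]])
      (use u in \<open>auto simp: suborthonormal_def\<close>)
  with series_op_sums[of "u m"] show ?thesis by (simp add: sums_unique2 cinner_self)
qed

lemma series_op_apply_orth: "(\<And>n. cinner x (u n) = 0) \<Longrightarrow> blinfun_apply (series_op a u v) x = 0"
  by (simp add: series_op_apply)

lemma cinner_series_op_sums:
  "(\<lambda>n. a n * cinner x (u n) * cinner (v n) y) sums cinner (blinfun_apply (series_op a u v) x) y"
  using bounded_linear.sums[OF bounded_linear_cinner_left series_op_sums, of x y]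
  by (simp add: cinner_scaleC_left)

lemma cinner_series_op_right:
  "cinner (blinfun_apply (series_op a u v) x) (v m) = a m * cinner x (u m) * (norm (v m))\<^sup>2"
proof -
  have "(\<lambda>n. a n * cinner x (u n) * cinner (v n) (v m)) sums (a m * cinner x (u m) * cinner (v m) (v m))"
    by (rule sums_cong[THEN iffD1, OF _ sums_single[of m "\<lambda>n. a n * cinner x (u n) * cinner (v n) (v m)"]])
      (use v in \<open>auto simp: suborthonormal_def\<close>)
  with cinner_series_op_sums[of x "v m"] show ?thesis by (simp add: sums_unique2 cinner_self)
qed

lemma bounded_cnj: "bounded (range (\<lambda>n. cnj (a n)))"
  using a by (auto simp: bounded_iff)

lemma adj_series_op: "adj (series_op a u v) = series_op (\<lambda>n. cnj (a n)) v u"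
proof (rule adj_eqI)
  interpret A: series_op_data "\<lambda>n. cnj (a n)" v u by unfold_locales (rule v u bounded_cnj)+
  show "series_op (\<lambda>n. cnj (a n)) v u \<in> bops" by (rule A.series_op_bops)
  fix x y
  have "(\<lambda>n. cnj (cnj (a n) * cinner y (v n) * cinner (u n) x)) sums
      cnj (cinner (blinfun_apply (series_op (\<lambda>n. cnj (a n)) v u) y) x)"
    by (intro bounded_linear.sums[OF bounded_linear_cnj] A.cinner_series_op_sums)
  moreover have eq: "cnj (cnj (a n) * cinner y (v n) * cinner (u n) x) = a n * cinner x (u n) * cinner (v n) y" for n
    using cinner_commute[of x "u n"] cinner_commute[of "v n" y] by simp
  ultimately have "(\<lambda>n. a n * cinner x (u n) * cinner (v n) y) sums
      cinner x (blinfun_apply (series_op (\<lambda>n. cnj (a n)) v u) y)"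
    unfolding eq by (simp add: cinner_commute[of x "blinfun_apply _ _"])
  then show "cinner (blinfun_apply (series_op a u v) x) y
      = cinner x (blinfun_apply (series_op (\<lambda>n. cnj (a n)) v u) y)"
    using cinner_series_op_sums sums_unique2 by blast
qed

end

text \<open>The squared norms of the middle family remain as a factor since that family is only
  suborthonormal. For Schmidt data they are 1 wherever the singular number is nonzero, so they get
  absorbed there.\<close>

lemma series_op_compose:
  assumes "series_op_data a u v" "series_op_data b v w"
  shows "series_op b v w o\<^sub>L series_op a u v = series_op (\<lambda>n. b n * a n * (norm (v n))\<^sup>2) u w"
proof (rule blinfun_eqI)
  fix x
  interpret A: series_op_data a u v by fact
  interpret B: series_op_data b v w by fact
  obtain K L where K: "\<And>n. cmod (a n) \<le> K" and L: "\<And>n. cmod (b n) \<le> L"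
    using A.a B.a by (auto simp: bounded_iff)
  have v: "norm (v n) \<le> 1" for n using A.v by (simp add: suborthonormal_def)
  have K0: "K \<ge> 0" and L0: "L \<ge> 0" using K[of 0] L[of 0] norm_ge_zero order_trans by blast+
  have "cmod (b n * a n * (norm (v n))\<^sup>2) \<le> L * K * 1" for n
    unfolding norm_mult norm_of_real
    using v[of n] K L K0 L0 by (intro mult_mono) (auto simp: norm_power power_le_one)
  then interpret C: series_op_data "\<lambda>n. b n * a n * (norm (v n))\<^sup>2" u w
    by unfold_locales (auto simp: A.u B.v bounded_iff)
  show "blinfun_apply (series_op b v w o\<^sub>L series_op a u v) x
      = blinfun_apply (series_op (\<lambda>n. b n * a n * (norm (v n))\<^sup>2) u w) x"
    using B.series_op_sums[of "blinfun_apply (series_op a u v) x"] C.series_op_sums[of x]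
    by (simp add: A.cinner_series_op_right mult_ac sums_unique2)
qed

lemma bounded_real_seq: "bounded (range (\<lambda>n. complex_of_real (s n)))" if "s \<in> c0star"
proof -
  have "\<bar>s n\<bar> \<le> s 0" for n using that by (simp add: c0star_def decseq_def)
  then show ?thesis by (auto simp: bounded_iff)
qed

lemma series_op_dataI:
  "s \<in> c0star \<Longrightarrow> suborthonormal u \<Longrightarrow> suborthonormal v \<Longrightarrow> series_op_data (\<lambda>n. complex_of_real (s n)) u v"
  by unfold_locales (auto intro: bounded_real_seq)

lemma series_op_data_one:
  "suborthonormal u \<Longrightarrow> suborthonormal v \<Longrightarrow> series_op_data (\<lambda>n. 1) u v"
  by unfold_locales (auto simp: bounded_iff)

section \<open>Positive operators and their square roots\<close>

lemma positive_series_op: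
  assumes s: "s \<in> c0star" and f: "suborthonormal f"
  shows "positive_op (series_op (\<lambda>n. complex_of_real (s n)) f f)"
proof -
  interpret series_op_data "\<lambda>n. complex_of_real (s n)" f f by (rule series_op_dataI[OF s f f])
  have "cinner (blinfun_apply (series_op (\<lambda>n. complex_of_real (s n)) f f) x) x \<in> \<real> \<and>
      0 \<le> Re (cinner (blinfun_apply (series_op (\<lambda>n. complex_of_real (s n)) f f) x) x)" for x
  proof -
    have eq: "complex_of_real (s n) * cinner x (f n) * cinner (f n) x
        = complex_of_real (s n * (cmod (cinner x (f n)))\<^sup>2)" for n
      using cinner_commute[of "f n" x] by (simp add: complex_norm_square mult.assoc del: of_real_power)
    have 1: "(\<lambda>n. complex_of_real (s n * (cmod (cinner x (f n)))\<^sup>2)) sums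
        cinner (blinfun_apply (series_op (\<lambda>n. complex_of_real (s n)) f f) x) x"
      using cinner_series_op_sums[of x x] unfolding eq .
    have sm: "summable (\<lambda>n. s n * (cmod (cinner x (f n)))\<^sup>2)"
      using sums_summable[OF 1] by (simp only: summable_complex_of_real)
    have "cinner (blinfun_apply (series_op (\<lambda>n. complex_of_real (s n)) f f) x) x
        = of_real (\<Sum>n. s n * (cmod (cinner x (f n)))\<^sup>2)"
      using 1 sums_of_real[OF summable_sums[OF sm], where 'a = complex] by (rule sums_unique2)
    moreover have "0 \<le> (\<Sum>n. s n * (cmod (cinner x (f n)))\<^sup>2)"
      using s by (intro suminf_nonneg sm) (simp add: c0star_def)
    ultimately show ?thesis by simp
  qed
  then show ?thesis by (simp add: positive_op_def series_op_bops)
qed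

text \<open>Polarization: reality of the quadratic form at \<open>x + y\<close> settles the
  imaginary parts, and at \<open>x + \<i> *\<^sub>C y\<close> the real parts.\<close>

lemma positive_op_symmetric:
  assumes "positive_op (A :: 'h::chilbert \<Rightarrow>\<^sub>L 'h)"
  shows "cinner (blinfun_apply A x) y = cinner x (blinfun_apply A y)"
proof -
  have A: "A \<in> bops" using assms by (simp add: positive_op_def)
  define q where "q x y = cinner (blinfun_apply A x) y" for x y
  have re: "Im (q z z) = 0" for z
    using assms by (simp add: positive_op_def q_def complex_is_Real_iff)
  have add: "q (x + y) z = q x z + q y z" "q z (x + y) = q z x + q z y" for x y z
    by (simp_all add: q_def blinfun.add_right cinner_add_left cinner_add_right)
  have sc: "q (c *\<^sub>C x) z = c * q x z" "q z (c *\<^sub>C x) = cnj c * q z x" for c x z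
    by (simp_all add: q_def bops_scaleC[OF A] cinner_scaleC_left cinner_scaleC_right)
  have "Im (q x y) + Im (q y x) = 0"
    using re[of "x + y"] re[of x] re[of y] by (simp add: add)
  moreover have "Re (q x y) = Re (q y x)"
    using re[of "x + \<i> *\<^sub>C y"] re[of x] re[of y] by (simp add: add sc)
  ultimately have "q x y = cnj (q y x)" by (simp add: complex_eq_iff)
  then show ?thesis by (simp add: q_def cinner_commute[of x "blinfun_apply A y"])
qed

text \<open>
  A positive square root of \<open>A\<^sup>2\<close> acts as the scalar \<open>t\<close> on the \<open>t\<^sup>2\<close>-eigenspace, because
  \<open>(A + t) (A - t) x = 0\<close> and \<open>A\<close> has no negative eigenvalue.
\<close>

lemma positive_op_sqrt_eigenvector:
  assumes pos: "positive_op A" and t: "t \<ge> 0"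
    and ev: "blinfun_apply A (blinfun_apply A x) = complex_of_real (t\<^sup>2) *\<^sub>C x"
  shows "blinfun_apply A x = complex_of_real t *\<^sub>C x"
proof -
  have A: "A \<in> bops" using pos by (simp add: positive_op_def)
  define w where "w = blinfun_apply A x - complex_of_real t *\<^sub>C x"
  have Aw: "blinfun_apply A w = complex_of_real (- t) *\<^sub>C w"
    by (simp add: w_def blinfun.diff_right ev bops_scaleC[OF A] complex_vector.scale_right_diff_distrib
        scaleC_scaleC power2_eq_square)
  have "0 \<le> Re (cinner (blinfun_apply A w) w)" using pos by (simp add: positive_op_def)
  then have tw: "t * (norm w)\<^sup>2 \<le> 0" unfolding Aw by (simp only: cinner_scaleC_left cinner_self) simp
  have "w = 0"
  proof (cases "t = 0")
    case True
    \<comment> \<open>For t = 0 the sign argument is void; instead symmetry turns the squared norm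
      of \<open>A x\<close> into \<open>cinner x (A (A x)) = 0\<close>.\<close>
    have "cinner (blinfun_apply A x) (blinfun_apply A x) = cinner x (blinfun_apply A (blinfun_apply A x))"
      by (rule positive_op_symmetric[OF pos])
    then have "blinfun_apply A x = 0" using ev True by simp
    then show ?thesis by (simp add: w_def True)
  next
    case False
    with t have "t > 0" by simp
    with tw have "(norm w)\<^sup>2 \<le> 0" by (simp add: mult_le_0_iff)
    then show ?thesis by simp
  qed
  then show ?thesis by (simp add: w_def)
qed

section \<open>Schmidt decomposition and singular numbers\<close>

lemma cmod_cinner_commute: "cmod (cinner x y) = cmod (cinner y (x::'h::chilbert))"
  by (metis cinner_commute complex_mod_cnj)

text \<open>A counting argument. If only 0 were orthogonal to all the \<open>f i\<close>, every
  squared norm would be the sum of the squared coefficients along \<open>f\<close>. Adding this up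
  over n + 1 basis vectors and applying Bessel's inequality to each of the n vectors
  \<open>f i\<close> would give n + 1 \<le> n.\<close>

lemma ex_unit_orthogonal:
  fixes e f :: "nat \<Rightarrow> 'h::chilbert"
  assumes e: "orthonormal_basis e"
    and f: "\<And>i j. i < n \<Longrightarrow> j < n \<Longrightarrow> cinner (f i) (f j) = (if i = j then 1 else 0)"
  obtains r where "norm r = 1" "\<And>i. i < n \<Longrightarrow> cinner r (f i) = 0"
proof -
  have "\<exists>x. x \<noteq> 0 \<and> (\<forall>i<n. cinner x (f i) = 0)"
  proof (rule ccontr)
    assume "\<not> ?thesis"
    then have none: "x = 0" if "\<And>i. i < n \<Longrightarrow> cinner x (f i) = 0" for x
      using that by blast
    have *: "(norm x)\<^sup>2 = (\<Sum>i<n. (cmod (cinner x (f i)))\<^sup>2)" for x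
    proof -
      have "x - (\<Sum>i<n. cinner x (f i) *\<^sub>C f i) = 0"
        by (rule none) (simp add: cinner_diff_left cinner_sum_left cinner_scaleC_left f if_distrib cong: if_cong)
      then have "cinner x x = cinner (\<Sum>i<n. cinner x (f i) *\<^sub>C f i) x" by simp
      also have "\<dots> = (\<Sum>i<n. cinner x (f i) * cnj (cinner x (f i)))"
        unfolding cinner_sum_left cinner_scaleC_left cinner_commute[of "f _" x] ..
      finally have "complex_of_real ((norm x)\<^sup>2) = of_real (\<Sum>i<n. (cmod (cinner x (f i)))\<^sup>2)"
        by (simp only: cinner_self complex_norm_square[symmetric] of_real_sum)
      then show ?thesis by (simp only: of_real_eq_iff)
    qed
    have se: "suborthonormal e" using orthonormal_basis_seq[OF e] by simp
    have ne: "norm (e k) = 1" for k using orthonormal_basis_seq[OF e] by simp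
    have nf: "norm (f i) = 1" if "i < n" for i
    proof -
      have "complex_of_real ((norm (f i))\<^sup>2) = 1" unfolding cinner_self[symmetric] using f[OF that that] by simp
      then have "(norm (f i))\<^sup>2 = 1" by (simp only: of_real_eq_1_iff)
      then show ?thesis by (simp add: power2_eq_1_iff) (smt (verit) norm_ge_zero)
    qed
    have "real (Suc n) = (\<Sum>k<Suc n. (norm (e k))\<^sup>2)" by (simp add: ne)
    also have "\<dots> = (\<Sum>k<Suc n. \<Sum>i<n. (cmod (cinner (e k) (f i)))\<^sup>2)"
      by (simp only: *)
    also have "\<dots> = (\<Sum>i<n. \<Sum>k<Suc n. (cmod (cinner (f i) (e k)))\<^sup>2)"
      by (subst sum.swap) (simp only: cmod_cinner_commute)
    also have "\<dots> \<le> (\<Sum>i<n. (norm (f i))\<^sup>2)"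
      by (intro sum_mono bessel_finite se) simp
    also have "\<dots> = real n" by (simp add: nf)
    finally show False by simp
  qed
  then obtain x where x: "x \<noteq> 0" "\<And>i. i < n \<Longrightarrow> cinner x (f i) = 0" by blast
  show ?thesis
    by (rule that[of "(1 / norm x) *\<^sub>R x"]) (use x in \<open>simp_all add: cinner_scaleR_left\<close>)
qed

lemma compact_op_convergent_subseq:
  assumes X: "compact_op X" and b: "\<And>k::nat. norm (x k) \<le> 1"
  obtains r y where "strict_mono r" "(\<lambda>k. blinfun_apply X (x (r k))) \<longlonglongrightarrow> y"
proof -
  \<comment> \<open>Halving moves vectors of norm 1 into the open unit ball, on which compactness is
    stated.\<close>
  define z where "z k = blinfun_apply X ((1/2) *\<^sub>R x k)" for k
  have "z k \<in> closure (blinfun_apply X ` ball 0 1)" for k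
    unfolding z_def using b[of k] by (intro subsetD[OF closure_subset] imageI) simp
  moreover have "compact (closure (blinfun_apply X ` ball 0 1))"
    using X by (simp add: compact_op_def)
  ultimately obtain l r where r: "strict_mono r" and "(z \<circ> r) \<longlonglongrightarrow> l"
    unfolding compact_def by blast
  then have "(\<lambda>k. 2 *\<^sub>R (z \<circ> r) k) \<longlonglongrightarrow> 2 *\<^sub>R l" by (intro tendsto_intros)
  then show ?thesis using r that by (simp add: z_def blinfun.scaleR_right)
qed

text \<open>
  A maximizing sequence for the norm of \<open>X x\<close> on the unit sphere of a closed subspace has a
  subsequence with convergent images, and that subsequence is Cauchy by the parallelogram law.
\<close>

lemma compact_op_norm_attained:
  fixes X :: "'h::chilbert \<Rightarrow>\<^sub>L 'h" and M :: "'h set"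
  assumes X: "compact_op X" and M: "closed M"
    and sub: "\<And>x y. x \<in> M \<Longrightarrow> y \<in> M \<Longrightarrow> x + y \<in> M" "\<And>c x. x \<in> M \<Longrightarrow> c *\<^sub>R x \<in> M"
    and u: "u \<in> M" "norm u = 1"
  obtains r where "r \<in> M" "norm r = 1" "\<And>x. x \<in> M \<Longrightarrow> norm (blinfun_apply X x) \<le> norm (blinfun_apply X r) * norm x"
proof -
  define S where "S = (\<lambda>x. norm (blinfun_apply X x)) ` {x \<in> M. norm x = 1}"
  define s where "s = Sup S"
  have ne: "S \<noteq> {}" using u by (auto simp: S_def)
  have bdd: "bdd_above S"
  proof (rule bdd_aboveI[of _ "norm X"])
    fix y assume "y \<in> S"
    then obtain x where "norm x = 1" "y = norm (blinfun_apply X x)" by (auto simp: S_def)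
    then show "y \<le> norm X" using norm_blinfun[of X x] by simp
  qed
  have le: "norm (blinfun_apply X x) \<le> s * norm x" if "x \<in> M" for x
  proof (cases "x = 0")
    case False
    have "norm (blinfun_apply X ((1 / norm x) *\<^sub>R x)) \<le> s"
      unfolding s_def S_def[symmetric]
      by (rule cSup_upper[OF _ bdd]) (use that False sub in \<open>auto simp: S_def intro!: imageI\<close>)
    then show ?thesis using False by (simp add: blinfun.scaleR_right field_simps)
  qed simp
  have "s \<ge> 0" using order_trans[OF norm_ge_zero le[OF u(1)]] u(2) by simp
  show ?thesis
  proof (cases "s = 0")
    case True
    then show ?thesis using le u by (intro that[of u]) (auto intro: order_trans)
  next
    case False
    with \<open>s \<ge> 0\<close> have s: "s > 0" by simp
    have "\<exists>x\<in>M. norm x = 1 \<and> s - 1 / real (Suc k) < norm (blinfun_apply X x)" for k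
    proof -
      have "s - 1 / real (Suc k) < Sup S" by (simp add: s_def)
      then obtain y where "y \<in> S" "s - 1 / real (Suc k) < y" by (rule less_cSupE[OF _ ne])
      then show ?thesis by (auto simp: S_def)
    qed
    then obtain x where x: "\<And>k. x k \<in> M" "\<And>k. norm (x k) = 1"
      "\<And>k. s - 1 / real (Suc k) < norm (blinfun_apply X (x k))" by metis
    obtain r y where r: "strict_mono r" and y: "(\<lambda>k. blinfun_apply X (x (r k))) \<longlonglongrightarrow> y"
      by (rule compact_op_convergent_subseq[OF X, of x]) (simp add: x(2))
    have Cy: "Cauchy (\<lambda>k. blinfun_apply X (x (r k)))" using y by (rule LIMSEQ_imp_Cauchy)
    have "(\<lambda>k. s - 1 / real (Suc k)) \<longlonglongrightarrow> s - 0"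
      by (intro tendsto_intros LIMSEQ_Suc[OF lim_1_over_n])
    moreover have "norm (blinfun_apply X (x k)) \<le> s" for k using le[OF x(1)[of k]] x(2)[of k] by simp
    ultimately have lims: "(\<lambda>k. norm (blinfun_apply X (x k))) \<longlonglongrightarrow> s"
      using tendsto_sandwich[of "\<lambda>k. s - 1 / real (Suc k)" "\<lambda>k. norm (blinfun_apply X (x k))"
          sequentially "\<lambda>_. s" s] less_imp_le[OF x(3)]
      by simp
    then have lims': "(\<lambda>k. norm (blinfun_apply X (x (r k)))) \<longlonglongrightarrow> s"
      using LIMSEQ_subseq_LIMSEQ[OF _ r] by (force simp: o_def)
    have "Cauchy (\<lambda>k. x (r k))"
    proof (rule metric_CauchyI)
      fix \<epsilon> :: real assume \<epsilon>: "\<epsilon> > 0"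
      \<comment> \<open>Chosen for the end of the estimate: \<delta>-closeness yields
        \<open>s * (2 - norm (a + b)) < 3 * \<delta>\<close>, and the parallelogram law costs a
        further factor 4.\<close>
      define \<delta> where "\<delta> = \<epsilon>\<^sup>2 * s / 12"
      have \<delta>: "\<delta> > 0" using \<epsilon> s by (simp add: \<delta>_def)
      obtain N1 where N1: "\<And>m n. m \<ge> N1 \<Longrightarrow> n \<ge> N1 \<Longrightarrow>
          norm (blinfun_apply X (x (r m)) - blinfun_apply X (x (r n))) < \<delta>"
        using CauchyD[OF Cy \<delta>] by blast
      obtain N2 where N2: "\<And>m. m \<ge> N2 \<Longrightarrow> norm (norm (blinfun_apply X (x (r m))) - s) < \<delta>"
        using LIMSEQ_D[OF lims' \<delta>] by blast
      show "\<exists>N. \<forall>m\<ge>N. \<forall>n\<ge>N. dist (x (r m)) (x (r n)) < \<epsilon>"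
      proof (intro exI[of _ "max N1 N2"] allI impI)
        fix m n assume "max N1 N2 \<le> m" "max N1 N2 \<le> n"
        then have mn: "m \<ge> N1" "n \<ge> N1" "m \<ge> N2" by auto
        define a b where "a = x (r m)" and "b = x (r n)"
        have ab: "a \<in> M" "b \<in> M" "norm a = 1" "norm b = 1" by (simp_all add: a_def b_def x)
        have "2 * norm (blinfun_apply X a) = norm (blinfun_apply X (a + b) + (blinfun_apply X a - blinfun_apply X b))"
          by (simp add: blinfun.add_right scaleR_2[symmetric])
        also have "\<dots> \<le> s * norm (a + b) + norm (blinfun_apply X a - blinfun_apply X b)"
          by (rule order_trans[OF norm_triangle_ineq]) (simp add: le sub ab)
        finally have "2 * (s - \<delta>) < s * norm (a + b) + \<delta>"
          using N1[OF mn(1,2)] N2[OF mn(3)] by (simp add: a_def b_def)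
        then have *: "s * (2 - norm (a + b)) < 3 * \<delta>" by (simp add: algebra_simps)
        have t: "norm (a + b) \<le> 2" using norm_triangle_ineq[of a b] ab by simp
        have "(norm (a - b))\<^sup>2 = (2 - norm (a + b)) * (2 + norm (a + b))"
          using parallelogram[of a b] ab by (simp add: algebra_simps power2_eq_square)
        also have "\<dots> \<le> (2 - norm (a + b)) * 4"
          using t by (intro mult_left_mono) auto
        finally have "s * (norm (a - b))\<^sup>2 \<le> s * ((2 - norm (a + b)) * 4)"
          using s by simp
        also have "\<dots> < 12 * \<delta>" using * by (simp add: algebra_simps)
        also have "\<dots> = s * \<epsilon>\<^sup>2" by (simp add: \<delta>_def)
        finally have "(norm (a - b))\<^sup>2 < \<epsilon>\<^sup>2" using s by simp
        then show "dist (x (r m)) (x (r n)) < \<epsilon>"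
          using \<epsilon> by (simp add: a_def b_def dist_norm power2_less_imp_less)
      qed
    qed
    then obtain f where f: "(\<lambda>k. x (r k)) \<longlonglongrightarrow> f"
      using Cauchy_convergent convergent_def by blast
    have "f \<in> M" using closed_sequentially[OF M _ f] x(1) by blast
    moreover have "norm f = 1"
      using tendsto_norm[OF f] by (simp add: x(2) LIMSEQ_const_iff)
    moreover have "norm (blinfun_apply X f) = s"
    proof -
      have "(\<lambda>k. norm (blinfun_apply X (x (r k)))) \<longlonglongrightarrow> norm (blinfun_apply X f)"
        by (intro tendsto_norm bounded_linear.tendsto[OF blinfun.bounded_linear_right] f)
      then show ?thesis using lims' LIMSEQ_unique by blast
    qed
    ultimately show ?thesis using le by (intro that[of f]) auto
  qed
qed

text \<open>\<open>g n\<close> has norm 1 only where \<open>s n\<close> is nonzero, which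
  accommodates finite rank. \<open>f\<close> is orthonormal throughout but may be incomplete, as the
  kernel of the operator can contain further directions.\<close>

definition schmidt_data :: "(nat \<Rightarrow> real) \<Rightarrow> (nat \<Rightarrow> 'h::chilbert) \<Rightarrow> (nat \<Rightarrow> 'h) \<Rightarrow> bool" where
  "schmidt_data s f g \<longleftrightarrow> s \<in> c0star \<and> orthonormal_seq f \<and> suborthonormal g \<and>
     (\<forall>n. s n \<noteq> 0 \<longrightarrow> norm (g n) = 1)"

text \<open>Greedy choice: \<open>f n\<close> maximizes the norm of the image among unit vectors
  orthogonal to the earlier ones. Comparing \<open>f m\<close> with
  \<open>f m + c *\<^sub>C f n\<close> shows that the images are orthogonal. Their norms tend to 0,
  because orthogonal images of norm at least L > 0 stay apart and could have no convergent
  subsequence.\<close>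

lemma schmidt_decomposition:
  fixes e :: "nat \<Rightarrow> 'h::chilbert" and X :: "'h \<Rightarrow>\<^sub>L 'h"
  assumes e: "orthonormal_basis e" and X: "compact_op X"
  obtains s f g where "schmidt_data s f g" "X = series_op (\<lambda>n. complex_of_real (s n)) f g"
proof -
  have XB: "X \<in> bops" using X by (simp add: compact_op_def)
  define P where "P f n r \<longleftrightarrow> norm r = 1 \<and> (\<forall>i<n. cinner r (f i) = 0) \<and>
      (\<forall>x. (\<forall>i<n. cinner x (f i) = 0) \<longrightarrow> norm (blinfun_apply X x) \<le> norm (blinfun_apply X r) * norm x)"
    for f :: "nat \<Rightarrow> 'h" and n r
  have "\<exists>f. \<forall>n. P f n (f n)"
  proof (rule dependent_wellorder_choice)
    show "P f n r = P g n r" if "\<And>m. m < n \<Longrightarrow> f m = g m" for r f g n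
      using that by (simp add: P_def)
    show "\<exists>r. P f n r" if prev: "\<And>m. m < n \<Longrightarrow> P f m (f m)" for n f
    proof -
      have on: "cinner (f i) (f j) = (if i = j then 1 else 0)" if "i < n" "j < n" for i j
      proof -
        consider "i = j" | "i < j" | "j < i" by linarith
        then show ?thesis
          using prev[OF that(1)] prev[OF that(2)] cinner_orth_commute[of "f i" "f j"]
          by cases (auto simp: P_def cinner_self)
      qed
      define M where "M = (\<Inter>i<n. {x. cinner x (f i) = 0})"
      obtain u where u: "norm u = 1" "\<And>i. i < n \<Longrightarrow> cinner u (f i) = 0"
        using ex_unit_orthogonal[OF e on] by blast
      have cl: "closed M"
        unfolding M_def
        by (intro closed_INT ballI closed_Collect_eq continuous_intros
            linear_continuous_on bounded_linear_cinner_left)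
      obtain r where "r \<in> M" "norm r = 1"
        "\<And>x. x \<in> M \<Longrightarrow> norm (blinfun_apply X x) \<le> norm (blinfun_apply X r) * norm x"
        by (rule compact_op_norm_attained[OF X cl, of u])
          (auto simp: M_def cinner_add_left cinner_scaleR_left u)
      then show ?thesis by (auto simp: P_def M_def)
    qed
  qed
  then obtain f where f: "\<And>n. P f n (f n)" by blast
  have nf: "norm (f n) = 1" for n using f[of n] by (simp add: P_def)
  have of: "cinner (f n) (f i) = 0" if "i < n" for i n using f[of n] that by (simp add: P_def)
  have on: "orthonormal_seq f" by (rule orthonormal_seqI[OF nf of])
  then have sf: "suborthonormal f" by simp
  define s where "s n = norm (blinfun_apply X (f n))" for n
  have le: "norm (blinfun_apply X x) \<le> s n * norm x" if "\<And>i. i < n \<Longrightarrow> cinner x (f i) = 0" for x n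
    using f[of n] that by (simp add: P_def s_def)
  have dec: "decseq s"
    unfolding decseq_def s_def[of "_ :: nat"]
  proof (intro allI impI)
    fix m n :: nat assume "m \<le> n"
    then show "norm (blinfun_apply X (f n)) \<le> norm (blinfun_apply X (f m))"
      using le[of m "f n"] of nf by (simp add: s_def)
  qed
  have orth': "cinner (blinfun_apply X (f m)) (blinfun_apply X (f n)) = 0" if "m < n" for m n
  proof -
    define z where "z = cinner (blinfun_apply X (f m)) (blinfun_apply X (f n))"
    \<comment> \<open>Small enough for the gain of first order,
      \<open>2 * t * (cmod z)\<^sup>2\<close>, to beat the loss of second order, which this choice
      keeps below \<open>t * (cmod z)\<^sup>2\<close>.\<close>
    define t where "t = 1 / ((s m)\<^sup>2 + 1)"
    define c where "c = complex_of_real t * z"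
    have t: "t > 0" by (simp add: t_def add_nonneg_pos)
    have "cinner (f m) (c *\<^sub>C f n) = 0"
      using orthonormal_seqD[OF on, of m n] that by (simp add: cinner_scaleC_right)
    then have n1: "(norm (f m + c *\<^sub>C f n))\<^sup>2 = 1 + (cmod c)\<^sup>2"
      by (simp add: norm_add_orth nf power_mult_distrib)
    have "cinner (f m + c *\<^sub>C f n) (f i) = 0" if "i < m" for i
      using \<open>m < n\<close> that of by (simp add: cinner_add_left cinner_scaleC_left)
    then have "norm (blinfun_apply X (f m + c *\<^sub>C f n)) \<le> s m * norm (f m + c *\<^sub>C f n)"
      by (rule le)
    then have "(norm (blinfun_apply X (f m + c *\<^sub>C f n)))\<^sup>2 \<le> (s m * norm (f m + c *\<^sub>C f n))\<^sup>2"
      by (intro power_mono) auto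
    also have "\<dots> = (s m)\<^sup>2 * (1 + (cmod c)\<^sup>2)" by (simp add: power_mult_distrib n1)
    finally have "(norm (blinfun_apply X (f m) + c *\<^sub>C blinfun_apply X (f n)))\<^sup>2 \<le> (s m)\<^sup>2 * (1 + (cmod c)\<^sup>2)"
      by (simp add: blinfun.add_right bops_scaleC[OF XB])
    moreover have "Re (cinner (blinfun_apply X (f m)) (c *\<^sub>C blinfun_apply X (f n))) = t * (cmod z)\<^sup>2"
    proof -
      have "cnj c * z = complex_of_real (t * (cmod z)\<^sup>2)"
        by (simp add: c_def complex_norm_square mult_ac del: of_real_power)
      then show ?thesis by (simp add: cinner_scaleC_right z_def[symmetric])
    qed
    ultimately have "2 * (t * (cmod z)\<^sup>2) \<le> (s m)\<^sup>2 * (cmod c)\<^sup>2"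
      unfolding norm_add_sq
      by (simp add: s_def[symmetric] distrib_left) (smt (verit) zero_le_power2)
    also have "\<dots> = t * ((t * (s m)\<^sup>2) * (cmod z)\<^sup>2)"
      using t by (simp add: c_def norm_mult power_mult_distrib power2_eq_square)
    also have "\<dots> \<le> t * (1 * (cmod z)\<^sup>2)"
      using t by (intro mult_left_mono mult_right_mono) (auto simp: t_def field_simps add_nonneg_pos)
    finally have "t * (cmod z)\<^sup>2 \<le> 0" by simp
    with t have "z = 0" by (simp add: mult_le_0_iff)
    then show ?thesis by (simp add: z_def)
  qed
  then have orth: "cinner (blinfun_apply X (f m)) (blinfun_apply X (f n)) = 0" if "m \<noteq> n" for m n
    using that cinner_orth_commute by (metis linorder_neqE_nat)
  have s0: "s \<longlonglongrightarrow> 0"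
  proof -
    have sn: "s n \<ge> 0" for n by (simp add: s_def)
    obtain L where L: "s \<longlonglongrightarrow> L" "\<And>n. L \<le> s n"
      using decseq_convergent[OF dec, of 0] sn by blast
    have "L \<ge> 0" using LIMSEQ_le_const[OF L(1)] sn by blast
    have "L = 0"
    proof (rule ccontr)
      assume "L \<noteq> 0"
      with \<open>L \<ge> 0\<close> have Lp: "L > 0" by simp
      obtain r y where r: "strict_mono r" and y: "(\<lambda>k. blinfun_apply X (f (r k))) \<longlonglongrightarrow> y"
        by (rule compact_op_convergent_subseq[OF X, of f]) (simp add: nf)
      obtain N where N: "\<And>m n. m \<ge> N \<Longrightarrow> n \<ge> N \<Longrightarrow>
          norm (blinfun_apply X (f (r m)) - blinfun_apply X (f (r n))) < L"
        using CauchyD[OF LIMSEQ_imp_Cauchy[OF y] Lp] by blast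
      have "r N \<noteq> r (Suc N)" using r by (metis lessI less_irrefl strict_mono_less)
      then have "(norm (blinfun_apply X (f (r N)) - blinfun_apply X (f (r (Suc N)))))\<^sup>2 = (s (r N))\<^sup>2 + (s (r (Suc N)))\<^sup>2"
        by (simp add: norm_diff_sq orth s_def)
      moreover have "L\<^sup>2 \<le> (s (r N))\<^sup>2" using L(2) Lp by (intro power_mono) auto
      moreover have "(norm (blinfun_apply X (f (r N)) - blinfun_apply X (f (r (Suc N)))))\<^sup>2 < L\<^sup>2"
        using N[of N "Suc N"] by (intro power_strict_mono) auto
      ultimately show False using zero_le_power2[of "s (r (Suc N))"] by linarith
    qed
    then show ?thesis using L by simp
  qed
  have s: "s \<in> c0star" using dec s0 by (simp add: c0star_def s_def[of "_ :: nat"])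
  \<comment> \<open>Division by zero makes \<open>g n = 0\<close> where \<open>s n = 0\<close>; the
    identity \<open>s n *\<^sub>R g n = X (f n)\<close> holds there too, both sides being 0.\<close>
  define g where "g n = (1 / s n) *\<^sub>R blinfun_apply X (f n)" for n
  have g1: "norm (g n) = 1" if "s n \<noteq> 0" for n using that by (simp add: g_def s_def)
  have g: "suborthonormal g"
    unfolding suborthonormal_def
    by (auto simp: g_def cinner_scaleR_left cinner_scaleR_right orth) (simp add: s_def)
  have sg: "s n *\<^sub>R g n = blinfun_apply X (f n)" for n
    by (cases "s n = 0") (auto simp: g_def, simp add: s_def)
  interpret series_op_data "\<lambda>n. complex_of_real (s n)" f g by (rule series_op_dataI[OF s sf g])
  have "X = series_op (\<lambda>n. complex_of_real (s n)) f g"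
  proof (rule blinfun_eqI)
    fix x
    define p where "p n = (\<Sum>i<n. cinner x (f i) *\<^sub>C f i)" for n
    have pn: "norm (p n) \<le> norm x" for n
    proof -
      have "(norm (p n))\<^sup>2 \<le> (\<Sum>i<n. (cmod (cinner x (f i)))\<^sup>2)"
        unfolding p_def by (rule norm_sum_suborthonormal[OF sf]) simp
      also have "\<dots> \<le> (norm x)\<^sup>2" by (rule bessel_finite[OF sf]) simp
      finally show ?thesis by (simp add: power2_le_iff_abs_le)
    qed
    \<comment> \<open>\<open>p n - x\<close> is orthogonal to the first n vectors of
      \<open>f\<close>, so the maximality of \<open>f n\<close> applies to it.\<close>
    have "norm (blinfun_apply X (p n) - blinfun_apply X x) \<le> s n * (2 * norm x)" for n
    proof -
      have "norm (blinfun_apply X (p n - x)) \<le> s n * norm (p n - x)"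
        by (rule le) (simp add: p_def cinner_diff_left cinner_sum_left cinner_scaleC_left
            orthonormal_seqD[OF on] if_distrib cong: if_cong)
      also have "\<dots> \<le> s n * (2 * norm x)"
        using pn[of n] norm_triangle_ineq4[of "p n" x] by (intro mult_left_mono) (auto simp: s_def)
      finally show ?thesis by (simp add: blinfun.diff_right)
    qed
    moreover have "(\<lambda>n. s n * (2 * norm x)) \<longlonglongrightarrow> 0"
      using tendsto_mult_left_zero[OF s0] by simp
    ultimately have "(\<lambda>n. blinfun_apply X (p n)) \<longlonglongrightarrow> blinfun_apply X x"
      by (intro LIM_zero_cancel[of "\<lambda>n. blinfun_apply X (p n)"]
          Lim_null_comparison[of "\<lambda>n. blinfun_apply X (p n) - blinfun_apply X x"] always_eventually allI)
    moreover have "blinfun_apply X (p n) = (\<Sum>i<n. (complex_of_real (s i) * cinner x (f i)) *\<^sub>C g i)" for n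
      by (simp add: p_def blinfun.sum_right bops_scaleC[OF XB] sg[symmetric] scaleR_scaleC scaleC_scaleC mult.commute)
    ultimately have "(\<lambda>i. (complex_of_real (s i) * cinner x (f i)) *\<^sub>C g i) sums blinfun_apply X x"
      by (simp add: sums_def)
    then show "blinfun_apply X x = blinfun_apply (series_op (\<lambda>n. complex_of_real (s n)) f g) x"
      using series_op_sums sums_unique2 by blast
  qed
  then show ?thesis using s on g g1 by (intro that[of s f g]) (auto simp: schmidt_data_def)
qed

lemma schmidt_dataD:
  assumes "schmidt_data s f g"
  shows "s \<in> c0star" "orthonormal_seq f" "suborthonormal f" "suborthonormal g"
    "complex_of_real (s n) * (complex_of_real (norm (g n)))\<^sup>2 = complex_of_real (s n)"
  using assms by (auto simp: schmidt_data_def)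

lemma schmidt_data_diag: "s \<in> c0star \<Longrightarrow> orthonormal_seq f \<Longrightarrow> schmidt_data s f f"
  by (simp add: schmidt_data_def)

text \<open>Uniqueness is the point. Any positive square root of the square of \<open>?B\<close>
  multiplies each \<open>f n\<close> by \<open>s n\<close> and annihilates everything orthogonal to
  \<open>f\<close>, by the eigenvector lemma for square roots; continuity then determines it
  everywhere.\<close>

lemma op_abs_series_op:
  fixes f g :: "nat \<Rightarrow> 'h::chilbert"
  assumes d: "schmidt_data s f g"
  shows "op_abs (series_op (\<lambda>n. complex_of_real (s n)) f g) = series_op (\<lambda>n. complex_of_real (s n)) f f"
    (is "op_abs ?X = ?B")
proof -
  note D = schmidt_dataD[OF d]
  interpret X: series_op_data "\<lambda>n. complex_of_real (s n)" f g by (rule series_op_dataI[OF D(1,3,4)])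
  interpret X': series_op_data "\<lambda>n. complex_of_real (s n)" g f by (rule series_op_dataI[OF D(1,4,3)])
  interpret B: series_op_data "\<lambda>n. complex_of_real (s n)" f f by (rule series_op_dataI[OF D(1,3,3)])
  interpret P: series_op_data "\<lambda>n. 1" f f by (rule series_op_data_one[OF D(3,3)])
  have nf: "norm (f n) = 1" for n using D(2) by simp
  have BB: "?B o\<^sub>L ?B = adj ?X o\<^sub>L ?X"
    using series_op_compose[OF B.series_op_data_axioms B.series_op_data_axioms]
      series_op_compose[OF X.series_op_data_axioms X'.series_op_data_axioms]
    by (simp add: X.adj_series_op nf mult.assoc D(5))
  have pos: "positive_op ?B" by (rule positive_series_op[OF D(1,3)])
  show ?thesis
    unfolding op_abs_def
  proof (rule the_equality)
    show "positive_op ?B \<and> ?B o\<^sub>L ?B = adj ?X o\<^sub>L ?X" using BB pos by simp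
    fix A assume "positive_op A \<and> A o\<^sub>L A = adj ?X o\<^sub>L ?X"
    then have A: "positive_op A" and "A o\<^sub>L A = ?B o\<^sub>L ?B" using BB by simp_all
    then have AA: "blinfun_apply A (blinfun_apply A x) = blinfun_apply ?B (blinfun_apply ?B x)" for x
      by (metis blinfun_apply_blinfun_compose)
    have Af: "blinfun_apply A (f n) = complex_of_real (s n) *\<^sub>C f n" for n
    proof (rule positive_op_sqrt_eigenvector[OF A])
      show "0 \<le> s n" using D(1) by (simp add: c0star_def)
      show "blinfun_apply A (blinfun_apply A (f n)) = complex_of_real ((s n)\<^sup>2) *\<^sub>C f n"
        by (simp add: AA B.series_op_apply_left nf bops_scaleC[OF B.series_op_bops] scaleC_scaleC power2_eq_square)
    qed
    have A0: "blinfun_apply A x = 0" if "\<And>n. cinner x (f n) = 0" for x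
    proof -
      have "blinfun_apply A x = complex_of_real 0 *\<^sub>C x"
        by (rule positive_op_sqrt_eigenvector[OF A])
          (simp_all add: AA B.series_op_apply_orth[OF that] blinfun.zero_right)
      then show ?thesis by simp
    qed
    show "A = ?B"
    proof (rule blinfun_eqI)
      fix x
      \<comment> \<open>The projection of \<open>x\<close> onto the closed span of
        \<open>f\<close>.\<close>
      define y where "y = blinfun_apply (series_op (\<lambda>n. 1) f f) x"
      have "blinfun_apply A (x - y) = 0"
        by (rule A0) (simp add: y_def cinner_diff_left P.cinner_series_op_right nf)
      then have "blinfun_apply A x = blinfun_apply A y" by (simp add: blinfun.diff_right)
      moreover have "(\<lambda>n. blinfun_apply A ((1 * cinner x (f n)) *\<^sub>C f n)) sums blinfun_apply A y"
        unfolding y_def by (rule bounded_linear.sums[OF blinfun.bounded_linear_right P.series_op_sums])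
      ultimately have "(\<lambda>n. (complex_of_real (s n) * cinner x (f n)) *\<^sub>C f n) sums blinfun_apply A x"
        using A by (simp add: bops_scaleC positive_op_def Af scaleC_scaleC mult.commute)
      then show "blinfun_apply A x = blinfun_apply ?B x"
        using B.series_op_sums sums_unique2 by blast
    qed
  qed
qed

section \<open>Eigenvalue multiplicities and singular numbers\<close>

lemma null_sequence_finite_ge:
  assumes "s \<longlonglongrightarrow> (0::real)" "t > 0"
  shows "finite {n. s n \<ge> t}"
proof -
  obtain N where "\<And>n. n \<ge> N \<Longrightarrow> norm (s n - 0) < t"
    using LIMSEQ_D[OF assms] by blast
  then have "{n. s n \<ge> t} \<subseteq> {..<N}" by (force simp: not_less[symmetric])
  then show ?thesis using finite_subset by blast
qed

text \<open>At the first index n where the sequences differ, the larger value occurs in the other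
  sequence only before n, hence strictly less often. Positive levels are attained finitely often, so
  \<open>card\<close> really counts them.\<close>

lemma c0star_eqI:
  assumes s: "s \<in> c0star" and s': "s' \<in> c0star"
    and eq: "\<And>t. t > 0 \<Longrightarrow> card {n. s n = t} = card {n. s' n = t}"
  shows "s = s'"
proof (rule ccontr)
  assume "s \<noteq> s'"
  then have ex: "\<exists>n. s n \<noteq> s' n" by (simp add: fun_eq_iff)
  define n where "n = (LEAST n. s n \<noteq> s' n)"
  have n: "s n \<noteq> s' n" unfolding n_def using ex by (rule LeastI_ex)
  have less: "s m = s' m" if "m < n" for m using not_less_Least[of m] that by (auto simp: n_def)
  have False if lt: "b n < a n" and ab: "a \<in> c0star" "b \<in> c0star" and le: "\<And>m. m < n \<Longrightarrow> a m = b m"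
    and eq: "\<And>t. t > 0 \<Longrightarrow> card {n. a n = t} = card {n. b n = t}" for a b :: "nat \<Rightarrow> real"
  proof -
    have pos: "a n > 0" using lt ab(2) by (simp add: c0star_def) (metis order_le_less_trans)
    have "{m. b m = a n} \<subset> {m. a m = a n}"
    proof
      show "{m. b m = a n} \<subseteq> {m. a m = a n}"
      proof
        fix m assume m: "m \<in> {m. b m = a n}"
        have "m < n"
        proof (rule ccontr)
          assume "\<not> m < n"
          then have "b m \<le> b n" using ab(2) by (simp add: c0star_def decseq_def)
          then show False using m lt by simp
        qed
        then show "m \<in> {m. a m = a n}" using m le by simp
      qed
      show "{m. b m = a n} \<noteq> {m. a m = a n}" using lt by force
    qed
    moreover have "finite {m. a m = a n}"
      using null_sequence_finite_ge[of a "a n"] ab(1) pos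
      by (auto simp: c0star_def intro: rev_finite_subset)
    ultimately have "card {m. b m = a n} < card {m. a m = a n}" by (simp add: psubset_card_mono)
    then show False using eq[OF pos] by simp
  qed
  from this[of s' s] this[of s s'] show False
    using n s s' less eq by (metis linorder_neqE_linordered_idom)
qed

lemma complex_dim_span_orthonormal:
  assumes f: "orthonormal_seq f" and N: "finite N"
  shows "complex_vector.dim (complex_vector.span (f ` N)) = card N"
proof -
  have inj: "inj f"
    by (rule injI) (metis f orthonormal_seqD zero_neq_one)
  have "complex_vector.independent (f ` N)"
    unfolding complex_vector.independent_explicit_finite_subsets
  proof (intro allI impI ballI)
    fix S u v assume S: "S \<subseteq> f ` N" "finite S" and 0: "(\<Sum>v\<in>S. u v *\<^sub>C v) = 0" and v: "v \<in> S"
    have "cinner (\<Sum>w\<in>S. u w *\<^sub>C w) v = (\<Sum>w\<in>S. if w = v then u w else 0)"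
      unfolding cinner_sum_left cinner_scaleC_left
    proof (rule sum.cong)
      fix w assume w: "w \<in> S"
      obtain i j where "w = f i" "v = f j" using w v S by blast
      then show "u w * cinner w v = (if w = v then u w else 0)"
        using orthonormal_seqD[OF f, of i j] inj by (auto simp: inj_eq)
    qed simp
    then show "u v = 0" using 0 v S(2) by simp
  qed
  then show ?thesis
    using inj by (simp add: complex_vector.dim_span complex_vector.dim_eq_card_independent card_image inj_on_subset)
qed

text \<open>Pairing the eigenvalue equation for t > 0 with \<open>f n\<close> kills all coefficients
  except those with \<open>s n = t\<close>. The eigenspace is therefore spanned by these finitely
  many \<open>f n\<close>.\<close>

lemma singular_numbers_series_op:
  fixes f g :: "nat \<Rightarrow> 'h::chilbert"
  assumes d: "schmidt_data s f g"
  shows "singular_numbers (series_op (\<lambda>n. complex_of_real (s n)) f g) = s"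
proof -
  note D = schmidt_dataD[OF d]
  interpret B: series_op_data "\<lambda>n. complex_of_real (s n)" f f by (rule series_op_dataI[OF D(1,3,3)])
  let ?B = "series_op (\<lambda>n. complex_of_real (s n)) f f"
  have nf: "norm (f n) = 1" for n using D(2) by simp
  have card: "card {n. s n = t} = complex_vector.dim {x. blinfun_apply ?B x = complex_of_real t *\<^sub>C x}"
    if t: "t > 0" for t
  proof -
    define N where "N = {n. s n = t}"
    have N: "finite N"
      using null_sequence_finite_ge[of s t] D(1) t by (auto simp: c0star_def N_def intro: rev_finite_subset)
    have "{x. blinfun_apply ?B x = complex_of_real t *\<^sub>C x} = complex_vector.span (f ` N)"
    proof
      show "{x. blinfun_apply ?B x = complex_of_real t *\<^sub>C x} \<subseteq> complex_vector.span (f ` N)"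
      proof
        fix x assume "x \<in> {x. blinfun_apply ?B x = complex_of_real t *\<^sub>C x}"
        then have x: "blinfun_apply ?B x = complex_of_real t *\<^sub>C x" by simp
        have "cinner x (f n) = 0" if "n \<notin> N" for n
          using B.cinner_series_op_right[of x n] that
          by (auto simp: x nf cinner_scaleC_left N_def)
        then have "(\<lambda>n. (complex_of_real (s n) * cinner x (f n)) *\<^sub>C f n) sums
            (\<Sum>n\<in>N. (complex_of_real (s n) * cinner x (f n)) *\<^sub>C f n)"
          by (intro sums_finite N) simp
        then have "complex_of_real t *\<^sub>C x = (\<Sum>n\<in>N. (complex_of_real (s n) * cinner x (f n)) *\<^sub>C f n)"
          using B.series_op_sums[of x] x sums_unique2 by force
        also have "\<dots> \<in> complex_vector.span (f ` N)"
          by (intro complex_vector.span_sum complex_vector.span_scale complex_vector.span_base imageI)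
        finally have "(1 / complex_of_real t) *\<^sub>C (complex_of_real t *\<^sub>C x) \<in> complex_vector.span (f ` N)"
          by (rule complex_vector.span_scale)
        then show "x \<in> complex_vector.span (f ` N)" using t by (simp add: scaleC_scaleC scaleC_one)
      qed
      show "complex_vector.span (f ` N) \<subseteq> {x. blinfun_apply ?B x = complex_of_real t *\<^sub>C x}"
      proof (rule complex_vector.span_minimal)
        show "f ` N \<subseteq> {x. blinfun_apply ?B x = complex_of_real t *\<^sub>C x}"
          by (auto simp: N_def B.series_op_apply_left nf)
        show "complex_vector.subspace {x. blinfun_apply ?B x = complex_of_real t *\<^sub>C x}"
          by (rule complex_vector.subspaceI)
            (simp_all add: blinfun.add_right blinfun.zero_right scaleC_add_right bops_scaleC[OF B.series_op_bops]
              scaleC_scaleC mult.commute)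
      qed
    qed
    then show ?thesis using complex_dim_span_orthonormal[OF D(2) N] by (simp add: N_def)
  qed
  show ?thesis
    unfolding singular_numbers_def op_abs_series_op[OF d]
  proof (rule the_equality)
    fix s' :: "nat \<Rightarrow> real"
    assume "s' \<in> c0star \<and> (\<forall>t>0. card {n. s' n = t} =
        complex_vector.dim {x. blinfun_apply ?B x = complex_of_real t *\<^sub>C x})"
    then show "s' = s" using card D(1) by (intro c0star_eqI) auto
  qed (use D(1) card in blast)
qed

section \<open>Compactness of diagonal operators\<close>

lemma compact_combinations:
  fixes e :: "nat \<Rightarrow> 'h::chilbert"
  shows "compact ((\<lambda>c. \<Sum>i<N. c i *\<^sub>C e i) ` {c. \<forall>i. cmod (c i) \<le> K})"
proof (induction N)
  case (Suc N)
  define S where "S N = (\<lambda>c. \<Sum>i<N. c i *\<^sub>C e i) ` {c. \<forall>i. cmod (c i) \<le> K}" for N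
  have "compact ((\<lambda>z. z *\<^sub>C e N) ` cball 0 K)"
    by (intro compact_continuous_image linear_continuous_on compact_cball
        bounded_bilinear.bounded_linear_left[OF bounded_bilinear_scaleC])
  then have "compact {x + y |x y. x \<in> S N \<and> y \<in> (\<lambda>z. z *\<^sub>C e N) ` cball 0 K}"
    using Suc by (intro compact_sums) (auto simp: S_def)
  moreover have "{x + y |x y. x \<in> S N \<and> y \<in> (\<lambda>z. z *\<^sub>C e N) ` cball 0 K} = S (Suc N)"
  proof (intro equalityI subsetI)
    fix x assume "x \<in> {x + y |x y. x \<in> S N \<and> y \<in> (\<lambda>z. z *\<^sub>C e N) ` cball 0 K}"
    then obtain c z where "x = (\<Sum>i<N. c i *\<^sub>C e i) + z *\<^sub>C e N" "\<And>i. cmod (c i) \<le> K" "cmod z \<le> K"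
      by (auto simp: S_def)
    then show "x \<in> S (Suc N)"
      unfolding S_def by (intro image_eqI[of _ _ "c(N := z)"]) auto
  qed (auto simp: S_def, use mem_cball_0 in blast)
  ultimately show ?case by (simp add: S_def)
qed (auto intro: finite_imp_compact finite_subset[of _ "{0}"])

text \<open>Cutting the series after N terms moves the image of a unit ball vector by at most
  \<open>s N\<close> and lands in the compact set \<open>T N\<close>; total boundedness follows as
  \<open>s N\<close> tends to 0.\<close>

lemma compact_series_op:
  fixes e :: "nat \<Rightarrow> 'h::chilbert"
  assumes s: "s \<in> c0star" and e: "suborthonormal e"
  shows "compact_op (series_op (\<lambda>n. complex_of_real (s n)) e e)"
proof -
  interpret series_op_data "\<lambda>n. complex_of_real (s n)" e e by (rule series_op_dataI[OF s e e])
  let ?D = "series_op (\<lambda>n. complex_of_real (s n)) e e"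
  have ss: "s n \<ge> 0" "s n \<le> s m" if "m \<le> n" for m n using s that by (auto simp: c0star_def decseq_def)
  define T where "T N = (\<lambda>c. \<Sum>i<N. c i *\<^sub>C e i) ` {c. \<forall>i. cmod (c i) \<le> s 0}" for N
  have approx: "\<exists>y\<in>T N. dist (blinfun_apply ?D x) y \<le> s N" if "x \<in> ball 0 1" for x N
  proof -
    have x: "norm x \<le> 1" using that by simp
    define c where "c n = complex_of_real (s n) * cinner x (e n)" for n
    have cs: "cmod (c n) \<le> s n" for n
    proof -
      have "cmod (cinner x (e n)) \<le> norm x * norm (e n)" by (rule norm_cinner_le)
      also have "\<dots> \<le> 1 * 1" using x e by (intro mult_mono) (auto simp: suborthonormal_def)
      finally show ?thesis using ss[of n n] by (simp add: c_def norm_mult mult_left_le)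
    qed
    then have "cmod (c n) \<le> s 0" for n using ss(2)[of 0 n] order_trans by blast
    then have "(\<Sum>i<N. c i *\<^sub>C e i) \<in> T N" by (auto simp: T_def)
    moreover have "dist (blinfun_apply ?D x) (\<Sum>i<N. c i *\<^sub>C e i) \<le> s N"
    proof (rule tendsto_le[OF sequentially_bot tendsto_const])
      show "(\<lambda>m. dist (\<Sum>i<m. c i *\<^sub>C e i) (\<Sum>i<N. c i *\<^sub>C e i)) \<longlonglongrightarrow>
          dist (blinfun_apply ?D x) (\<Sum>i<N. c i *\<^sub>C e i)"
        using series_op_sums[of x] unfolding sums_def c_def[symmetric] by (intro tendsto_intros)
      have "dist (\<Sum>i<m. c i *\<^sub>C e i) (\<Sum>i<N. c i *\<^sub>C e i) \<le> s N" if "m \<ge> N" for m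
      proof -
        have "(\<Sum>i<m. c i *\<^sub>C e i) - (\<Sum>i<N. c i *\<^sub>C e i) = (\<Sum>i\<in>{N..<m}. c i *\<^sub>C e i)"
          using that by (simp add: lessThan_atLeast0 sum_diff_nat_ivl)
        then have "(dist (\<Sum>i<m. c i *\<^sub>C e i) (\<Sum>i<N. c i *\<^sub>C e i))\<^sup>2 \<le> (\<Sum>i\<in>{N..<m}. (cmod (c i))\<^sup>2)"
          using norm_sum_suborthonormal[OF e, of "{N..<m}" c] by (simp add: dist_norm)
        also have "\<dots> \<le> (\<Sum>i\<in>{N..<m}. (s N)\<^sup>2 * (cmod (cinner x (e i)))\<^sup>2)"
          using ss by (intro sum_mono)
            (auto simp: c_def norm_mult power_mult_distrib intro!: mult_right_mono power_mono)
        also have "\<dots> \<le> (s N)\<^sup>2 * (norm x)\<^sup>2"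
          unfolding sum_distrib_left[symmetric] by (intro mult_left_mono bessel_finite[OF e]) auto
        also have "\<dots> \<le> (s N)\<^sup>2" using x by (simp add: mult_left_le power_le_one)
        finally show ?thesis by (rule power2_le_imp_le) (use ss(1)[of N N] in simp)
      qed
      then show "\<forall>\<^sub>F m in sequentially. dist (\<Sum>i<m. c i *\<^sub>C e i) (\<Sum>i<N. c i *\<^sub>C e i) \<le> s N"
        using eventually_sequentially by blast
    qed
    ultimately show ?thesis by blast
  qed
  have "compact (closure (blinfun_apply ?D ` ball 0 1))"
    unfolding compact_eq_totally_bounded
  proof (intro conjI allI impI)
    show "complete (closure (blinfun_apply ?D ` ball 0 1))" by (simp add: complete_eq_closed)
    fix \<epsilon> :: real assume \<epsilon>: "\<epsilon> > 0"
    \<comment> \<open>Three errors of at most \<epsilon> / 4 are added: leaving the closure, cutting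
      the series at N, and passing to a finite net of \<open>T N\<close>.\<close>
    obtain N where "norm (s N - 0) < \<epsilon> / 4"
      using LIMSEQ_D[of s 0 "\<epsilon> / 4"] s \<epsilon> by (auto simp: c0star_def)
    then have N: "s N < \<epsilon> / 4" by simp
    have "compact (T N)" unfolding T_def by (rule compact_combinations)
    then obtain k where k: "finite k" "T N \<subseteq> (\<Union>x\<in>k. ball x (\<epsilon> / 4))"
      using \<epsilon> unfolding compact_eq_totally_bounded by (meson zero_less_divide_iff zero_less_numeral)
    have "closure (blinfun_apply ?D ` ball 0 1) \<subseteq> (\<Union>x\<in>k. ball x \<epsilon>)"
    proof
      fix z assume "z \<in> closure (blinfun_apply ?D ` ball 0 1)"
      then obtain x where x: "x \<in> ball 0 1" "dist (blinfun_apply ?D x) z < \<epsilon> / 4"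
        using \<epsilon> unfolding closure_approachable by (auto dest: spec[of _ "\<epsilon> / 4"])
      obtain y where y: "y \<in> T N" "dist (blinfun_apply ?D x) y \<le> s N" using approx[OF x(1)] by blast
      obtain w where w: "w \<in> k" "dist w y < \<epsilon> / 4" using k y by (auto simp: subset_iff)
      have "dist w z \<le> dist w y + (dist (blinfun_apply ?D x) y + dist (blinfun_apply ?D x) z)"
        using dist_triangle[of w z y] dist_triangle[of y z "blinfun_apply ?D x"]
        by (simp add: dist_commute)
      then have "dist w z < \<epsilon>" using x y w N \<epsilon> by linarith
      then show "z \<in> (\<Union>x\<in>k. ball x \<epsilon>)" using w by auto
    qed
    then show "\<exists>k. finite k \<and> closure (blinfun_apply ?D ` ball 0 1) \<subseteq> (\<Union>x\<in>k. ball x \<epsilon>)"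
      using k by blast
  qed
  then show ?thesis by (simp add: compact_op_def series_op_bops)
qed

section \<open>Ideals and their characteristic sets\<close>

abbreviation real_diag :: "(nat \<Rightarrow> 'h::chilbert) \<Rightarrow> (nat \<Rightarrow> real) \<Rightarrow> ('h \<Rightarrow>\<^sub>L 'h)" where
  "real_diag e a \<equiv> diag_op e (\<lambda>n. complex_of_real (a n))"

lemma series_op_data_diag:
  assumes "orthonormal_seq e" and a: "\<And>n. \<bar>a n\<bar> \<le> (K::real)"
  shows "series_op_data (\<lambda>n. complex_of_real (a n)) e e"
  using assms by unfold_locales (auto simp: bounded_iff)

lemma real_diag_bops:
  assumes "orthonormal_seq e" "\<And>n. \<bar>a n\<bar> \<le> (K::real)"
  shows "real_diag e a \<in> bops"
  unfolding diag_op_eq by (rule series_op_data.series_op_bops[OF series_op_data_diag[OF assms]])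

lemma real_diag_apply:
  assumes "orthonormal_seq e" "\<And>n. \<bar>a n\<bar> \<le> (K::real)"
  shows "blinfun_apply (real_diag e a) (e n) = complex_of_real (a n) *\<^sub>C e n"
  unfolding diag_op_eq
  using series_op_data.series_op_apply_left[OF series_op_data_diag[OF assms], where m = n] assms(1) by simp

lemma c0star_bounded: "a \<in> c0star \<Longrightarrow> \<bar>a n\<bar> \<le> a 0"
  by (simp add: c0star_def decseq_def)

lemma
  assumes "orthonormal_basis e" "a \<in> c0star"
  shows compact_real_diag: "compact_op (real_diag e a)"
    and singular_numbers_real_diag: "singular_numbers (real_diag e a) = a"
  using orthonormal_basis_seq[OF assms(1)] assms(2)
  by (simp_all add: diag_op_eq compact_series_op singular_numbers_series_op schmidt_data_diag)

text \<open>Each sequence is realised by its diagonal operator, so the sets that define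
  \<open>pre_ainf\<close> and \<open>post_ainf\<close> can be read back directly.\<close>

lemma charset_ideal_of_charset:
  fixes e :: "nat \<Rightarrow> 'h::chilbert"
  assumes e: "orthonormal_basis e" and S: "S \<subseteq> c0star"
  shows "charset (ideal_of_charset S :: ('h \<Rightarrow>\<^sub>L 'h) set) = S"
proof
  show "charset (ideal_of_charset S :: ('h \<Rightarrow>\<^sub>L 'h) set) \<subseteq> S"
    by (auto simp: charset_def ideal_of_charset_def)
  show "S \<subseteq> charset (ideal_of_charset S :: ('h \<Rightarrow>\<^sub>L 'h) set)"
  proof
    fix a assume "a \<in> S"
    then have "real_diag e a \<in> ideal_of_charset S" "singular_numbers (real_diag e a) = a"
      using S compact_real_diag[OF e, of a] singular_numbers_real_diag[OF e, of a]
      by (auto simp: ideal_of_charset_def)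
    then show "a \<in> charset (ideal_of_charset S :: ('h \<Rightarrow>\<^sub>L 'h) set)"
      unfolding charset_def by (metis imageI)
  qed
qed

section \<open>Closure properties of the characteristic set of an ideal\<close>

locale trace_ideal =
  fixes e :: "nat \<Rightarrow> 'h::chilbert" and I :: "('h \<Rightarrow>\<^sub>L 'h) set"
  assumes e: "orthonormal_basis e" and I: "op_ideal I" and tc: "I \<subseteq> trace_class"
begin

lemma es: "orthonormal_seq e" by (rule orthonormal_basis_seq[OF e])

lemma e_sub: "suborthonormal e" using es by simp

lemma ideal_bops: "X \<in> I \<Longrightarrow> X \<in> bops"
  using I by (auto simp: op_ideal_def)

lemma ideal_add: "X \<in> I \<Longrightarrow> Y \<in> I \<Longrightarrow> X + Y \<in> I"
  using I by (simp add: op_ideal_def)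

lemma ideal_left: "X \<in> I \<Longrightarrow> A \<in> bops \<Longrightarrow> A o\<^sub>L X \<in> I"
  using I by (simp add: op_ideal_def)

lemma ideal_right: "X \<in> I \<Longrightarrow> A \<in> bops \<Longrightarrow> X o\<^sub>L A \<in> I"
  using I by (simp add: op_ideal_def)

lemma ideal_compact: "X \<in> I \<Longrightarrow> compact_op X"
  using tc by (auto simp: trace_class_def)

text \<open>Given a Schmidt expansion of \<open>X\<close>, multiplying on the right by the operator
  carrying \<open>e n\<close> to \<open>f n\<close> and on the left by the one carrying
  \<open>g n\<close> to \<open>e n\<close> turns \<open>X\<close> into a diagonal operator without
  leaving the ideal.\<close>

lemma charset_iff: "a \<in> charset I \<longleftrightarrow> a \<in> c0star \<and> real_diag e a \<in> I"
proof
  assume "a \<in> c0star \<and> real_diag e a \<in> I"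
  then show "a \<in> charset I"
    using singular_numbers_real_diag[OF e] unfolding charset_def by (metis imageI)
next
  assume "a \<in> charset I"
  then obtain X where X: "X \<in> I" "a = singular_numbers X" by (auto simp: charset_def)
  obtain s f g where d: "schmidt_data s f g" and eq: "X = series_op (\<lambda>n. complex_of_real (s n)) f g"
    using schmidt_decomposition[OF e ideal_compact[OF X(1)]] by blast
  note D = schmidt_dataD[OF d]
  have a: "a = s" using X(2) singular_numbers_series_op[OF d] eq by simp
  interpret X: series_op_data "\<lambda>n. complex_of_real (s n)" f g by (rule series_op_dataI[OF D(1,3,4)])
  interpret F: series_op_data "\<lambda>n. 1" e f by (rule series_op_data_one[OF e_sub D(3)])
  interpret G: series_op_data "\<lambda>n. 1" g e by (rule series_op_data_one[OF D(4) e_sub])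
  interpret Y: series_op_data "\<lambda>n. complex_of_real (s n)" e g by (rule series_op_dataI[OF D(1) e_sub D(4)])
  have "X o\<^sub>L series_op (\<lambda>n. 1) e f = series_op (\<lambda>n. complex_of_real (s n)) e g"
    unfolding eq series_op_compose[OF F.series_op_data_axioms X.series_op_data_axioms]
    using D(2) by simp
  moreover have "series_op (\<lambda>n. 1) g e o\<^sub>L series_op (\<lambda>n. complex_of_real (s n)) e g = real_diag e s"
    unfolding diag_op_eq series_op_compose[OF Y.series_op_data_axioms G.series_op_data_axioms]
    by (simp add: D(5))
  ultimately have "real_diag e s \<in> I"
    using ideal_left[OF ideal_right[OF X(1) F.series_op_bops] G.series_op_bops] by simp
  then show "a \<in> c0star \<and> real_diag e a \<in> I" using D(1) a by simp
qed

lemma charset_l1star: "a \<in> charset I \<Longrightarrow> a \<in> l1star"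
  using tc charset_iff[of a] by (auto simp: charset_def trace_class_def l1star_def)

lemma charset_mono:
  assumes b: "b \<in> charset I" and a: "a \<in> c0star" and le: "\<And>n. a n \<le> b n"
  shows "a \<in> charset I"
proof -
  have B: "b \<in> c0star" "real_diag e b \<in> I" using b by (simp_all add: charset_iff)
  \<comment> \<open>Where \<open>b n = 0\<close> also \<open>a n = 0\<close>, so the conventional
    value 0 of the quotient is the right one.\<close>
  define c where "c n = a n / b n" for n
  have a0: "0 \<le> a n" and b0: "0 \<le> b n" for n using a B(1) by (simp_all add: c0star_def)
  have c: "\<bar>c n\<bar> \<le> 1" and cb: "c n * b n = a n" for n
    using a0[of n] b0[of n] le[of n] by (auto simp: c_def divide_le_eq_1)
  interpret B: series_op_data "\<lambda>n. complex_of_real (b n)" e e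
    by (rule series_op_dataI[OF B(1) e_sub e_sub])
  interpret C: series_op_data "\<lambda>n. complex_of_real (c n)" e e
    by (rule series_op_data_diag[OF es c])
  have "series_op (\<lambda>n. complex_of_real (c n)) e e o\<^sub>L real_diag e b = real_diag e a"
    unfolding diag_op_eq series_op_compose[OF B.series_op_data_axioms C.series_op_data_axioms]
    using es by (simp add: cb flip: of_real_mult)
  then have "real_diag e a \<in> I" using ideal_left[OF B(2) C.series_op_bops] by simp
  then show ?thesis using a by (simp add: charset_iff)
qed

lemma real_diag_add:
  assumes "a \<in> c0star" "b \<in> c0star"
  shows "real_diag e a + real_diag e b = real_diag e (\<lambda>n. a n + b n)"
proof (rule bops_eqI[OF e])
  have ab: "\<bar>a n + b n\<bar> \<le> a 0 + b 0" for n
    using c0star_bounded[OF assms(1), of n] c0star_bounded[OF assms(2), of n] by simp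
  show "real_diag e (\<lambda>n. a n + b n) \<in> bops" by (rule real_diag_bops[OF es ab])
  show "real_diag e a + real_diag e b \<in> bops"
    using real_diag_bops[OF es c0star_bounded[OF assms(1)]] real_diag_bops[OF es c0star_bounded[OF assms(2)]]
    by (simp add: bops_def blinfun.add_left scaleC_add_right)
  fix n
  show "blinfun_apply (real_diag e a + real_diag e b) (e n) = blinfun_apply (real_diag e (\<lambda>n. a n + b n)) (e n)"
    using real_diag_apply[OF es c0star_bounded[OF assms(1)]] real_diag_apply[OF es c0star_bounded[OF assms(2)]]
      real_diag_apply[OF es ab]
    by (simp add: blinfun.add_left scaleC_add_left)
qed

lemma charset_add:
  assumes "a \<in> charset I" "b \<in> charset I"
  shows "(\<lambda>n. a n + b n) \<in> charset I"
proof -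
  have a: "a \<in> c0star" "real_diag e a \<in> I" and b: "b \<in> c0star" "real_diag e b \<in> I"
    using assms by (simp_all add: charset_iff)
  have "(\<lambda>n. a n + b n) \<in> c0star"
    using a(1) b(1) tendsto_add[of a 0 sequentially b 0] by (auto simp: c0star_def decseq_def add_mono)
  then show ?thesis using ideal_add[OF a(2) b(2)] by (simp add: charset_iff real_diag_add a b)
qed

lemma charset_multiple:
  assumes a: "a \<in> charset I"
  shows "(\<lambda>n. real m * a n) \<in> charset I"
proof (induction m)
  case 0
  have "a \<in> c0star" using a by (simp add: charset_iff)
  then have "(\<lambda>n. 0) \<in> charset I" by (intro charset_mono[OF a]) (auto simp: c0star_def decseq_def)
  then show ?case by simp
next
  case (Suc m)
  from charset_add[OF a Suc] show ?case by (simp add: algebra_simps)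
qed

lemma charset_scale:
  assumes a: "a \<in> charset I" and c: "0 \<le> c"
  shows "(\<lambda>n. c * a n) \<in> charset I"
proof (rule charset_mono[OF charset_multiple[OF a, of "nat \<lceil>c\<rceil>"]])
  have ac: "a \<in> c0star" using a by (simp add: charset_iff)
  then show "(\<lambda>n. c * a n) \<in> c0star"
    using c tendsto_mult_right_zero[of a sequentially c] by (auto simp: c0star_def decseq_def mult_left_mono)
  show "c * a n \<le> real (nat \<lceil>c\<rceil>) * a n" for n
    using ac c by (intro mult_right_mono) (auto simp: c0star_def)
qed

text \<open>The ampliated diagonal operator is the sum of two copies of the given one, moved to the
  basis vectors of even and of odd index. Iterating the doubling produces long constant
  stretches.\<close>

lemma charset_ampliation:
  assumes a: "a \<in> charset I"
  shows "(\<lambda>n. a (n div 2)) \<in> charset I"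
proof -
  have A: "a \<in> c0star" "real_diag e a \<in> I" using a by (simp_all add: charset_iff)
  define u where "u r n = e (2 * n + r)" for r n
  have u: "suborthonormal (u r)" for r
    using suborthonormal_reindex[OF e_sub, of "\<lambda>n. 2 * n + r"] by (simp add: u_def[abs_def] inj_def o_def)
  have nu: "norm (u r n) = 1" for r n using es by (simp add: u_def)
  have W: "series_op (\<lambda>n. complex_of_real (a n)) (u r) (u r) \<in> I" for r
  proof -
    interpret V: series_op_data "\<lambda>n. 1" e "u r" by (rule series_op_data_one[OF e_sub u])
    interpret V': series_op_data "\<lambda>n. 1" "u r" e by (rule series_op_data_one[OF u e_sub])
    interpret D: series_op_data "\<lambda>n. complex_of_real (a n)" e e by (rule series_op_dataI[OF A(1) e_sub e_sub])
    interpret Y: series_op_data "\<lambda>n. complex_of_real (a n)" "u r" e by (rule series_op_dataI[OF A(1) u e_sub])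
    have "series_op (\<lambda>n. complex_of_real (a n)) e e o\<^sub>L series_op (\<lambda>n. 1) (u r) e
        = series_op (\<lambda>n. complex_of_real (a n)) (u r) e"
      unfolding series_op_compose[OF V'.series_op_data_axioms D.series_op_data_axioms] using es by simp
    moreover have "series_op (\<lambda>n. 1) e (u r) o\<^sub>L series_op (\<lambda>n. complex_of_real (a n)) (u r) e
        = series_op (\<lambda>n. complex_of_real (a n)) (u r) (u r)"
      unfolding series_op_compose[OF Y.series_op_data_axioms V.series_op_data_axioms] using es by simp
    ultimately show ?thesis
      using ideal_left[OF ideal_right[OF A(2)[unfolded diag_op_eq] V'.series_op_bops] V.series_op_bops] by simp
  qed
  define T where "T r = series_op (\<lambda>n. complex_of_real (a n)) (u r) (u r)" for r
  have T: "blinfun_apply (T r) (e m) = (if m mod 2 = r then complex_of_real (a (m div 2)) *\<^sub>C e m else 0)"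
    if "r < 2" for r m
  proof -
    interpret S: series_op_data "\<lambda>n. complex_of_real (a n)" "u r" "u r" by (rule series_op_dataI[OF A(1) u u])
    show ?thesis
    proof (cases "m mod 2 = r")
      case True
      then have "u r (m div 2) = e m" by (simp add: u_def flip: True)
      then show ?thesis using S.series_op_apply_left[of "m div 2"] nu[of r "m div 2"] True by (simp add: T_def)
    next
      case False
      have "m \<noteq> 2 * n + r" for n using False that by auto
      then have "cinner (e m) (u r n) = 0" for n using orthonormal_seqD[OF es] by (simp add: u_def)
      then show ?thesis using S.series_op_apply_orth[of "e m"] False by (simp add: T_def)
    qed
  qed
  have D2: "(\<lambda>n. a (n div 2)) \<in> c0star"
  proof -
    have "filterlim (\<lambda>n::nat. n div 2) at_top sequentially"
      unfolding filterlim_at_top eventually_sequentially by (metis (no_types, lifting) div_le_mono div_mult_self1_is_m zero_less_numeral)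
    then have "(\<lambda>n. a (n div 2)) \<longlonglongrightarrow> 0"
      using A(1) filterlim_compose[of a] by (auto simp: c0star_def)
    then show ?thesis using A(1) by (auto simp: c0star_def decseq_def div_le_mono)
  qed
  have "T 0 + T 1 = real_diag e (\<lambda>n. a (n div 2))"
  proof (rule bops_eqI[OF e])
    show "T 0 + T 1 \<in> bops" using ideal_bops[OF ideal_add[OF W W]] by (simp add: T_def)
    show "real_diag e (\<lambda>n. a (n div 2)) \<in> bops" by (rule real_diag_bops[OF es c0star_bounded[OF D2]])
    show "blinfun_apply (T 0 + T 1) (e n) = blinfun_apply (real_diag e (\<lambda>n. a (n div 2))) (e n)" for n
      using real_diag_apply[OF es c0star_bounded[OF D2], where n = n] T[of 0 n] T[of 1 n]
      by (cases "n mod 2 = 0") (auto simp: blinfun.add_left)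
  qed
  moreover have "T 0 + T 1 \<in> I" unfolding T_def by (intro ideal_add W)
  ultimately show ?thesis using D2 by (simp add: charset_iff)
qed

text \<open>A nonzero operator has \<open>s 0 > 0\<close>. Its sequence cut after the first entry
  lies in the characteristic set, and N doublings stretch it to the length 2 ^ N, which exceeds N;
  scaling gives the height \<open>M\<close>.\<close>

lemma charset_finite_support:
  assumes nz: "I \<noteq> {0}" and M: "0 \<le> M"
  shows "(\<lambda>n. if n < N then M else 0) \<in> charset I"
proof -
  have step: "(\<lambda>n. if n < N then c else 0) \<in> c0star" if "0 \<le> c" for N :: nat and c :: real
  proof -
    have "(\<lambda>n. if n < N then c else 0) \<longlonglongrightarrow> 0"
      by (rule tendsto_eventually) (auto simp: eventually_sequentially intro: exI[of _ N])
    then show ?thesis using that by (auto simp: c0star_def decseq_def)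
  qed
  have "0 \<in> I" using I by (simp add: op_ideal_def)
  then obtain X where X: "X \<in> I" "X \<noteq> 0" using nz by blast
  obtain s f g where d: "schmidt_data s f g" and eq: "X = series_op (\<lambda>n. complex_of_real (s n)) f g"
    using schmidt_decomposition[OF e ideal_compact[OF X(1)]] by blast
  note D = schmidt_dataD[OF d]
  have s: "s \<in> charset I"
    unfolding charset_def using X(1) singular_numbers_series_op[OF d] eq by (metis imageI)
  interpret X: series_op_data "\<lambda>n. complex_of_real (s n)" f g by (rule series_op_dataI[OF D(1,3,4)])
  have "s 0 \<noteq> 0"
  proof
    assume "s 0 = 0"
    then have "s n = 0" for n using c0star_bounded[OF D(1), of n] by simp
    then have "blinfun_apply X x = 0" for x unfolding eq X.series_op_apply by simp
    then have "X = 0" by (intro blinfun_eqI) simp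
    then show False using X(2) by simp
  qed
  then have s0: "s 0 > 0" using D(1) by (simp add: c0star_def order_less_le)
  have "(\<lambda>n. if n < 2 ^ k then s 0 else 0) \<in> charset I" for k
  proof (induction k)
    case 0
    show ?case
      by (rule charset_mono[OF s step]) (use D(1) in \<open>auto simp: c0star_def\<close>)
  next
    case (Suc k)
    have "(n div 2 < 2 ^ k) = (n < 2 ^ Suc k)" for n :: nat by auto
    then show ?case using charset_ampliation[OF Suc] by simp
  qed
  from charset_scale[OF this, of "M / s 0" N]
  have *: "(\<lambda>n. M / s 0 * (if n < 2 ^ N then s 0 else 0)) \<in> charset I" using M s0 by simp
  have lt: "n < 2 ^ N" if "n < N" for n using that less_exp[of N] by (rule less_trans)
  show ?thesis
    by (rule charset_mono[OF * step[OF M]]) (use M s0 lt in auto)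
qed

text \<open>Conjugation with the isometry carrying \<open>e n\<close> to
  \<open>e (\<sigma> n)\<close>. Injections are the right generality: a decreasing enumeration of
  infinitely many positive entries has to skip the zeros.\<close>

lemma charset_rearrangement:
  assumes b: "real_diag e b \<in> I" "\<And>n. \<bar>b n\<bar> \<le> K" and \<sigma>: "inj \<sigma>" "b \<circ> \<sigma> \<in> c0star"
  shows "b \<circ> \<sigma> \<in> charset I"
proof -
  have u: "suborthonormal (e \<circ> \<sigma>)" by (rule suborthonormal_reindex[OF e_sub \<sigma>(1)])
  interpret W: series_op_data "\<lambda>n. 1" e "e \<circ> \<sigma>" by (rule series_op_data_one[OF e_sub u])
  interpret W': series_op_data "\<lambda>n. 1" "e \<circ> \<sigma>" e by (rule series_op_data_one[OF u e_sub])
  have in_I: "series_op (\<lambda>n. 1) (e \<circ> \<sigma>) e o\<^sub>L (real_diag e b o\<^sub>L series_op (\<lambda>n. 1) e (e \<circ> \<sigma>)) \<in> I"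
    by (intro ideal_left ideal_right b W.series_op_bops W'.series_op_bops)
  have "series_op (\<lambda>n. 1) (e \<circ> \<sigma>) e o\<^sub>L (real_diag e b o\<^sub>L series_op (\<lambda>n. 1) e (e \<circ> \<sigma>)) = real_diag e (b \<circ> \<sigma>)"
  proof (rule bops_eqI[OF e ideal_bops[OF in_I]])
    show "real_diag e (b \<circ> \<sigma>) \<in> bops" by (rule real_diag_bops[OF es c0star_bounded[OF \<sigma>(2)]])
    show "blinfun_apply (series_op (\<lambda>n. 1) (e \<circ> \<sigma>) e o\<^sub>L (real_diag e b o\<^sub>L series_op (\<lambda>n. 1) e (e \<circ> \<sigma>))) (e n)
        = blinfun_apply (real_diag e (b \<circ> \<sigma>)) (e n)" for n
      using W.series_op_apply_left[of n] W'.series_op_apply_left[of n] es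
        real_diag_apply[OF es b(2), where n = "\<sigma> n"] real_diag_apply[OF es c0star_bounded[OF \<sigma>(2)], where n = n]
      by (simp add: scaleC_one bops_scaleC[OF W'.series_op_bops])
  qed
  then show ?thesis using in_I \<sigma>(2) by (simp add: charset_iff)
qed

end

section \<open>Horn's theorem and block orthostochastic matrices\<close>

text \<open>In the induction step of Horn's theorem this folds the two columns touched by the
  rotation into one, so that sums over n + 1 columns become sums over n columns.\<close>

lemma sum_lessThan_Suc_merge:
  fixes F :: "nat \<Rightarrow> 'a::comm_monoid_add"
  assumes "k < m"
  shows "(\<Sum>j<Suc m. F j) = (\<Sum>j<m. if j < k then F j else if j = k then F k + F (Suc k) else F (Suc j))"
  using assms
proof (induction m)
  case (Suc m)
  show ?case
  proof (cases "k = m")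
    case True
    have "(\<Sum>j<m. if j < m then F j else if j = m then F m + F (Suc m) else F (Suc j)) = (\<Sum>j<m. F j)"
      by (rule sum.cong) auto
    then show ?thesis by (simp add: True add.assoc)
  next
    case False
    then have "k < m" using Suc.prems by simp
    then show ?thesis using Suc.IH by simp
  qed
qed simp

text \<open>
  Induction on the size: a rotation in the coordinates of two adjacent entries \<open>x k \<ge> y 0 \<ge> x (Suc k)\<close>
  produces the diagonal entry \<open>y 0\<close>, and its complementary entry is merged into the remaining list.
\<close>

lemma horn_orthostochastic:
  fixes x y :: "nat \<Rightarrow> real"
  assumes "\<And>i j. i \<le> j \<Longrightarrow> j < n \<Longrightarrow> x j \<le> x i"
    and "\<And>i j. i \<le> j \<Longrightarrow> j < n \<Longrightarrow> y j \<le> y i"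
    and "\<And>m. m \<le> n \<Longrightarrow> (\<Sum>i<m. y i) \<le> (\<Sum>i<m. x i)"
    and "(\<Sum>i<n. y i) = (\<Sum>i<n. x i)"
  shows "\<exists>U. (\<forall>i<n. \<forall>j<n. (\<Sum>l<n. U i l * U j l) = (if i = j then 1 else 0)) \<and>
     (\<forall>i<n. \<forall>j<n. (\<Sum>l<n. U l i * U l j) = (if i = j then 1 else (0::real))) \<and>
     (\<forall>i<n. y i = (\<Sum>j<n. (U i j)\<^sup>2 * x j))"
  using assms
proof (induction n arbitrary: x y)
  case 0
  then show ?case by simp
next
  case (Suc n)
  note xd = Suc.prems(1) and yd = Suc.prems(2) and part = Suc.prems(3) and tot = Suc.prems(4)
  show ?case
  proof (cases "n = 0")
    case True
    with tot show ?thesis by (intro exI[of _ "\<lambda>_ _. 1"]) simp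
  next
    case False
    have x0: "y 0 \<le> x 0" using part[of 1] by simp
    have xn: "x n \<le> y 0"
    proof (rule ccontr)
      assume "\<not> x n \<le> y 0"
      then have "y i < x i" if "i < Suc n" for i
        using xd[of i n] yd[of 0 i] that by simp
      then have "(\<Sum>i<Suc n. y i) < (\<Sum>i<Suc n. x i)" by (intro sum_strict_mono) auto
      then show False using tot by simp
    qed
    \<comment> \<open>The least such index, so that also \<open>y 0 \<le> x k\<close>: by
      minimality, or for k = 0 by the first partial sum.\<close>
    define k where "k = (LEAST k. x (Suc k) \<le> y 0)"
    have ex: "x (Suc (n - 1)) \<le> y 0" using xn False by simp
    have xk1: "x (Suc k) \<le> y 0" unfolding k_def using ex by (rule LeastI)
    have "k \<le> n - 1" unfolding k_def using ex by (rule Least_le)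
    then have kn: "k < n" using False by simp
    have xk: "y 0 \<le> x k"
    proof (cases k)
      case (Suc k')
      then have "\<not> x (Suc k') \<le> y 0" using not_less_Least[of k' "\<lambda>k. x (Suc k) \<le> y 0"] Suc by (simp add: k_def)
      then show ?thesis using Suc by simp
    qed (simp add: x0)
    \<comment> \<open>A rotation preserves the trace of its block, so this is the complementary
      diagonal entry. It lies between \<open>x (Suc k)\<close> and \<open>x k\<close>, which keeps
      the merged list decreasing.\<close>
    define z where "z = x k + x (Suc k) - y 0"
    have z: "x (Suc k) \<le> z" "z \<le> x k" using xk xk1 by (simp_all add: z_def)
    define x' where "x' j = (if j < k then x j else if j = k then z else x (Suc j))" for j
    define y' where "y' j = y (Suc j)" for j
    have merge: "(\<Sum>i<m. x' i) = (\<Sum>i<Suc m. x i) - y 0" if "k < m" for m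
    proof -
      have "(\<Sum>i<m. x' i) = (\<Sum>j<m. (if j < k then x j else if j = k then x k + x (Suc k) else x (Suc j))
          - (if j = k then y 0 else 0))"
        by (rule sum.cong) (auto simp: x'_def z_def)
      then show ?thesis
        unfolding sum_lessThan_Suc_merge[OF that, of x] using that by (simp add: sum_subtractf)
    qed
    have shift: "(\<Sum>i<m. y' i) = (\<Sum>i<Suc m. y i) - y 0" for m
      unfolding y'_def sum.lessThan_Suc_shift by simp
    have "\<exists>U. (\<forall>i<n. \<forall>j<n. (\<Sum>l<n. U i l * U j l) = (if i = j then 1 else 0)) \<and>
       (\<forall>i<n. \<forall>j<n. (\<Sum>l<n. U l i * U l j) = (if i = j then 1 else (0::real))) \<and>
       (\<forall>i<n. y' i = (\<Sum>j<n. (U i j)\<^sup>2 * x' j))"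
    proof (rule Suc.IH)
      show "x' j \<le> x' i" if "i \<le> j" "j < n" for i j
      proof -
        consider "j < k" | "j = k" "i < k" | "j = k" "i = k" | "i < k" "k < j" | "i = k" "k < j" | "k < i"
          using linorder_less_linear[of i k] linorder_less_linear[of j k] by blast
        then show ?thesis
        proof cases
          case 1
          then show ?thesis using xd[of i j] that by (simp add: x'_def)
        next
          case 2
          then have "x k \<le> x i" using xd[of i k] kn by simp
          then show ?thesis using 2 z by (simp add: x'_def)
        next
          case 3
          then show ?thesis by simp
        next
          case 4
          then show ?thesis using xd[of i "Suc j"] that by (simp add: x'_def)
        next
          case 5
          then have "x (Suc j) \<le> x (Suc k)" using xd[of "Suc k" "Suc j"] that by simp
          then show ?thesis using 5 z by (simp add: x'_def)
        next
          case 6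
          then show ?thesis using xd[of "Suc i" "Suc j"] that by (simp add: x'_def)
        qed
      qed
      show "y' j \<le> y' i" if "i \<le> j" "j < n" for i j
        using yd[of "Suc i" "Suc j"] that by (simp add: y'_def)
      show "(\<Sum>i<m. y' i) \<le> (\<Sum>i<m. x' i)" if "m \<le> n" for m
      proof (cases "k < m")
        case True
        then show ?thesis using part[of "Suc m"] that by (simp only: merge shift) simp
      next
        case F: False
        \<comment> \<open>Before the merged entry the comparison holds term by term, since
          \<open>y 0 \<le> x k\<close> separates the two lists.\<close>
        show ?thesis
        proof (rule sum_mono)
          fix i assume "i \<in> {..<m}"
          then have i: "i < k" "Suc i < Suc n" using F that by auto
          have "y' i \<le> y 0" using yd[of 0 "Suc i"] i by (simp add: y'_def)
          also have "\<dots> \<le> x i" using xk xd[of i k] i kn by simp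
          finally show "y' i \<le> x' i" using i by (simp add: x'_def)
        qed
      qed
      show "(\<Sum>i<n. y' i) = (\<Sum>i<n. x' i)" using tot kn by (simp only: merge shift)
    qed
    then obtain V where
      Vr: "\<And>i j. i < n \<Longrightarrow> j < n \<Longrightarrow> (\<Sum>l<n. V i l * V j l) = (if i = j then 1 else (0::real))" and
      Vc: "\<And>i j. i < n \<Longrightarrow> j < n \<Longrightarrow> (\<Sum>l<n. V l i * V l j) = (if i = j then 1 else 0)" and
      Vy: "\<And>i. i < n \<Longrightarrow> y' i = (\<Sum>j<n. (V i j)\<^sup>2 * x' j)" by blast
    obtain c s where cs: "c\<^sup>2 + s\<^sup>2 = (1::real)" "c\<^sup>2 * x k + s\<^sup>2 * x (Suc k) = y 0"
    proof (cases "x k = x (Suc k)")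
      case True
      then show ?thesis using that[of 1 0] xk xk1 by simp
    next
      case F: False
      \<comment> \<open>The weight that makes \<open>y 0\<close> a convex combination of the two
        entries; \<open>c\<close> and \<open>s\<close> are the square roots of \<theta> and 1 -
        \<theta>.\<close>
      define \<theta> where "\<theta> = (y 0 - x (Suc k)) / (x k - x (Suc k))"
      have d: "x k - x (Suc k) > 0" using F xk xk1 by simp
      have \<theta>: "0 \<le> \<theta>" "\<theta> \<le> 1" using d xk xk1 by (simp_all add: \<theta>_def)
      have "\<theta> * (x k - x (Suc k)) = y 0 - x (Suc k)" using d by (simp add: \<theta>_def)
      then show ?thesis using that[of "sqrt \<theta>" "sqrt (1 - \<theta>)"] \<theta> by (simp add: algebra_simps)
    qed
    \<comment> \<open>Row 0 of \<open>U\<close> is (c, s) in the columns k, k + 1. The other rows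
      are those of \<open>V\<close> with column k spread over these two columns by (s, -c), which is
      orthogonal to (c, s). \<phi> sends a column of \<open>U\<close> to its column of
      \<open>V\<close>.\<close>
    define r where "r j = (if j = k then c else if j = Suc k then s else 0)" for j
    define w where "w j = (if j = k then s else if j = Suc k then - c else 1)" for j
    define \<phi> where "\<phi> j = (if j \<le> k then j else j - 1)" for j :: nat
    define U where "U i j = (case i of 0 \<Rightarrow> r j | Suc a \<Rightarrow> w j * V a (\<phi> j))" for i j
    have U0: "U 0 j = r j" and US: "U (Suc a) j = w j * V a (\<phi> j)" for a j
      by (simp_all add: U_def)
    have zc: "s\<^sup>2 * x k + c\<^sup>2 * x (Suc k) = z"
    proof -
      have "s\<^sup>2 * x k + c\<^sup>2 * x (Suc k) = (c\<^sup>2 + s\<^sup>2) * (x k + x (Suc k)) - (c\<^sup>2 * x k + s\<^sup>2 * x (Suc k))"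
        by (simp add: algebra_simps)
      then show ?thesis by (simp add: cs z_def)
    qed
    show ?thesis
    proof (intro exI[of _ U] conjI allI impI)
      fix i j assume ij: "i < Suc n" "j < Suc n"
      show "(\<Sum>l<Suc n. U i l * U j l) = (if i = j then 1 else 0)"
        unfolding sum_lessThan_Suc_merge[OF kn]
      proof (cases i; cases j)
        assume "i = 0" "j = 0"
        then have "(\<Sum>l<n. if l < k then U i l * U j l else if l = k then U i k * U j k + U i (Suc k) * U j (Suc k)
            else U i (Suc l) * U j (Suc l)) = (\<Sum>l<n. if l = k then 1 else 0)"
          using cs(1) by (intro sum.cong) (auto simp: U0 r_def power2_eq_square)
        then show "(\<Sum>l<n. if l < k then U i l * U j l else if l = k then U i k * U j k + U i (Suc k) * U j (Suc k)
            else U i (Suc l) * U j (Suc l)) = (if i = j then 1 else 0)"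
          using kn \<open>i = 0\<close> \<open>j = 0\<close> by simp
      next
        fix b assume "i = 0" "j = Suc b"
        then show "(\<Sum>l<n. if l < k then U i l * U j l else if l = k then U i k * U j k + U i (Suc k) * U j (Suc k)
            else U i (Suc l) * U j (Suc l)) = (if i = j then 1 else 0)"
          by (auto simp: U0 US r_def w_def \<phi>_def intro!: sum.neutral)
      next
        fix a assume "i = Suc a" "j = 0"
        then show "(\<Sum>l<n. if l < k then U i l * U j l else if l = k then U i k * U j k + U i (Suc k) * U j (Suc k)
            else U i (Suc l) * U j (Suc l)) = (if i = j then 1 else 0)"
          by (auto simp: U0 US r_def w_def \<phi>_def intro!: sum.neutral)
      next
        fix a b assume ab: "i = Suc a" "j = Suc b"
        have "s * V a k * (s * V b k) + c * V a k * (c * V b k) = (c\<^sup>2 + s\<^sup>2) * (V a k * V b k)"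
          by (simp add: algebra_simps power2_eq_square)
        then have "(\<Sum>l<n. if l < k then U i l * U j l else if l = k then U i k * U j k + U i (Suc k) * U j (Suc k)
            else U i (Suc l) * U j (Suc l)) = (\<Sum>l<n. V a l * V b l)"
          by (intro sum.cong) (auto simp: ab US w_def \<phi>_def cs(1))
        then show "(\<Sum>l<n. if l < k then U i l * U j l else if l = k then U i k * U j k + U i (Suc k) * U j (Suc k)
            else U i (Suc l) * U j (Suc l)) = (if i = j then 1 else 0)"
          using ab ij Vr[of a b] by simp
      qed
      have \<phi>: "\<phi> i < n" "\<phi> j < n" using ij kn by (auto simp: \<phi>_def)
      have "(\<Sum>l<Suc n. U l i * U l j) = r i * r j + (w i * w j) * (\<Sum>l<n. V l (\<phi> i) * V l (\<phi> j))"
        unfolding sum.lessThan_Suc_shift by (simp add: U0 US sum_distrib_left mult_ac)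
      also have "\<dots> = r i * r j + (if \<phi> i = \<phi> j then w i * w j else 0)"
        by (simp add: Vc \<phi>)
      also have "\<dots> = (if i = j then 1 else 0)"
        using cs(1) by (auto simp: r_def w_def \<phi>_def power2_eq_square add.commute split: if_splits)
      finally show "(\<Sum>l<Suc n. U l i * U l j) = (if i = j then 1 else 0)" .
    next
      fix i assume i: "i < Suc n"
      show "y i = (\<Sum>j<Suc n. (U i j)\<^sup>2 * x j)"
        unfolding sum_lessThan_Suc_merge[OF kn]
      proof (cases i)
        case 0
        then have "(\<Sum>j<n. if j < k then (U i j)\<^sup>2 * x j else if j = k then (U i k)\<^sup>2 * x k + (U i (Suc k))\<^sup>2 * x (Suc k)
            else (U i (Suc j))\<^sup>2 * x (Suc j)) = (\<Sum>j<n. if j = k then y 0 else 0)"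
          by (intro sum.cong) (auto simp: U0 r_def cs(2))
        then show "y i = (\<Sum>j<n. if j < k then (U i j)\<^sup>2 * x j else if j = k then (U i k)\<^sup>2 * x k + (U i (Suc k))\<^sup>2 * x (Suc k)
            else (U i (Suc j))\<^sup>2 * x (Suc j))"
          using kn 0 by simp
      next
        case (Suc a)
        have "(s * V a k)\<^sup>2 * x k + (c * V a k)\<^sup>2 * x (Suc k) = (V a k)\<^sup>2 * z"
          unfolding zc[symmetric] by (simp add: algebra_simps power2_eq_square)
        then have "(\<Sum>j<n. if j < k then (U i j)\<^sup>2 * x j else if j = k then (U i k)\<^sup>2 * x k + (U i (Suc k))\<^sup>2 * x (Suc k)
            else (U i (Suc j))\<^sup>2 * x (Suc j)) = (\<Sum>j<n. (V a j)\<^sup>2 * x' j)"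
          by (intro sum.cong) (auto simp: Suc US w_def \<phi>_def x'_def)
        then show "y i = (\<Sum>j<n. if j < k then (U i j)\<^sup>2 * x j else if j = k then (U i k)\<^sup>2 * x k + (U i (Suc k))\<^sup>2 * x (Suc k)
            else (U i (Suc j))\<^sup>2 * x (Suc j))"
          using Vy[of a] Suc i by (simp add: y'_def)
      qed
    qed
  qed
qed

text \<open>The height comes from the intermediate value theorem. Let \<open>G n\<close> be the
  excess of the partial sums of \<open>x\<close> over those of the truncation, so G vanishes at q.
  Where \<open>y\<close> is below c nothing is cut off and the hypothesis on the tails gives
  \<open>G n \<ge> 0\<close>. Before that point the increments \<open>x j - c\<close> decrease, so a
  negative G could not recover by then.\<close>

lemma trim_block:
  fixes x y :: "nat \<Rightarrow> real"
  assumes x: "decseq x" "\<And>j. 0 \<le> x j" and y: "decseq y" "\<And>j. 0 \<le> y j"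
    and pq: "p < q" and tails: "\<And>n. p \<le> n \<Longrightarrow> n \<le> q \<Longrightarrow> (\<Sum>j=n..<q. x j) \<le> (\<Sum>j=n..<q. y j)"
  obtains c where "0 \<le> c" "(\<Sum>j=p..<q. min (y j) c) = (\<Sum>j=p..<q. x j)"
    "\<And>n. p \<le> n \<Longrightarrow> n \<le> q \<Longrightarrow> (\<Sum>j=p..<n. min (y j) c) \<le> (\<Sum>j=p..<n. x j)"
proof -
  have "\<exists>c\<ge>0. c \<le> y p \<and> (\<Sum>j=p..<q. min (y j) c) = (\<Sum>j=p..<q. x j)"
  proof (rule IVT')
    have "(\<Sum>j=p..<q. min (y j) 0) = 0" using y(2) by (intro sum.neutral) simp
    then show "(\<Sum>j=p..<q. min (y j) 0) \<le> (\<Sum>j=p..<q. x j)" using x(2) by (simp add: sum_nonneg)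
    have "(\<Sum>j=p..<q. min (y j) (y p)) = (\<Sum>j=p..<q. y j)"
      using y(1) by (intro sum.cong) (auto simp: decseq_def min_def intro: antisym)
    then show "(\<Sum>j=p..<q. x j) \<le> (\<Sum>j=p..<q. min (y j) (y p))" using tails[of p] pq by simp
    show "continuous_on {0..y p} (\<lambda>c. \<Sum>j=p..<q. min (y j) c)" by (intro continuous_intros)
  qed (rule y(2))
  then obtain c where c: "0 \<le> c" "(\<Sum>j=p..<q. min (y j) c) = (\<Sum>j=p..<q. x j)" by blast
  define G where "G n = (\<Sum>j=p..<n. x j - min (y j) c)" for n
  have G1: "G n \<ge> 0" if n: "p \<le> n" "n \<le> q" "n = q \<or> y n \<le> c" for n
  proof -
    have "G n + (\<Sum>j=n..<q. x j - min (y j) c) = G q"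
      unfolding G_def by (rule sum.atLeastLessThan_concat[OF n(1,2)])
    moreover have "G q = 0" using c(2) by (simp add: G_def sum_subtractf)
    moreover have "(\<Sum>j=n..<q. x j - min (y j) c) = (\<Sum>j=n..<q. x j - y j)"
    proof (rule sum.cong)
      fix j assume "j \<in> {n..<q}"
      then have "y j \<le> c" using n(3) y(1) by (auto simp: decseq_def intro: order_trans)
      then show "x j - min (y j) c = x j - y j" by simp
    qed simp
    ultimately show ?thesis using tails[OF n(1,2)] by (simp add: sum_subtractf)
  qed
  have G: "G n \<ge> 0" if n: "p \<le> n" "n \<le> q" for n
  proof (rule ccontr)
    assume neg: "\<not> G n \<ge> 0"
    then have nq: "n < q" "c < y n" using G1[OF n] n by force+
    \<comment> \<open>The first index from n on where the truncation is inactive, or the end of the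
      block.\<close>
    define m where "m = (LEAST m. n \<le> m \<and> (m = q \<or> y m \<le> c))"
    have m: "n \<le> m \<and> (m = q \<or> y m \<le> c)" unfolding m_def by (rule LeastI[of _ q]) (use n in simp)
    have mq: "m \<le> q" unfolding m_def by (rule Least_le) (use n in simp)
    have big: "c < y j" if "j < m" for j
    proof (cases "n \<le> j")
      case True
      then show ?thesis using not_less_Least[of j "\<lambda>m. n \<le> m \<and> (m = q \<or> y m \<le> c)"] that by (force simp: m_def)
    next
      case False
      then have "y n \<le> y j" using y(1) by (simp add: decseq_def)
      then show ?thesis using nq by simp
    qed
    have Gn: "G n = (\<Sum>j=p..<n. x j - c)" unfolding G_def
      using m big by (intro sum.cong) (auto simp: min_def not_le dest: less_le_trans)
    obtain j where j: "j \<in> {p..<n}" "x j - c < 0"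
      using neg sum_nonneg[of "{p..<n}" "\<lambda>j. x j - c"] unfolding Gn by force
    have "G n + (\<Sum>j=n..<m. x j - min (y j) c) = G m"
      unfolding G_def using m n by (intro sum.atLeastLessThan_concat) auto
    moreover have "(\<Sum>j=n..<m. x j - min (y j) c) \<le> 0"
    proof (rule sum_nonpos)
      fix i assume i: "i \<in> {n..<m}"
      then have "x i \<le> x j" using j x(1) by (simp add: decseq_def)
      then show "x i - min (y i) c \<le> 0" using j big[of i] i by simp
    qed
    ultimately show False using neg G1[of m] m mq n by simp
  qed
  show ?thesis
    by (rule that[OF c]) (use G in \<open>simp add: G_def sum_subtractf\<close>)
qed

section \<open>Block structure and stochasticity\<close>

lemma l1starD:
  assumes "\<xi> \<in> l1star"
  shows "decseq \<xi>" "\<And>n. 0 \<le> \<xi> n" "\<xi> \<longlonglongrightarrow> 0" "summable \<xi>"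
  using assms by (auto simp: l1star_def c0star_def)

text \<open>\<open>block_orthogonal\<close> states vanishing only along the rows of a block. Entries
  above and below a block vanish because the blocks exhaust the indices and are disjoint, so the row
  in question belongs to another block.\<close>

lemma block_orthogonal_block:
  assumes "block_orthogonal U"
  shows "\<exists>B. finite B \<and> j \<in> B \<and> (\<forall>i l. (i \<in> B) \<noteq> (l \<in> B) \<longrightarrow> U i l = 0) \<and>
    (\<forall>i\<in>B. \<forall>k\<in>B. (\<Sum>l\<in>B. U i l * U k l) = (if i = k then 1 else 0)) \<and>
    (\<forall>i\<in>B. \<forall>k\<in>B. (\<Sum>l\<in>B. U l i * U l k) = (if i = k then 1 else 0))"
proof -
  from assms obtain p where p: "strict_mono p" "p 0 = 0" and
    zero': "\<forall>k. \<forall>i\<in>{p k..<p (Suc k)}. \<forall>l\<in>- {p k..<p (Suc k)}. U i l = 0" and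
    rows: "\<forall>k. \<forall>i\<in>{p k..<p (Suc k)}. \<forall>j\<in>{p k..<p (Suc k)}.
      (\<Sum>l\<in>{p k..<p (Suc k)}. U i l * U j l) = (if i = j then 1 else 0)" and
    cols: "\<forall>k. \<forall>i\<in>{p k..<p (Suc k)}. \<forall>j\<in>{p k..<p (Suc k)}.
      (\<Sum>l\<in>{p k..<p (Suc k)}. U l i * U l j) = (if i = j then 1 else 0)"
    unfolding block_orthogonal_def Let_def by blast
  have zero: "U i l = 0" if "i \<in> {p k..<p (Suc k)}" "l \<notin> {p k..<p (Suc k)}" for k i l
    using zero' that by blast
  have ex: "\<exists>k. i \<in> {p k..<p (Suc k)}" for i
  proof (induction i)
    case 0
    have "p 0 < p (Suc 0)" using p(1) by (simp add: strict_mono_less)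
    then show ?case using p(2) by (intro exI[of _ 0]) simp
  next
    case (Suc i)
    then obtain k where k: "i \<in> {p k..<p (Suc k)}" ..
    have "p (Suc k) < p (Suc (Suc k))" using p(1) by (simp add: strict_mono_less)
    then show ?case using k by (cases "Suc i < p (Suc k)") (auto intro: exI[of _ k] exI[of _ "Suc k"])
  qed
  obtain k where k: "j \<in> {p k..<p (Suc k)}" using ex by blast
  have col0: "U i l = 0" if "i \<notin> {p k..<p (Suc k)}" "l \<in> {p k..<p (Suc k)}" for i l
  proof -
    obtain m where m: "i \<in> {p m..<p (Suc m)}" using ex by blast
    have "l \<notin> {p m..<p (Suc m)}"
    proof
      assume "l \<in> {p m..<p (Suc m)}"
      with that(2) have "p k < p (Suc m)" "p m < p (Suc k)" by auto
      then have "k = m" using p(1) by (simp add: strict_mono_less)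
      then show False using m that(1) by simp
    qed
    then show ?thesis using zero[OF m] by blast
  qed
  show ?thesis
  proof (intro exI[of _ "{p k..<p (Suc k)}"] conjI allI impI)
    show "U i l = 0" if "(i \<in> {p k..<p (Suc k)}) \<noteq> (l \<in> {p k..<p (Suc k)})" for i l
      using that zero[of i k l] col0[of i l] by blast
  qed (use k rows cols in blast)+
qed

lemma block_orthostochastic_column_stochastic:
  assumes "block_orthostochastic Q"
  shows "column_stochastic Q"
proof -
  obtain U where U: "block_orthogonal U" "\<And>i j. Q i j = (U i j)\<^sup>2"
    using assms by (auto simp: block_orthostochastic_def)
  have "(\<lambda>j. Q i j) sums 1 \<and> (\<lambda>j. Q j i) sums 1" for i
  proof -
    from block_orthogonal_block[OF U(1), of i] obtain B where B: "finite B" "i \<in> B"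
      "\<forall>k l. (k \<in> B) \<noteq> (l \<in> B) \<longrightarrow> U k l = 0"
      "\<forall>j\<in>B. \<forall>k\<in>B. (\<Sum>l\<in>B. U j l * U k l) = (if j = k then 1 else 0)"
      "\<forall>j\<in>B. \<forall>k\<in>B. (\<Sum>l\<in>B. U l j * U l k) = (if j = k then 1 else 0)" by blast
    have "(\<lambda>j. Q i j) sums (\<Sum>l\<in>B. Q i l)" "(\<lambda>j. Q j i) sums (\<Sum>l\<in>B. Q l i)"
      using B by (auto intro!: sums_finite simp: U(2))
    then show ?thesis using B by (simp add: U(2) power2_eq_square)
  qed
  then have "summable (Q i)" "(\<Sum>j. Q i j) = 1" "summable (\<lambda>j. Q j i)" "(\<Sum>j. Q j i) = 1" for i
    by (auto simp: sums_iff)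
  moreover have "0 \<le> Q i j" for i j by (simp add: U(2))
  ultimately show ?thesis by (simp add: column_stochastic_def substochastic_def)
qed

text \<open>Compare \<open>u\<close> with the indicator \<open>v\<close> of the first n indices at
  the threshold \<open>\<xi> n\<close>: the product \<open>(u j - v j) * (\<xi> j - \<xi> n)\<close>
  is never positive, and the total weight of \<open>u\<close> does not exceed that of
  \<open>v\<close>.\<close>

lemma weighted_sum_le:
  assumes \<xi>: "\<xi> \<in> l1star" and u: "summable u" "\<And>j. 0 \<le> u j" "\<And>j. u j \<le> 1" "(\<Sum>j. u j) \<le> real n"
  shows "(\<Sum>j. u j * \<xi> j) \<le> (\<Sum>j<n. \<xi> j)"
proof -
  note x = l1starD[OF \<xi>]
  define v where "v j = (if j < n then 1 else 0 :: real)" for j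
  have v: "v sums real n" using sums_If_finite_set[of "{..<n}" "\<lambda>_. 1::real"] by (simp add: v_def[abs_def])
  have s1: "summable (\<lambda>j. u j * \<xi> j)"
    by (rule summable_comparison_test'[OF x(4)]) (simp add: u x mult_right_le_one_le mult_left_le_one_le)
  have s2: "(\<lambda>j. v j * \<xi> j) sums (\<Sum>j<n. \<xi> j)"
    using sums_If_finite_set[of "{..<n}" \<xi>] by (simp add: v_def if_distrib[of "\<lambda>a. a * _"] cong: if_cong)
  have "(\<Sum>j. u j * \<xi> j) - (\<Sum>j<n. \<xi> j) = (\<Sum>j. u j * \<xi> j - v j * \<xi> j)"
    using sums_unique[OF sums_diff[OF summable_sums[OF s1] s2]] by simp
  also have "\<dots> \<le> (\<Sum>j. (u j - v j) * \<xi> n)"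
  proof (rule suminf_le)
    show "u j * \<xi> j - v j * \<xi> j \<le> (u j - v j) * \<xi> n" for j
    proof (cases "j < n")
      case True
      then have "\<xi> n \<le> \<xi> j" using x(1) by (simp add: decseq_def)
      then have "(u j - 1) * \<xi> j \<le> (u j - 1) * \<xi> n" using u(3)[of j] by (intro mult_left_mono_neg) auto
      then show ?thesis using True by (simp add: v_def algebra_simps)
    next
      case False
      then have "\<xi> j \<le> \<xi> n" using x(1) by (simp add: decseq_def)
      then show ?thesis using False u(2)[of j] by (simp add: v_def mult_left_mono)
    qed
    show "summable (\<lambda>j. u j * \<xi> j - v j * \<xi> j)"
      using s1 s2 by (intro summable_diff) (auto simp: sums_iff)
    show "summable (\<lambda>j. (u j - v j) * \<xi> n)"
      using u(1) v by (intro summable_mult2 summable_diff) (auto simp: sums_iff)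
  qed
  also have "\<dots> = ((\<Sum>j. u j) - real n) * \<xi> n"
    using sums_unique[OF sums_mult2[OF sums_diff[OF summable_sums[OF u(1)] v], of "\<xi> n"]] by simp
  also have "\<dots> \<le> 0" using u(4) x(2)[of n] by (simp add: mult_le_0_iff)
  finally show ?thesis by simp
qed

section \<open>Majorization by column-stochastic matrices\<close>

context
  fixes P :: "nat \<Rightarrow> nat \<Rightarrow> real" and \<xi> :: "nat \<Rightarrow> real"
  assumes P: "column_stochastic P" and \<xi>: "\<xi> \<in> l1star"
begin

lemma column_stochasticD:
  "0 \<le> P i j" "summable (\<lambda>j. P i j)" "(\<Sum>j. P i j) \<le> 1" "summable (\<lambda>i. P i j)" "(\<Sum>i. P i j) = 1"
  using P by (auto simp: column_stochastic_def substochastic_def)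

lemma mat_apply_sums: "(\<lambda>j. P i j * \<xi> j) sums mat_apply P \<xi> i"
proof -
  have "\<xi> j \<le> \<xi> 0" for j using l1starD(1)[OF \<xi>] by (simp add: decseq_def)
  then have "summable (\<lambda>j. P i j * \<xi> j)"
    by (intro summable_comparison_test'[OF summable_mult2[OF column_stochasticD(2)[of i], where c = "\<xi> 0"]])
      (simp add: column_stochasticD(1) l1starD(2)[OF \<xi>] abs_mult mult_left_mono)
  then show ?thesis by (simp add: mat_apply_def summable_sums)
qed

lemma mat_apply_nonneg: "0 \<le> mat_apply P \<xi> i"
  by (rule sums_le[OF _ sums_zero mat_apply_sums]) (simp add: column_stochasticD(1) l1starD(2)[OF \<xi>])

text \<open>Adding the rows in \<open>F\<close> gives weights on \<xi>: column sums bound each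
  weight by 1, row sums bound the total by \<open>card F\<close>. As \<open>F\<close> is arbitrary,
  this controls the partial sums of every rearrangement.\<close>

lemma sum_mat_apply_le:
  assumes F: "finite F"
  shows "(\<Sum>i\<in>F. mat_apply P \<xi> i) \<le> (\<Sum>j<card F. \<xi> j)"
proof -
  have "(\<lambda>j. \<Sum>i\<in>F. P i j * \<xi> j) sums (\<Sum>i\<in>F. mat_apply P \<xi> i)"
    by (intro sums_sum mat_apply_sums)
  then have "(\<Sum>i\<in>F. mat_apply P \<xi> i) = (\<Sum>j. (\<Sum>i\<in>F. P i j) * \<xi> j)"
    by (simp add: sums_iff sum_distrib_right)
  also have "\<dots> \<le> (\<Sum>j<card F. \<xi> j)"
  proof (rule weighted_sum_le[OF \<xi>])
    show "summable (\<lambda>j. \<Sum>i\<in>F. P i j)" by (intro summable_sum column_stochasticD)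
    show "0 \<le> (\<Sum>i\<in>F. P i j)" for j by (intro sum_nonneg column_stochasticD)
    have "(\<Sum>i\<in>F. P i j) \<le> (\<Sum>i. P i j)" for j by (intro sum_le_suminf column_stochasticD F ballI)
    then show "(\<Sum>i\<in>F. P i j) \<le> 1" for j using column_stochasticD(5) by simp
    have "(\<Sum>j. \<Sum>i\<in>F. P i j) = (\<Sum>i\<in>F. \<Sum>j. P i j)" by (rule suminf_sum) (rule column_stochasticD)
    also have "\<dots> \<le> (\<Sum>i\<in>F. 1)" by (intro sum_mono column_stochasticD)
    finally show "(\<Sum>j. \<Sum>i\<in>F. P i j) \<le> real (card F)" by simp
  qed
  finally show ?thesis .
qed

lemma summable_mat_apply: "summable (mat_apply P \<xi>)"
proof (rule summableI_nonneg_bounded[where x = "\<Sum>j. \<xi> j"])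
  fix n
  have "(\<Sum>j<n. \<xi> j) \<le> (\<Sum>j. \<xi> j)" using l1starD[OF \<xi>] by (intro sum_le_suminf) auto
  then show "(\<Sum>i<n. mat_apply P \<xi> i) \<le> (\<Sum>j. \<xi> j)" using sum_mat_apply_le[of "{..<n}"] by simp
qed (rule mat_apply_nonneg)

text \<open>Column sums equal to 1 prevent any loss of mass; restricting to finitely many columns
  makes the exchange of sums elementary.\<close>

lemma suminf_mat_apply_ge: "(\<Sum>j. \<xi> j) \<le> (\<Sum>i. mat_apply P \<xi> i)"
proof (rule suminf_le_const[OF l1starD(4)[OF \<xi>]])
  fix m
  have *: "(\<lambda>i. \<Sum>j<m. P i j * \<xi> j) sums (\<Sum>j<m. 1 * \<xi> j)"
    using column_stochasticD(4,5) by (intro sums_sum sums_mult2) (simp add: sums_iff)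
  have "(\<Sum>j<m. \<xi> j) = (\<Sum>i. \<Sum>j<m. P i j * \<xi> j)" using * by (simp add: sums_iff)
  also have "\<dots> \<le> (\<Sum>i. mat_apply P \<xi> i)"
  proof (rule suminf_le)
    show "(\<Sum>j<m. P i j * \<xi> j) \<le> mat_apply P \<xi> i" for i
      unfolding mat_apply_def using sums_summable[OF mat_apply_sums[of i]]
      by (intro sum_le_suminf) (auto simp: column_stochasticD(1) l1starD(2)[OF \<xi>])
  qed (use * summable_mat_apply in \<open>auto simp: sums_iff\<close>)
  finally show "(\<Sum>j<m. \<xi> j) \<le> (\<Sum>i. mat_apply P \<xi> i)" .
qed

text \<open>The condition on the range keeps the total sum. The differences of the partial sums then
  converge to 0, and their limit is the required liminf.\<close>

lemma strongly_majorized_rearrangement: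
  assumes \<sigma>: "inj \<sigma>" and ran: "\<And>i. mat_apply P \<xi> i \<noteq> 0 \<Longrightarrow> i \<in> range \<sigma>"
  shows "strongly_majorized (mat_apply P \<xi> \<circ> \<sigma>) \<xi>"
proof -
  define \<eta> where "\<eta> = mat_apply P \<xi> \<circ> \<sigma>"
  have inj: "inj_on \<sigma> {..<n}" for n using \<sigma> inj_on_subset by blast
  have part: "(\<Sum>k<n. \<eta> k) = (\<Sum>i\<in>\<sigma> ` {..<n}. mat_apply P \<xi> i)" for n
    by (simp add: \<eta>_def sum.reindex[OF inj])
  have maj: "(\<Sum>k<n. \<eta> k) \<le> (\<Sum>j<n. \<xi> j)" for n
    unfolding part using sum_mat_apply_le[of "\<sigma> ` {..<n}"] by (simp add: card_image[OF inj])
  have \<eta>0: "\<eta> k \<ge> 0" for k by (simp add: \<eta>_def mat_apply_nonneg)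
  have sx: "(\<Sum>j<n. \<xi> j) \<le> (\<Sum>j. \<xi> j)" for n using l1starD[OF \<xi>] by (intro sum_le_suminf) auto
  have s\<eta>: "summable \<eta>"
    by (rule summableI_nonneg_bounded[where x = "\<Sum>j. \<xi> j"]) (use \<eta>0 order_trans[OF maj sx] in auto)
  have "(\<Sum>i. mat_apply P \<xi> i) \<le> (\<Sum>k. \<eta> k)"
  proof (rule suminf_le_const[OF summable_mat_apply])
    fix m
    define A where "A = {i. i < m \<and> mat_apply P \<xi> i \<noteq> 0}"
    have "finite A" "A \<subseteq> range \<sigma>" using ran by (auto simp: A_def)
    then obtain C where C: "finite C" "A = \<sigma> ` C" by (meson finite_subset_image)
    then obtain K where K: "C \<subseteq> {..<K}" by (meson finite_nat_iff_bounded)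
    have "(\<Sum>i<m. mat_apply P \<xi> i) = (\<Sum>i\<in>A. mat_apply P \<xi> i)"
      by (rule sum.mono_neutral_right) (auto simp: A_def)
    also have "\<dots> \<le> (\<Sum>i\<in>\<sigma> ` {..<K}. mat_apply P \<xi> i)"
      using C K by (intro sum_mono2) (auto simp: mat_apply_nonneg)
    also have "\<dots> \<le> (\<Sum>k. \<eta> k)"
      unfolding part[symmetric] using s\<eta> \<eta>0 by (intro sum_le_suminf) auto
    finally show "(\<Sum>i<m. mat_apply P \<xi> i) \<le> (\<Sum>k. \<eta> k)" .
  qed
  moreover have "(\<Sum>k. \<eta> k) \<le> (\<Sum>j. \<xi> j)"
    by (rule suminf_le_const[OF s\<eta>]) (rule order_trans[OF maj sx])
  ultimately have tot: "(\<Sum>k. \<eta> k) = (\<Sum>j. \<xi> j)" using suminf_mat_apply_ge by simp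
  have "(\<lambda>n. \<Sum>j<n. \<xi> j - \<eta> j) \<longlonglongrightarrow> (\<Sum>j. \<xi> j) - (\<Sum>k. \<eta> k)"
    unfolding sum_subtractf using l1starD(4)[OF \<xi>] s\<eta> by (intro tendsto_diff summable_LIMSEQ)
  then have "(\<lambda>n. ereal (\<Sum>j<n. \<xi> j - \<eta> j)) \<longlonglongrightarrow> ereal 0" by (simp add: tot)
  then have "liminf (\<lambda>n. ereal (\<Sum>j<n. \<xi> j - \<eta> j)) = 0"
    by (simp add: lim_imp_Liminf zero_ereal_def)
  then show ?thesis using maj by (simp add: strongly_majorized_def majorized_def \<eta>_def)
qed

end

lemma strongly_majorized_imp_strongly_majorized_inf:
  assumes \<xi>: "\<xi> \<in> l1star" and \<eta>: "\<eta> \<in> l1star" and maj: "strongly_majorized \<eta> \<xi>"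
  shows "strongly_majorized_inf \<xi> \<eta>"
proof -
  note x = l1starD(4)[OF \<xi>] and y = l1starD(4)[OF \<eta>]
  have "(\<lambda>n. ereal (\<Sum>j<n. \<xi> j - \<eta> j)) \<longlonglongrightarrow> ereal ((\<Sum>j. \<xi> j) - (\<Sum>k. \<eta> k))"
    unfolding sum_subtractf lim_ereal using x y by (intro tendsto_diff summable_LIMSEQ)
  then have "liminf (\<lambda>n. ereal (\<Sum>j<n. \<xi> j - \<eta> j)) = ereal ((\<Sum>j. \<xi> j) - (\<Sum>k. \<eta> k))"
    by (simp add: lim_imp_Liminf)
  then have tot: "(\<Sum>j. \<xi> j) = (\<Sum>k. \<eta> k)"
    using maj by (simp add: strongly_majorized_def zero_ereal_def)
  have "(\<Sum>j. \<xi> (j + n)) \<le> (\<Sum>j. \<eta> (j + n))" for n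
  proof -
    have "(\<Sum>j<n. \<eta> j) \<le> (\<Sum>j<n. \<xi> j)" using maj by (simp add: strongly_majorized_def majorized_def)
    then show ?thesis
      using suminf_split_initial_segment[OF x, of n] suminf_split_initial_segment[OF y, of n] tot by linarith
  qed
  then show ?thesis using tot by (simp add: strongly_majorized_inf_def majorized_inf_def)
qed

lemma ex_decreasing_rearrangement:
  fixes b :: "nat \<Rightarrow> real"
  assumes b: "\<And>i. 0 \<le> b i" and lim: "b \<longlonglongrightarrow> 0"
  obtains \<sigma> where "inj \<sigma>" "\<And>i. b i \<noteq> 0 \<Longrightarrow> i \<in> range \<sigma>" "b \<circ> \<sigma> \<in> c0star"
proof -
  note fin = null_sequence_finite_ge[OF lim]
  define P where "P f n r \<longleftrightarrow> r \<notin> f ` {..<n} \<and> (\<forall>i. i \<notin> f ` {..<n} \<longrightarrow> b i \<le> b r)"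
    for f :: "nat \<Rightarrow> nat" and n r
  have "\<exists>f. \<forall>n. P f n (f n)"
  proof (rule dependent_wellorder_choice)
    show "P f n r = P g n r" if "\<And>m. m < n \<Longrightarrow> f m = g m" for r f g n
    proof -
      have "f ` {..<n} = g ` {..<n}" using that by (intro image_cong) auto
      then show ?thesis by (simp add: P_def)
    qed
    show "\<exists>r. P f n r" for n :: nat and f
    proof (cases "\<exists>i. i \<notin> f ` {..<n} \<and> b i > 0")
      case True
      then obtain i where i: "i \<notin> f ` {..<n}" "b i > 0" by blast
      define A where "A = {j. b i \<le> b j} - f ` {..<n}"
      have A: "finite A" "A \<noteq> {}" using fin[OF i(2)] i by (auto simp: A_def)
      have "Max (b ` A) \<in> b ` A" using A by (intro Max_in) auto
      then obtain r where "r \<in> A" "b r = Max (b ` A)" by auto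
      then have r: "r \<in> A" "\<And>j. j \<in> A \<Longrightarrow> b j \<le> b r" using A(1) by simp_all
      have "b j \<le> b r" if "j \<notin> f ` {..<n}" for j
        using r that by (cases "b i \<le> b j") (auto simp: A_def)
      then show ?thesis using r(1) by (auto simp: P_def A_def)
    next
      case False
      obtain r where "r \<notin> f ` {..<n}" using ex_new_if_finite[of "f ` {..<n}"] by auto
      then have "P f n r" using False b[of r] by (auto simp: P_def not_less intro: order_trans)
      then show ?thesis ..
    qed
  qed
  then obtain \<sigma> where \<sigma>: "\<And>n. P \<sigma> n (\<sigma> n)" by blast
  have ne: "\<sigma> n \<noteq> \<sigma> m" if "m < n" for m n using \<sigma>[of n] that by (auto simp: P_def)
  then have inj: "inj \<sigma>" by (metis injI linorder_neqE_nat)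
  have "b (\<sigma> n) \<le> b (\<sigma> m)" if "m \<le> n" for m n
  proof -
    have "\<sigma> n \<notin> \<sigma> ` {..<m}" using ne that by fastforce
    then show ?thesis using \<sigma>[of m] by (simp add: P_def)
  qed
  then have dec: "decseq (b \<circ> \<sigma>)" by (simp add: decseq_def)
  have notall: "\<not> (\<forall>n. t \<le> b (\<sigma> n))" if "t > 0" for t
  proof
    assume "\<forall>n. t \<le> b (\<sigma> n)"
    then have "range \<sigma> \<subseteq> {i. t \<le> b i}" by auto
    then have "finite (range \<sigma>)" using fin[OF that] finite_subset by blast
    then show False using inj by (simp add: finite_image_iff)
  qed
  have ran: "i \<in> range \<sigma>" if "b i \<noteq> 0" for i
  proof (rule ccontr)
    assume "i \<notin> range \<sigma>"
    then have "i \<notin> \<sigma> ` {..<n}" for n by blast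
    then have "b i \<le> b (\<sigma> n)" for n using \<sigma>[of n] by (simp add: P_def)
    then show False using notall[of "b i"] that b[of i] by simp
  qed
  have "(b \<circ> \<sigma>) \<longlonglongrightarrow> 0"
  proof (rule LIMSEQ_I)
    fix r :: real assume "r > 0"
    with notall obtain N where "b (\<sigma> N) < r" by (meson not_le)
    then have "norm ((b \<circ> \<sigma>) n - 0) < r" if "n \<ge> N" for n
      using dec that b[of "\<sigma> n"] by (auto simp: decseq_def intro: order_le_less_trans)
    then show "\<exists>N. \<forall>n\<ge>N. norm ((b \<circ> \<sigma>) n - 0) < r" by blast
  qed
  then show ?thesis using inj ran dec b by (intro that[of \<sigma>]) (auto simp: c0star_def)
qed

text \<open>A bound of \<open>mat_apply Q \<xi>\<close> by 2\<eta>, together with monotonicity, is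
  enough to place it in the characteristic set containing \<eta>, since that set is solid and closed
  under scaling.\<close>

lemma block_orthostochastic_majorization:
  assumes \<xi>: "\<xi> \<in> l1star" and \<eta>: "\<eta> \<in> l1star" and maj: "majorized_inf \<xi> \<eta>"
  obtains Q where "block_orthostochastic Q" "mat_apply Q \<xi> \<in> c0star"
    "\<And>n. mat_apply Q \<xi> n \<le> 2 * \<eta> n"
proof -
  note x = l1starD[OF \<xi>] and y = l1starD[OF \<eta>]
  define \<theta> where "\<theta> n = 2 * \<eta> n" for n
  have \<theta>: "decseq \<theta>" "\<And>n. 0 \<le> \<theta> n" "\<theta> \<longlonglongrightarrow> 0" "summable \<theta>"
    using y tendsto_mult_right_zero[OF y(3), of 2] by (auto simp: \<theta>_def[abs_def] decseq_def summable_mult)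
  define \<delta> where "\<delta> n = (\<Sum>j. \<theta> (j + n)) - (\<Sum>j. \<xi> (j + n))" for n
  have \<theta>t: "(\<Sum>j. \<theta> (j + n)) = 2 * (\<Sum>j. \<eta> (j + n))" for n
    unfolding \<theta>_def using y(4) by (intro suminf_mult) (simp add: summable_iff_shift)
  have tle: "(\<Sum>j. \<xi> (j + n)) \<le> (\<Sum>j. \<eta> (j + n))" for n
    using maj by (simp add: majorized_inf_def)
  have t0: "0 \<le> (\<Sum>j. \<eta> (j + n))" for n
    using y by (intro suminf_nonneg) (auto simp: summable_iff_shift)
  \<comment> \<open>The gain from doubling: one copy of the tail of \<eta> pays for \<xi>, the other
    remains.\<close>
  have \<delta>ge: "(\<Sum>j. \<eta> (j + n)) \<le> \<delta> n" for n using tle[of n] by (simp add: \<delta>_def \<theta>t)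
  have \<delta>lim: "\<delta> \<longlonglongrightarrow> 0"
    unfolding \<delta>_def using tendsto_diff[OF suminf_exist_split2[OF \<theta>(4)] suminf_exist_split2[OF x(4)]] by simp
  have \<delta>diff: "\<delta> n - \<delta> q = (\<Sum>j=n..<q. \<theta> j) - (\<Sum>j=n..<q. \<xi> j)" if "n \<le> q" for n q
  proof -
    have "(\<Sum>j. a (j + n)) - (\<Sum>j. a (j + q)) = (\<Sum>j=n..<q. a j)" if "summable a" for a :: "nat \<Rightarrow> real"
      using suminf_split_initial_segment[OF that, of n] suminf_split_initial_segment[OF that, of q]
        sum.atLeastLessThan_concat[of 0 n q a] \<open>n \<le> q\<close> by (simp add: lessThan_atLeast0)
    from this[OF \<theta>(4)] this[OF x(4)] show ?thesis by (simp add: \<delta>_def)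
  qed
  have "\<exists>q>p. \<delta> q \<le> \<delta> p" for p
  proof (cases "\<delta> p > 0")
    case True
    then obtain N where "\<And>n. n \<ge> N \<Longrightarrow> norm (\<delta> n - 0) < \<delta> p" using LIMSEQ_D[OF \<delta>lim] by blast
    then have "\<delta> (max N (Suc p)) < \<delta> p" by (metis max.cobounded1 diff_zero real_norm_def abs_less_iff)
    then show ?thesis by (intro exI[of _ "max N (Suc p)"]) auto
  next
    \<comment> \<open>Then the tail of \<eta> vanishes, and with it that of \<xi>; \<delta> stays
      constant and the next index serves.\<close>
    case False
    then have t: "(\<Sum>j. \<eta> (j + p)) = 0" using \<delta>ge[of p] t0[of p] by simp
    then have "\<eta> (j + p) = 0" for j
      using suminf_eq_zero_iff[of "\<lambda>j. \<eta> (j + p)"] y by (simp add: summable_iff_shift)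
    then have e: "\<eta> j = 0" if "j \<ge> p" for j using that by (metis le_add_diff_inverse2)
    have "(\<Sum>j. \<xi> (j + p)) = 0"
      using tle[of p] t x by (intro antisym suminf_nonneg) (auto simp: summable_iff_shift)
    then have "\<xi> (j + p) = 0" for j
      using suminf_eq_zero_iff[of "\<lambda>j. \<xi> (j + p)"] x by (simp add: summable_iff_shift)
    then have "\<xi> j = 0" if "j \<ge> p" for j using that by (metis le_add_diff_inverse2)
    then have "\<delta> (Suc p) = \<delta> p" by (simp add: \<delta>_def \<theta>_def e)
    then show ?thesis by (intro exI[of _ "Suc p"]) simp
  qed
  have "\<exists>q>p. \<forall>n. p \<le> n \<longrightarrow> n \<le> q \<longrightarrow> \<delta> q \<le> \<delta> n" for p
  proof -
    \<comment> \<open>At the first return of \<delta> to its value at p or below, all intermediate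
      values exceed \<open>\<delta> p\<close>, so q is minimal over the whole block.\<close>
    define q where "q = (LEAST q. p < q \<and> \<delta> q \<le> \<delta> p)"
    have q: "p < q \<and> \<delta> q \<le> \<delta> p"
      unfolding q_def using \<open>\<exists>q>p. \<delta> q \<le> \<delta> p\<close> by (rule LeastI_ex)
    have "\<delta> q \<le> \<delta> n" if "p \<le> n" "n \<le> q" for n
    proof (cases "n = p \<or> n = q")
      case False
      then have "p < n" "n < q" using that by auto
      then have "\<delta> p < \<delta> n" using not_less_Least[of n "\<lambda>q. p < q \<and> \<delta> q \<le> \<delta> p"] by (simp add: q_def)
      then show ?thesis using q by simp
    qed (use q in auto)
    then show ?thesis using q by blast
  qed
  then obtain nxt where nxt: "\<And>p. p < nxt p" "\<And>p n. p \<le> n \<Longrightarrow> n \<le> nxt p \<Longrightarrow> \<delta> (nxt p) \<le> \<delta> n"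
    by metis
  have "\<exists>c\<ge>0. (\<Sum>j=p..<nxt p. min (\<theta> j) c) = (\<Sum>j=p..<nxt p. \<xi> j) \<and>
      (\<forall>n. p \<le> n \<longrightarrow> n \<le> nxt p \<longrightarrow> (\<Sum>j=p..<n. min (\<theta> j) c) \<le> (\<Sum>j=p..<n. \<xi> j))" for p
  proof -
    \<comment> \<open>By \<open>\<delta>diff\<close>, minimality of \<delta> at the end of the block
      is the same as comparison of the tails taken inside the block.\<close>
    have "(\<Sum>j=n..<nxt p. \<xi> j) \<le> (\<Sum>j=n..<nxt p. \<theta> j)" if "p \<le> n" "n \<le> nxt p" for n
      using nxt(2)[OF that] \<delta>diff[OF that(2)] by simp
    then obtain c where "0 \<le> c" "(\<Sum>j=p..<nxt p. min (\<theta> j) c) = (\<Sum>j=p..<nxt p. \<xi> j)"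
      "\<And>n. p \<le> n \<Longrightarrow> n \<le> nxt p \<Longrightarrow> (\<Sum>j=p..<n. min (\<theta> j) c) \<le> (\<Sum>j=p..<n. \<xi> j)"
      using trim_block[OF x(1,2) \<theta>(1,2) nxt(1)[of p]] by metis
    then show ?thesis by blast
  qed
  then obtain cc where cc: "\<And>p. 0 \<le> cc p"
    "\<And>p. (\<Sum>j=p..<nxt p. min (\<theta> j) (cc p)) = (\<Sum>j=p..<nxt p. \<xi> j)"
    "\<And>p n. p \<le> n \<Longrightarrow> n \<le> nxt p \<Longrightarrow> (\<Sum>j=p..<n. min (\<theta> j) (cc p)) \<le> (\<Sum>j=p..<n. \<xi> j)"
    by metis
  define p where "p k = (nxt ^^ k) 0" for k
  have pS: "p (Suc k) = nxt (p k)" and p0: "p 0 = 0" for k by (simp_all add: p_def)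
  have p: "strict_mono p" by (simp add: strict_mono_Suc_iff pS nxt)
  \<comment> \<open>The number of the block containing j; it selects the truncation height at
    j.\<close>
  define \<kappa> where "\<kappa> j = (LEAST k. j < p (Suc k))" for j
  have "j < p (Suc j)" for j using strict_mono_imp_increasing[OF p, of "Suc j"] by simp
  then have \<kappa>1: "j < p (Suc (\<kappa> j))" for j unfolding \<kappa>_def by (rule LeastI)
  have \<kappa>2: "p (\<kappa> j) \<le> j" for j
  proof (cases "\<kappa> j")
    case (Suc k)
    then have "\<not> j < p (Suc k)" using not_less_Least[of k "\<lambda>k. j < p (Suc k)"] by (simp add: \<kappa>_def)
    then show ?thesis using Suc by simp
  qed (simp add: p0)
  have \<kappa>: "\<kappa> j = k" if "p k \<le> j" "j < p (Suc k)" for j k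
  proof -
    have "p k < p (Suc (\<kappa> j))" "p (\<kappa> j) < p (Suc k)" using \<kappa>1[of j] \<kappa>2[of j] that by auto
    then show ?thesis using p by (simp add: strict_mono_less)
  qed
  define \<zeta> where "\<zeta> j = min (\<theta> j) (cc (p (\<kappa> j)))" for j
  have \<zeta>sum: "(\<Sum>j=p k..<n. \<zeta> j) = (\<Sum>j=p k..<n. min (\<theta> j) (cc (p k)))" if "n \<le> p (Suc k)" for k n
    using that by (intro sum.cong) (auto simp: \<zeta>_def \<kappa>)
  have part: "(\<Sum>j=p k..<n. \<zeta> j) \<le> (\<Sum>j=p k..<n. \<xi> j)" if "p k \<le> n" "n \<le> p (Suc k)" for k n
    using cc(3)[of "p k" n] that by (simp add: \<zeta>sum pS)
  have tot: "(\<Sum>j=p k..<p (Suc k). \<zeta> j) = (\<Sum>j=p k..<p (Suc k). \<xi> j)" for k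
    using cc(2)[of "p k"] by (simp add: \<zeta>sum pS)
  have \<zeta>0: "0 \<le> \<zeta> j" and \<zeta>le: "\<zeta> j \<le> \<theta> j" for j using \<theta>(2) cc(1) by (simp_all add: \<zeta>_def)
  have \<zeta>dec: "\<zeta> (Suc j) \<le> \<zeta> j" for j
  proof (cases "Suc j < p (Suc (\<kappa> j))")
    case True
    then have "\<kappa> (Suc j) = \<kappa> j" using \<kappa>2[of j] by (intro \<kappa>) auto
    moreover have "\<theta> (Suc j) \<le> \<theta> j" using \<theta>(1) by (simp add: decseq_def)
    ultimately show ?thesis by (auto simp: \<zeta>_def)
  next
    \<comment> \<open>Here j ends its block. Equal block sums with smaller partial sums give
      \<open>\<xi> j \<le> \<zeta> j\<close>, and the first entry of the next block satisfies
      \<open>\<zeta> (Suc j) \<le> \<xi> (Suc j)\<close>. So the decrease across the boundary is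
      inherited from \<xi>, whatever the heights of the two blocks.\<close>
    case False
    define k where "k = \<kappa> j"
    have Sj: "Suc j = p (Suc k)" using False \<kappa>1[of j] by (simp add: k_def)
    have "p k \<le> j" using \<kappa>2 by (simp add: k_def)
    then have "\<xi> j \<le> \<zeta> j" using tot[of k] part[of k j] by (simp flip: Sj)
    have "p (Suc k) < p (Suc (Suc k))" using p by (simp add: strict_mono_less)
    then have "\<zeta> (Suc j) \<le> \<xi> (Suc j)" using part[of "Suc k" "Suc (p (Suc k))"] by (simp add: Sj)
    also have "\<dots> \<le> \<xi> j" using x(1) by (simp add: decseq_def)
    finally show ?thesis using \<open>\<xi> j \<le> \<zeta> j\<close> by simp
  qed
  then have \<zeta>d: "decseq \<zeta>" by (simp add: decseq_Suc_iff)
  have "\<zeta> \<longlonglongrightarrow> 0"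
    by (rule tendsto_sandwich[OF _ _ tendsto_const \<theta>(3)]) (auto simp: \<zeta>0 \<zeta>le)
  then have \<zeta>c: "\<zeta> \<in> c0star" using \<zeta>d \<zeta>0 by (simp add: c0star_def)
  have shift: "(\<Sum>j=p k..<n. f j) = (\<Sum>i<n - p k. f (p k + i))" for k n and f :: "nat \<Rightarrow> real"
    unfolding sum.atLeastLessThan_shift_0[of f "p k" n] by (simp add: lessThan_atLeast0)
  define R where "R k V \<longleftrightarrow>
     (\<forall>i<p (Suc k) - p k. \<forall>j<p (Suc k) - p k.
        (\<Sum>l<p (Suc k) - p k. V i l * V j l) = (if i = j then 1 else 0)) \<and>
     (\<forall>i<p (Suc k) - p k. \<forall>j<p (Suc k) - p k.
        (\<Sum>l<p (Suc k) - p k. V l i * V l j) = (if i = j then 1 else 0)) \<and>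
     (\<forall>i<p (Suc k) - p k. \<zeta> (p k + i) = (\<Sum>j<p (Suc k) - p k. (V i j)\<^sup>2 * \<xi> (p k + j)))"
    for k and V :: "nat \<Rightarrow> nat \<Rightarrow> real"
  have "\<exists>V. R k V" for k
    unfolding R_def
  proof (rule horn_orthostochastic)
    have pk: "p k < p (Suc k)" using p by (simp add: strict_mono_less)
    show "(\<Sum>i<m. \<zeta> (p k + i)) \<le> (\<Sum>i<m. \<xi> (p k + i))" if "m \<le> p (Suc k) - p k" for m
      using part[of k "p k + m"] that pk by (simp add: shift)
    show "(\<Sum>i<p (Suc k) - p k. \<zeta> (p k + i)) = (\<Sum>i<p (Suc k) - p k. \<xi> (p k + i))"
      using tot[of k] by (simp add: shift)
  qed (use x(1) \<zeta>d in \<open>auto simp: decseq_def\<close>)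
  then obtain V where "\<And>k. R k (V k)" by metis
  then have
    Vr: "\<And>k i j. i < p (Suc k) - p k \<Longrightarrow> j < p (Suc k) - p k \<Longrightarrow>
      (\<Sum>l<p (Suc k) - p k. V k i l * V k j l) = (if i = j then 1 else 0)" and
    Vc: "\<And>k i j. i < p (Suc k) - p k \<Longrightarrow> j < p (Suc k) - p k \<Longrightarrow>
      (\<Sum>l<p (Suc k) - p k. V k l i * V k l j) = (if i = j then 1 else 0)" and
    V\<zeta>: "\<And>k i. i < p (Suc k) - p k \<Longrightarrow> \<zeta> (p k + i) = (\<Sum>j<p (Suc k) - p k. (V k i j)\<^sup>2 * \<xi> (p k + j))"
    unfolding R_def by simp_all
  \<comment> \<open>\<open>V k\<close> uses indices relative to the start \<open>p k\<close> of its
    block.\<close>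
  define U where "U i j = (if \<kappa> i = \<kappa> j then V (\<kappa> i) (i - p (\<kappa> i)) (j - p (\<kappa> i)) else 0)" for i j
  have U: "U (p k + i) (p k + j) = V k i j" if "i < p (Suc k) - p k" "j < p (Suc k) - p k" for k i j
  proof -
    have "\<kappa> (p k + i) = k" "\<kappa> (p k + j) = k" using that by (auto intro!: \<kappa>)
    then show ?thesis by (simp add: U_def)
  qed
  have in_block: "\<exists>i'. i' < p (Suc k) - p k \<and> i = p k + i'" if "i \<in> {p k..<p (Suc k)}" for i k
    using that by (intro exI[of _ "i - p k"]) auto
  have "block_orthogonal U"
    unfolding block_orthogonal_def Let_def
  proof (intro exI[of _ p] conjI p p0 allI ballI)
    fix k i j assume i: "i \<in> {p k..<p (Suc k)}" and j: "j \<in> - {p k..<p (Suc k)}"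
    have "\<kappa> i = k" using i by (intro \<kappa>) auto
    moreover have "\<kappa> j \<noteq> k" using \<kappa>1[of j] \<kappa>2[of j] j by auto
    ultimately show "U i j = 0" by (simp add: U_def)
  next
    fix k i j assume "i \<in> {p k..<p (Suc k)}" and "j \<in> {p k..<p (Suc k)}"
    then obtain i' j' where ij: "i' < p (Suc k) - p k" "i = p k + i'" "j' < p (Suc k) - p k" "j = p k + j'"
      using in_block by meson
    show "(\<Sum>l = p k..<p (Suc k). U i l * U j l) = (if i = j then 1 else 0)"
      using Vr[OF ij(1,3)] by (simp add: shift ij U)
    show "(\<Sum>l = p k..<p (Suc k). U l i * U l j) = (if i = j then 1 else 0)"
      using Vc[OF ij(1,3)] by (simp add: shift ij U)
  qed
  then have Q: "block_orthostochastic (\<lambda>i j. (U i j)\<^sup>2)" by (auto simp: block_orthostochastic_def)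
  have "mat_apply (\<lambda>i j. (U i j)\<^sup>2) \<xi> i = \<zeta> i" for i
  proof -
    define k where "k = \<kappa> i"
    have "i \<in> {p k..<p (Suc k)}" using \<kappa>1[of i] \<kappa>2[of i] by (simp add: k_def)
    then obtain i' where i': "i' < p (Suc k) - p k" "i = p k + i'" using in_block by blast
    have "U i j = 0" if "j \<notin> {p k..<p (Suc k)}" for j
      using \<kappa>1[of j] \<kappa>2[of j] that by (auto simp: U_def k_def)
    then have "mat_apply (\<lambda>i j. (U i j)\<^sup>2) \<xi> i = (\<Sum>j=p k..<p (Suc k). (U i j)\<^sup>2 * \<xi> j)"
      unfolding mat_apply_def by (intro suminf_finite) auto
    also have "\<dots> = \<zeta> i" using V\<zeta>[OF i'(1)] by (simp add: shift i' U)
    finally show ?thesis .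
  qed
  then have "mat_apply (\<lambda>i j. (U i j)\<^sup>2) \<xi> = \<zeta>" by (rule ext)
  then show ?thesis using Q \<zeta>c \<zeta>le by (intro that[of "\<lambda>i j. (U i j)\<^sup>2"]) (auto simp: \<theta>_def)
qed

section \<open>Matrices of isometries\<close>

text \<open>The n-th diagonal entry is the quadratic form of the diagonal operator at
  \<open>adj V\<close> applied to \<open>e n\<close>, whose coordinates have the moduli of row n of
  the matrix of \<open>V\<close>.\<close>

lemma cond_exp_conjugate:
  fixes e :: "nat \<Rightarrow> 'h::chilbert"
  assumes e: "orthonormal_basis e" and V: "V \<in> bops" and \<xi>: "\<xi> \<in> c0star"
  shows "cond_exp e (V o\<^sub>L real_diag e \<xi> o\<^sub>L adj V)
    = real_diag e (mat_apply (\<lambda>i j. (cmod (op_matrix e V i j))\<^sup>2) \<xi>)"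
proof -
  have es: "suborthonormal e" using orthonormal_basis_seq[OF e] by simp
  interpret D: series_op_data "\<lambda>n. complex_of_real (\<xi> n)" e e by (rule series_op_dataI[OF \<xi> es es])
  have "op_matrix e (V o\<^sub>L real_diag e \<xi> o\<^sub>L adj V) n n
      = of_real (mat_apply (\<lambda>i j. (cmod (op_matrix e V i j))\<^sup>2) \<xi> n)" for n
  proof -
    define w where "w = blinfun_apply (adj V) (e n)"
    have ew: "cinner (e j) w = op_matrix e V n j" for j
      by (simp add: w_def op_matrix_def cinner_adj[OF e V])
    have eq: "complex_of_real (\<xi> j) * cinner w (e j) * cinner (e j) w
        = complex_of_real ((cmod (op_matrix e V n j))\<^sup>2 * \<xi> j)" for j
    proof -
      have "cinner w (e j) * cinner (e j) w = complex_of_real ((cmod (op_matrix e V n j))\<^sup>2)"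
        unfolding cinner_commute[of w "e j"] ew complex_norm_square by (simp add: mult.commute)
      then show ?thesis by (simp add: mult.assoc)
    qed
    have *: "(\<lambda>j. complex_of_real ((cmod (op_matrix e V n j))\<^sup>2 * \<xi> j)) sums
        cinner (blinfun_apply (real_diag e \<xi>) w) w"
      using D.cinner_series_op_sums[of w w] unfolding diag_op_eq eq .
    then have "summable (\<lambda>j. (cmod (op_matrix e V n j))\<^sup>2 * \<xi> j)"
      using summable_complex_of_real sums_summable by blast
    from sums_of_real[OF summable_sums[OF this], where 'a = complex]
    have "cinner (blinfun_apply (real_diag e \<xi>) w) w
        = of_real (mat_apply (\<lambda>i j. (cmod (op_matrix e V i j))\<^sup>2) \<xi> n)"
      unfolding mat_apply_def by (rule sums_unique2[OF *])
    then show ?thesis by (simp add: op_matrix_def cinner_adj[OF e V] w_def)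
  qed
  then show ?thesis by (simp add: cond_exp_def)
qed

text \<open>Columns are the coordinates of the unit vectors \<open>V e\<^sub>j\<close>, so Parseval
  gives sum 1. Rows come from the adjoint, which is only contractive when \<open>V\<close> is not
  surjective, hence the inequality.\<close>

lemma isometry_column_stochastic:
  fixes e :: "nat \<Rightarrow> 'h::chilbert"
  assumes e: "orthonormal_basis e" and V: "isometry_op V"
  shows "column_stochastic (\<lambda>i j. (cmod (op_matrix e V i j))\<^sup>2)"
proof -
  have VB: "V \<in> bops" and nV: "\<And>x. norm (blinfun_apply V x) = norm x"
    using V by (simp_all add: isometry_op_def)
  have es: "suborthonormal e" and ne: "\<And>n. norm (e n) = 1" using orthonormal_basis_seq[OF e] by simp_all
  have col: "(\<lambda>i. (cmod (op_matrix e V i j))\<^sup>2) sums 1" for j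
    using parseval[OF e, of "blinfun_apply V (e j)"] by (simp add: op_matrix_def nV ne)
  have nadj: "norm (blinfun_apply (adj V) x) \<le> norm x" for x
  proof -
    define w where "w = blinfun_apply (adj V) x"
    have "complex_of_real ((norm w)\<^sup>2) = cinner (blinfun_apply V w) x"
      by (simp only: cinner_self[symmetric] w_def cinner_adj[OF e VB])
    then have "(norm w)\<^sup>2 = cmod (cinner (blinfun_apply V w) x)"
      by (metis norm_of_real abs_power2)
    also have "\<dots> \<le> norm w * norm x" using norm_cinner_le[of "blinfun_apply V w" x] by (simp add: nV)
    finally have "norm w * norm w \<le> norm w * norm x" by (simp add: power2_eq_square)
    then show ?thesis by (cases "w = 0") (simp_all add: w_def)
  qed
  have "cmod (op_matrix e V i j) = cmod (cinner (blinfun_apply (adj V) (e i)) (e j))" for i j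
    by (simp add: op_matrix_def cinner_adj[OF e VB] cmod_cinner_commute)
  moreover have "(norm (blinfun_apply (adj V) (e i)))\<^sup>2 \<le> 1" for i
    using nadj[of "e i"] by (simp add: ne power_le_one)
  ultimately have "summable (\<lambda>j. (cmod (op_matrix e V i j))\<^sup>2)" "(\<Sum>j. (cmod (op_matrix e V i j))\<^sup>2) \<le> 1" for i
    using bessel_summable[OF es, of "blinfun_apply (adj V) (e i)"] by (auto intro: order_trans)
  then show ?thesis
    using col by (simp add: column_stochastic_def substochastic_def sums_iff)
qed

lemma isometry_series_op:
  fixes e v :: "nat \<Rightarrow> 'h::chilbert"
  assumes e: "orthonormal_basis e" and v: "orthonormal_seq v"
  shows "isometry_op (series_op (\<lambda>n. 1) e v)"
proof -
  have es: "suborthonormal e" and vs: "suborthonormal v" and nv: "\<And>n. norm (v n) = 1"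
    using orthonormal_basis_seq[OF e] v by simp_all
  interpret U: series_op_data "\<lambda>n. 1" e v by (rule series_op_data_one[OF es vs])
  have "norm (blinfun_apply (series_op (\<lambda>n. 1) e v) x) = norm x" for x
  proof -
    let ?y = "blinfun_apply (series_op (\<lambda>n. 1) e v) x"
    have "(\<lambda>n. (cmod (cinner x (e n)))\<^sup>2) sums (norm ?y)\<^sup>2"
    proof -
      have "(\<lambda>n. 1 * cinner x (e n) * cinner (v n) ?y) sums cinner ?y ?y"
        by (rule U.cinner_series_op_sums)
      moreover have "1 * cinner x (e n) * cinner (v n) ?y = of_real ((cmod (cinner x (e n)))\<^sup>2)" for n
        unfolding cinner_commute[of "v n" ?y] U.cinner_series_op_right complex_norm_square
        by (simp add: nv)
      ultimately show ?thesis unfolding cinner_self by (simp only: sums_of_real_iff)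
    qed
    then have "(norm ?y)\<^sup>2 = (norm x)\<^sup>2" using parseval[OF e, of x] sums_unique2 by blast
    then show ?thesis by (simp add: power2_eq_iff_nonneg)
  qed
  then show ?thesis by (simp add: isometry_op_def U.series_op_bops)
qed

text \<open>The columns as vectors: each is a finite sum, its support lying in one block. Columns of
  different blocks are orthogonal because their supports are disjoint.\<close>

lemma block_orthogonal_columns:
  fixes e :: "nat \<Rightarrow> 'h::chilbert"
  assumes e: "orthonormal_seq e" and M: "block_orthogonal M"
  obtains v where "orthonormal_seq v" "\<And>i j. cinner (v j) (e i) = complex_of_real (M i j)"
proof -
  define A where "A j = {i. M i j \<noteq> 0}" for j
  define v where "v j = (\<Sum>i\<in>A j. complex_of_real (M i j) *\<^sub>C e i)" for j
  have A: "finite (A j)" for j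
  proof -
    from block_orthogonal_block[OF M, of j] obtain B where B: "finite B" "j \<in> B"
      "\<forall>i l. (i \<in> B) \<noteq> (l \<in> B) \<longrightarrow> M i l = 0" by blast
    then have "A j \<subseteq> B" "finite B" by (auto simp: A_def)
    then show ?thesis using finite_subset by blast
  qed
  have ve: "cinner (v j) (e i) = complex_of_real (M i j)" for i j
  proof -
    have "cinner (v j) (e i) = (\<Sum>l\<in>A j. if l = i then complex_of_real (M l j) else 0)"
      unfolding v_def cinner_sum_left cinner_scaleC_left
      by (rule sum.cong) (auto simp: orthonormal_seqD[OF e])
    then show ?thesis using A by (simp add: A_def)
  qed
  have "cinner (v j) (v k) = (if j = k then 1 else 0)" for j k
  proof -
    from block_orthogonal_block[OF M, of j] obtain B where B: "finite B" "j \<in> B"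
      "\<forall>i l. (i \<in> B) \<noteq> (l \<in> B) \<longrightarrow> M i l = 0"
      "\<forall>i\<in>B. \<forall>k\<in>B. (\<Sum>l\<in>B. M l i * M l k) = (if i = k then 1 else 0)" by blast
    have "cinner (e l) (v k) = complex_of_real (M l k)" for l
      using ve[of k l] cinner_commute[of "e l" "v k"] by simp
    then have "cinner (v j) (v k) = (\<Sum>l\<in>A j. complex_of_real (M l j * M l k))"
      by (simp add: v_def[of j] cinner_sum_left cinner_scaleC_left)
    also have "\<dots> = of_real (\<Sum>l\<in>A j. M l j * M l k)" by simp
    also have "(\<Sum>l\<in>A j. M l j * M l k) = (\<Sum>l\<in>B. M l j * M l k)"
      using B by (intro sum.mono_neutral_left) (auto simp: A_def)
    also have "\<dots> = (if j = k then 1 else 0)"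
    proof (cases "k \<in> B")
      case True
      then show ?thesis using B by simp
    next
      case False
      then show ?thesis using B(2,3) by (auto intro!: sum.neutral)
    qed
    finally show ?thesis by simp
  qed
  then show ?thesis using ve by (intro that[of v]) (auto simp: orthonormal_seq_def)
qed

text \<open>The equivalence is used in both directions: existence yields the operator for (iv') from
  the matrix in (iii'), and uniqueness shows that an operator given in (iv') by its matrix alone is
  an isometry, as (iv) demands.\<close>

lemma isometry_of_block_orthogonal_matrix:
  fixes e :: "nat \<Rightarrow> 'h::chilbert"
  assumes e: "orthonormal_basis e" and M: "block_orthogonal M"
  shows "\<exists>U. isometry_op U \<and>
    (\<forall>U'. U' \<in> bops \<and> (\<forall>i j. op_matrix e U' i j = complex_of_real (M i j)) \<longleftrightarrow> U' = U)"
proof -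
  note es = orthonormal_basis_seq[OF e]
  obtain v where v: "orthonormal_seq v" and ve: "\<And>i j. cinner (v j) (e i) = complex_of_real (M i j)"
    by (rule block_orthogonal_columns[OF es M], rule that) simp_all
  interpret U: series_op_data "\<lambda>n. 1" e v by (rule series_op_data_one) (use es v in simp_all)
  have Ue: "blinfun_apply (series_op (\<lambda>n. 1) e v) (e n) = v n" for n
    using U.series_op_apply_left[of n] es by (simp add: scaleC_one)
  show ?thesis
  proof (intro exI[of _ "series_op (\<lambda>n. 1) e v"] conjI allI iffI)
    show "isometry_op (series_op (\<lambda>n. 1) e v)" by (rule isometry_series_op[OF e v])
  next
    fix U' assume "U' = series_op (\<lambda>n. 1) e v"
    then show "U' \<in> bops" "op_matrix e U' i j = complex_of_real (M i j)" for i j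
      by (simp_all add: U.series_op_bops op_matrix_def Ue ve)
  next
    fix U' assume U': "U' \<in> bops \<and> (\<forall>i j. op_matrix e U' i j = complex_of_real (M i j))"
    have "blinfun_apply U' (e n) = v n" for n
      by (rule orthonormal_basis_eqI[OF e]) (use U' in \<open>simp add: op_matrix_def ve\<close>)
    then show "U' = series_op (\<lambda>n. 1) e v"
      using U' by (intro bops_eqI[OF e _ U.series_op_bops]) (simp_all add: Ue)
  qed
qed

section \<open>The am-infinity closure\<close>

lemma tail_antimono:
  assumes "\<xi> \<in> l1star"
  shows "(\<Sum>j. \<xi> (j + Suc n)) \<le> (\<Sum>j. \<xi> (j + n))"
  using suminf_split_initial_segment[OF l1starD(4)[OF assms], of n]
    suminf_split_initial_segment[OF l1starD(4)[OF assms], of "Suc n"] l1starD(2)[OF assms, of n]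
  by simp

lemma tail_nonneg: "\<xi> \<in> l1star \<Longrightarrow> 0 \<le> (\<Sum>j. \<xi> (j + n))"
  using l1starD by (intro suminf_nonneg) (auto simp: summable_iff_shift)

lemma amean_inf_c0star:
  assumes \<xi>: "\<xi> \<in> l1star"
  shows "amean_inf \<xi> \<in> c0star"
proof -
  note t0 = tail_nonneg[OF \<xi>]
  have "amean_inf \<xi> (Suc n) \<le> amean_inf \<xi> n" for n
    unfolding amean_inf_def using t0[of "Suc n"] tail_antimono[OF \<xi>, of "Suc n"] by (intro frac_le) auto
  then have "decseq (amean_inf \<xi>)" by (simp add: decseq_Suc_iff)
  moreover have a0: "0 \<le> amean_inf \<xi> n" for n unfolding amean_inf_def using t0[of "Suc n"] by (intro divide_nonneg_nonneg) auto
  moreover have "amean_inf \<xi> \<longlonglongrightarrow> 0"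
  proof (rule tendsto_sandwich[OF _ _ tendsto_const LIMSEQ_Suc[OF suminf_exist_split2[OF l1starD(4)[OF \<xi>]]]])
    show "\<forall>\<^sub>F n in sequentially. amean_inf \<xi> n \<le> (\<Sum>i. \<xi> (i + Suc n))"
    proof (intro always_eventually allI)
      show "amean_inf \<xi> n \<le> (\<Sum>i. \<xi> (i + Suc n))" for n
        unfolding amean_inf_def using mult_left_mono[OF _ t0[of "Suc n"], of 1 "real (Suc n)"]
        by (simp add: divide_le_eq)
    qed
  qed (simp add: a0)
  ultimately show ?thesis by (simp add: c0star_def)
qed

context trace_ideal
begin

lemma charset_am_inf_closure_iff:
  assumes \<xi>: "\<xi> \<in> l1star"
  shows "\<xi> \<in> charset (am_inf_closure I) \<longleftrightarrow> (\<exists>\<eta> \<in> charset I. amean_inf \<xi> \<in> O(amean_inf \<eta>))"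
proof -
  have "I \<inter> trace_class = I" using tc by blast
  then have "charset (post_ainf I) = {\<zeta> \<in> c0star. \<exists>\<eta> \<in> charset I. \<zeta> \<in> O(amean_inf \<eta>)}"
    unfolding post_ainf_def by (subst charset_ideal_of_charset[OF e]) auto
  moreover have "charset (am_inf_closure I) = {\<zeta> \<in> l1star. amean_inf \<zeta> \<in> charset (post_ainf I)}"
    unfolding am_inf_closure_def pre_ainf_def
    by (subst charset_ideal_of_charset[OF e]) (auto simp: l1star_def)
  ultimately show ?thesis using \<xi> amean_inf_c0star[OF \<xi>] by simp
qed

text \<open>From (i), \<open>O\<close> compares the tails only from some index on. Adding a constant
  of the size of the whole sum of \<xi> on an initial stretch repairs the remaining tails; such
  finitely supported sequences are available since the ideal is nonzero.\<close>

lemma am_inf_closure_iff_majorized_inf: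
  assumes \<xi>: "\<xi> \<in> l1star" and nz: "I \<noteq> {0}"
  shows "\<xi> \<in> charset (am_inf_closure I) \<longleftrightarrow> (\<exists>\<eta> \<in> charset I. majorized_inf \<xi> \<eta>)"
  unfolding charset_am_inf_closure_iff[OF \<xi>]
proof
  assume "\<exists>\<eta> \<in> charset I. majorized_inf \<xi> \<eta>"
  then obtain \<eta> where \<eta>: "\<eta> \<in> charset I" and maj: "majorized_inf \<xi> \<eta>" by blast
  have "amean_inf \<xi> \<in> O(amean_inf \<eta>)"
  proof (rule bigoI[of _ 1], intro always_eventually allI)
    fix n
    have "(\<Sum>j. \<xi> (j + Suc n)) \<le> (\<Sum>j. \<eta> (j + Suc n))"
      using maj unfolding majorized_inf_def by blast
    then have "amean_inf \<xi> n \<le> amean_inf \<eta> n"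
      unfolding amean_inf_def by (rule divide_right_mono) simp
    then show "norm (amean_inf \<xi> n) \<le> 1 * norm (amean_inf \<eta> n)"
      using amean_inf_c0star[OF \<xi>] by (simp add: c0star_def)
  qed
  then show "\<exists>\<eta> \<in> charset I. amean_inf \<xi> \<in> O(amean_inf \<eta>)" using \<eta> by blast
next
  assume "\<exists>\<eta> \<in> charset I. amean_inf \<xi> \<in> O(amean_inf \<eta>)"
  then obtain \<eta> where \<eta>: "\<eta> \<in> charset I" and "amean_inf \<xi> \<in> O(amean_inf \<eta>)" by blast
  then obtain c where c: "c > 0" and
    "eventually (\<lambda>n. norm (amean_inf \<xi> n) \<le> c * norm (amean_inf \<eta> n)) sequentially"
    by (elim landau_o.bigE)
  then obtain N where N: "\<And>n. n \<ge> N \<Longrightarrow> norm (amean_inf \<xi> n) \<le> c * norm (amean_inf \<eta> n)"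
    by (auto simp: eventually_sequentially)
  have \<eta>1: "\<eta> \<in> l1star" by (rule charset_l1star[OF \<eta>])
  define M where "M = (\<Sum>j. \<xi> j)"
  have M: "0 \<le> M" using tail_nonneg[OF \<xi>, of 0] by (simp add: M_def)
  \<comment> \<open>The stretch includes the index N, so every tail starting at or before N contains
    an entry of size at least \<open>M\<close>.\<close>
  define \<zeta> where "\<zeta> n = c * \<eta> n + (if n < Suc N then M else 0)" for n
  have \<zeta>: "\<zeta> \<in> charset I"
    unfolding \<zeta>_def[abs_def] using c by (intro charset_add charset_scale \<eta> charset_finite_support nz M) simp
  have \<zeta>1: "\<zeta> \<in> l1star" by (rule charset_l1star[OF \<zeta>])
  have "(\<Sum>j. \<xi> (j + n)) \<le> (\<Sum>j. \<zeta> (j + n))" for n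
  proof (cases "n \<le> N")
    case True
    have "(\<Sum>j. \<xi> (j + n)) \<le> M"
      unfolding M_def suminf_split_initial_segment[OF l1starD(4)[OF \<xi>], of n]
      using l1starD(2)[OF \<xi>] by (simp add: sum_nonneg)
    also have "M \<le> \<zeta> (N - n + n)" using True c l1starD(2)[OF \<eta>1, of N] by (simp add: \<zeta>_def)
    also have "\<dots> = (\<Sum>j\<in>{N - n}. \<zeta> (j + n))" by simp
    also have "\<dots> \<le> (\<Sum>j. \<zeta> (j + n))"
      using l1starD[OF \<zeta>1] by (intro sum_le_suminf) (auto simp: summable_iff_shift)
    finally show ?thesis .
  next
    case False
    \<comment> \<open>\<open>amean_inf\<close> at m involves the tail from \<open>Suc m\<close> on,
      so the bound valid from N on covers exactly the tails starting after N.\<close>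
    then obtain m where m: "n = Suc m" "N \<le> m" by (cases n) auto
    have "amean_inf \<xi> m \<le> c * amean_inf \<eta> m"
      using N[OF m(2)] amean_inf_c0star[OF \<xi>] amean_inf_c0star[OF \<eta>1] by (simp add: c0star_def)
    then have "(\<Sum>j. \<xi> (j + n)) \<le> c * (\<Sum>j. \<eta> (j + n))"
      by (simp add: amean_inf_def m(1) divide_le_cancel)
    also have "\<dots> = (\<Sum>j. c * \<eta> (j + n))"
      using l1starD(4)[OF \<eta>1] by (intro suminf_mult[symmetric]) (simp add: summable_iff_shift)
    also have "\<dots> \<le> (\<Sum>j. \<zeta> (j + n))"
    proof (rule suminf_le)
      show "c * \<eta> (j + n) \<le> \<zeta> (j + n)" for j using M by (simp add: \<zeta>_def)
      show "summable (\<lambda>j. c * \<eta> (j + n))"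
        using l1starD(4)[OF \<eta>1] by (intro summable_mult) (simp add: summable_iff_shift)
      show "summable (\<lambda>j. \<zeta> (j + n))" using l1starD(4)[OF \<zeta>1] by (simp add: summable_iff_shift)
    qed
    finally show ?thesis .
  qed
  then show "\<exists>\<eta> \<in> charset I. majorized_inf \<xi> \<eta>" using \<zeta> by (auto simp: majorized_inf_def)
qed

end

text \<open>The sequence conditions form the cycle (ii), (iii'), (iii), (ii''), (ii'), (ii). The
  operator conditions hang on it by the chain (iii'), (iv'), (iv), (ii''). Only the equivalence with
  (i) is proved separately.\<close>

theorem proposition4p3:
  fixes e :: "nat \<Rightarrow> 'h::chilbert"
    and I :: "('h \<Rightarrow>\<^sub>L 'h) set"
    and \<xi> :: "nat \<Rightarrow> real"
  assumes "orthonormal_basis e"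
    and "op_ideal I"
    and "I \<subseteq> trace_class"
    and "\<xi> \<in> l1star"
  defines "i \<equiv> \<xi> \<in> charset (am_inf_closure I)"
    and "ii \<equiv> \<exists>\<eta> \<in> charset I. majorized_inf \<xi> \<eta>"
    and "ii' \<equiv> \<exists>\<eta> \<in> charset I. strongly_majorized_inf \<xi> \<eta>"
    and "ii'' \<equiv> \<exists>\<eta> \<in> charset I. strongly_majorized \<eta> \<xi>"
    and "iii \<equiv> \<exists>P. column_stochastic P \<and> mat_apply P \<xi> \<in> charset I"
    and "iii' \<equiv> \<exists>Q. block_orthostochastic Q \<and> mat_apply Q \<xi> \<in> charset I"
    and "iv \<equiv> \<exists>V. isometry_op V \<and>
           cond_exp e (V o\<^sub>L diag_op e (\<lambda>n. complex_of_real (\<xi> n)) o\<^sub>L adj V) \<in> I"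
    and "iv' \<equiv> \<exists>U \<in> bops. (\<exists>M. block_orthogonal M \<and>
             (\<forall>i j. op_matrix e U i j = complex_of_real (M i j))) \<and>
           cond_exp e (U o\<^sub>L diag_op e (\<lambda>n. complex_of_real (\<xi> n)) o\<^sub>L adj U) \<in> I"
  shows "(I \<noteq> {0} \<longrightarrow> (i \<longleftrightarrow> ii)) \<and> (ii \<longleftrightarrow> ii') \<and> (ii' \<longleftrightarrow> ii'') \<and> (ii'' \<longleftrightarrow> iii) \<and>
         (iii \<longleftrightarrow> iii') \<and> (iii' \<longleftrightarrow> iv) \<and> (iv \<longleftrightarrow> iv')"
proof -
  interpret trace_ideal e I using assms(1-3) by unfold_locales
  note \<xi> = assms(4)
  have \<xi>c: "\<xi> \<in> c0star" using \<xi> by (simp add: l1star_def)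
  have "ii" if "ii'" using that by (auto simp: ii_def ii'_def strongly_majorized_inf_def)
  moreover have "ii'" if "ii''"
    using that strongly_majorized_imp_strongly_majorized_inf[OF \<xi> charset_l1star]
    by (auto simp: ii'_def ii''_def)
  moreover have "ii''" if asm: "iii"
  proof -
    obtain P where P: "column_stochastic P" "mat_apply P \<xi> \<in> charset I" using asm by (auto simp: iii_def)
    \<comment> \<open>The identity serves as the rearrangement, since a member of the characteristic
      set is already decreasing.\<close>
    have "strongly_majorized (mat_apply P \<xi> \<circ> (\<lambda>n. n)) \<xi>"
      by (rule strongly_majorized_rearrangement[OF P(1) \<xi>]) auto
    then show ?thesis using P(2) by (auto simp: ii''_def o_def)
  qed
  moreover have "iii" if "iii'"
    using that block_orthostochastic_column_stochastic by (auto simp: iii_def iii'_def)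
  moreover have "iii'" if asm: "ii"
  proof -
    obtain \<eta> where \<eta>: "\<eta> \<in> charset I" "majorized_inf \<xi> \<eta>" using asm by (auto simp: ii_def)
    obtain Q where Q: "block_orthostochastic Q" "mat_apply Q \<xi> \<in> c0star" "\<And>n. mat_apply Q \<xi> n \<le> 2 * \<eta> n"
      using block_orthostochastic_majorization[OF \<xi> charset_l1star[OF \<eta>(1)] \<eta>(2)] by blast
    have "mat_apply Q \<xi> \<in> charset I"
      by (rule charset_mono[OF charset_scale[OF \<eta>(1), of 2] Q(2)]) (use Q(3) in simp_all)
    then show ?thesis using Q(1) by (auto simp: iii'_def)
  qed
  moreover have "iv'" if asm: "iii'"
  proof -
    obtain M where M: "block_orthogonal M" "mat_apply (\<lambda>i j. (M i j)\<^sup>2) \<xi> \<in> charset I"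
    proof -
      obtain Q where Q: "block_orthostochastic Q" "mat_apply Q \<xi> \<in> charset I"
        using asm by (auto simp: iii'_def)
      then obtain M where M: "block_orthogonal M" "\<And>i j. Q i j = (M i j)\<^sup>2"
        by (auto simp: block_orthostochastic_def)
      then have "Q = (\<lambda>i j. (M i j)\<^sup>2)" by (intro ext)
      then show thesis using that M Q by blast
    qed
    from isometry_of_block_orthogonal_matrix[OF e M(1)]
    obtain U where UB: "U \<in> bops" and U: "\<And>i j. op_matrix e U i j = complex_of_real (M i j)" by blast
    have "cond_exp e (U o\<^sub>L real_diag e \<xi> o\<^sub>L adj U) = real_diag e (mat_apply (\<lambda>i j. (M i j)\<^sup>2) \<xi>)"
      unfolding cond_exp_conjugate[OF e UB \<xi>c] by (simp add: U)
    then have "cond_exp e (U o\<^sub>L real_diag e \<xi> o\<^sub>L adj U) \<in> I"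
      using M(2) by (simp add: charset_iff)
    then show ?thesis using UB M(1) U by (auto simp: iv'_def)
  qed
  moreover have "iv" if asm: "iv'"
  proof -
    obtain U M where U: "U \<in> bops" "block_orthogonal M" "\<And>i j. op_matrix e U i j = complex_of_real (M i j)"
      "cond_exp e (U o\<^sub>L real_diag e \<xi> o\<^sub>L adj U) \<in> I"
      using asm by (auto simp: iv'_def)
    from isometry_of_block_orthogonal_matrix[OF e U(2)] obtain W where W: "isometry_op W"
      "\<And>U'. U' \<in> bops \<and> (\<forall>i j. op_matrix e U' i j = complex_of_real (M i j)) \<longleftrightarrow> U' = W" by blast
    have "U = W" using U(1,3) W(2)[of U] by simp
    then have "isometry_op U" using W(1) by simp
    then show ?thesis using U(4) by (auto simp: iv_def)
  qed
  moreover have "ii''" if asm: "iv"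
  proof -
    obtain V where V: "isometry_op V" "cond_exp e (V o\<^sub>L real_diag e \<xi> o\<^sub>L adj V) \<in> I"
      using asm by (auto simp: iv_def)
    have VB: "V \<in> bops" using V(1) by (simp add: isometry_op_def)
    define P where "P = (\<lambda>i j. (cmod (op_matrix e V i j))\<^sup>2)"
    have P: "column_stochastic P" unfolding P_def by (rule isometry_column_stochastic[OF e V(1)])
    define b where "b = mat_apply P \<xi>"
    have bI: "real_diag e b \<in> I"
      using V(2) unfolding cond_exp_conjugate[OF e VB \<xi>c] P_def[symmetric] b_def .
    have b0: "0 \<le> b n" for n unfolding b_def by (rule mat_apply_nonneg[OF P \<xi>])
    have sb: "summable b" unfolding b_def by (rule summable_mat_apply[OF P \<xi>])
    have bb: "\<bar>b n\<bar> \<le> (\<Sum>n. b n)" for n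
      using sum_le_suminf[OF sb, of "{n}"] b0 by simp
    \<comment> \<open>The diagonal \<open>b\<close> lies in the ideal as an operator but may fail to
      decrease, so it is rearranged before being compared with \<xi>.\<close>
    obtain \<sigma> where \<sigma>: "inj \<sigma>" "\<And>i. b i \<noteq> 0 \<Longrightarrow> i \<in> range \<sigma>" "b \<circ> \<sigma> \<in> c0star"
      using ex_decreasing_rearrangement[OF b0 summable_LIMSEQ_zero[OF sb]] by blast
    have "b \<circ> \<sigma> \<in> charset I" by (rule charset_rearrangement[OF bI bb \<sigma>(1,3)])
    moreover have "strongly_majorized (b \<circ> \<sigma>) \<xi>"
      unfolding b_def by (rule strongly_majorized_rearrangement[OF P \<xi> \<sigma>(1)]) (use \<sigma>(2) in \<open>simp add: b_def\<close>)
    ultimately show ?thesis by (auto simp: ii''_def)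
  qed
  moreover have "i \<longleftrightarrow> ii" if "I \<noteq> {0}"
    unfolding i_def ii_def by (rule am_inf_closure_iff_majorized_inf[OF \<xi> that])
  ultimately show ?thesis by blast
qed

end
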